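(* Let $Y=\{Y(t),t\geqslant 0\}$ be a real-valued Lévy process, let $\omega>0$ and $\beta\geqslant 0$; if $\beta=0$, assume in addition that $\mathbb{E}\,Y(1)<0$. Let $\overline Y(t)=\sup_{s\in[0,t]}Y(s)$, and let $T_\beta$ and $T_{\beta+\omega}$ be exponentially distributed random variables with parameters $\beta$ and $\beta+\omega$, each independent of $Y$. Let $Y_{\beta,\omega}$ be the running maximum of $Y$ at Poisson($\omega$) inspection epochs until the exponential($\beta$) killing time (as defined in the context). Then $$\overline Y(T_\beta)\stackrel{\rm d}{=}Y_{\beta,\omega}+\overline Y(T_{\beta+\omega}),$$ where the two terms on the right-hand side are taken to be independent (i.e., the law of $\overline Y(T_\beta)$ is the convolution of the law of $Y_{\beta,\omega}$ and the law of $\overline Y(T_{\beta+\omega})$).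
   Context: $Y(0)=0$. The process $Y$ is inspected at the epochs $0=I_0<I_1<I_2<\dots$ of a Poisson process of intensity $\omega$, independent of $Y$, until an independent exponentially distributed killing time $T_\beta$ with parameter $\beta$. Let $N_{\beta,\omega}$ be the number of inspections before killing, so $\mathbb{P}(N_{\beta,\omega}=n)=\left(\frac{\omega}{\beta+\omega}\right)^n\frac{\beta}{\beta+\omega}$, $n=0,1,\dots$. Let $Z_1,Z_2,\dots$ be the increments of $Y$ between consecutive inspection epochs, conditioned on the process not having been killed; they are i.i.d., distributed as $Y(T_{\beta+\omega})$ with $T_{\beta+\omega}$ exponential with parameter $\beta+\omega$ and independent of $Y$, and they are independent of $N_{\beta,\omega}$. With $S_0=0$ and $S_n=\sum_{m=1}^n Z_m$, define $Y_{\beta,\omega}:=\max_{0\leqslant n\leqslant N_{\beta,\omega}}S_n$. (Equivalently, in law, $Y_{\beta,\omega}$ is the maximum of $Y(I_n)$ over all $n\geqslant 0$ with $I_n\leqslant T_\beta$.) For $\beta=0$ we use the convention $T_0=\infty$, $N_{0,\omega}=\infty$, so that $\overline Y(T_0)=\sup_{t\geqslant 0}Y(t)$ and $Y_{0,\omega}=\sup_{n\geqslant 0}S_n$. *)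

theory Defs
  imports "HOL-Probability.Probability"
begin

text \<open>Independence of two random elements whose value types may differ; the library's
  \<open>indep_var\<close> requires equal types.\<close>

definition indep_elements ::
  "'a measure \<Rightarrow> 'b measure \<Rightarrow> ('a \<Rightarrow> 'b) \<Rightarrow> 'c measure \<Rightarrow> ('a \<Rightarrow> 'c) \<Rightarrow> bool" where
  "indep_elements M A X B Y \<longleftrightarrow>
     X \<in> measurable M A \<and> Y \<in> measurable M B \<and>
     prob_space.indep_set M {X -` S \<inter> space M | S. S \<in> sets A} {Y -` S \<inter> space M | S. S \<in> sets B}"

definition cadlag :: "(real \<Rightarrow> real) \<Rightarrow> bool" where
  "cadlag f \<longleftrightarrow>
     (\<forall>t\<ge>0. (f \<longlongrightarrow> f t) (at_right t)) \<and>
     (\<forall>t>0. \<exists>l. (f \<longlongrightarrow> l) (at_left t))"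

text \<open>Only the values of a process at times \<open>t \<ge> 0\<close> matter; what it does at negative times
  is unconstrained. As usual, the path properties are required almost surely.\<close>

definition levy_process :: "'a measure \<Rightarrow> (real \<Rightarrow> 'a \<Rightarrow> real) \<Rightarrow> bool" where
  "levy_process M Y \<longleftrightarrow>
     prob_space M \<and>
     (\<forall>t\<ge>0. Y t \<in> borel_measurable M) \<and>
     (AE x in M. Y 0 x = 0) \<and>
     (\<forall>(n::nat) t. 0 \<le> t 0 \<and> (\<forall>k<n. t k \<le> t (Suc k)) \<longrightarrow>
        prob_space.indep_vars M (\<lambda>_. borel) (\<lambda>k x. Y (t (Suc k)) x - Y (t k) x) {..<n}) \<and>
     (\<forall>s\<ge>0. \<forall>t\<ge>0. distr M borel (\<lambda>x. Y (s + t) x - Y s x) = distr M borel (Y t)) \<and>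
     (AE x in M. cadlag (\<lambda>t. Y t x))"

text \<open>The process as one random element of \<open>PiM {0..} (\<lambda>_. borel)\<close>, whose pulled-back
  \<open>\<sigma>\<close>-algebra is the one generated by all \<open>Y t\<close> with \<open>t \<ge> 0\<close>.\<close>

definition path_of :: "(real \<Rightarrow> 'a \<Rightarrow> real) \<Rightarrow> 'a \<Rightarrow> real \<Rightarrow> real" where
  "path_of Y x = (\<lambda>t\<in>{0..}. Y t x)"

text \<open>The law is taken under the completed measure because path functionals such as suprema
  over uncountable sets are measurable only up to null sets when paths are cadlag merely almost
  surely. For \<open>X \<in> borel_measurable M\<close> it is the same as \<open>distr M borel X\<close>.\<close>

definition law :: "'a measure \<Rightarrow> ('a \<Rightarrow> 'b::topological_space) \<Rightarrow> 'b measure" where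
  "law M X = distr (completion M) borel X"

text \<open>Maxima are taken in \<^typ>\<open>ereal\<close>, so that an unbounded path has supremum \<open>\<infinity>\<close> instead of an
  unspecified real number. The library's convolution is restricted to Euclidean spaces; this is
  the same definition on \<^typ>\<open>ereal\<close>.\<close>

definition ereal_convolution :: "ereal measure \<Rightarrow> ereal measure \<Rightarrow> ereal measure" where
  "ereal_convolution \<mu> \<nu> = distr (\<mu> \<Otimes>\<^sub>M \<nu>) borel (\<lambda>(u, v). u + v)"

text \<open>The mean \<open>E X\<^sup>+ - E X\<^sup>-\<close> with values in \<open>[-\<infinity>, \<infinity>]\<close>. It equals \<open>\<infinity>\<close> if both parts are
  infinite, so a negative value means that the mean exists and is negative, possibly \<open>-\<infinity>\<close>.\<close>

definition ext_expectation :: "'a measure \<Rightarrow> ('a \<Rightarrow> real) \<Rightarrow> ereal" where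
  "ext_expectation M X =
     enn2ereal (\<integral>\<^sup>+x. ennreal (X x) \<partial>M) - enn2ereal (\<integral>\<^sup>+x. ennreal (- X x) \<partial>M)"

text \<open>Exponential with parameter \<open>\<beta>\<close>, with \<open>T = \<infinity>\<close> for \<open>\<beta> = 0\<close>.\<close>

definition killing_time :: "'a measure \<Rightarrow> real \<Rightarrow> ('a \<Rightarrow> ereal) \<Rightarrow> bool" where
  "killing_time M \<beta> T \<longleftrightarrow>
     T \<in> borel_measurable M \<and>
     (if \<beta> = 0 then AE x in M. T x = \<infinity>
      else \<exists>U. distributed M lborel U (exponential_density \<beta>) \<and> (AE x in M. T x = ereal (U x)))"

text \<open>The supremum of the path over \<open>[0, u]\<close>, or over \<open>[0, \<infinity>)\<close> if \<open>u = \<infinity>\<close>.\<close>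

definition running_sup :: "(real \<Rightarrow> 'a \<Rightarrow> real) \<Rightarrow> ereal \<Rightarrow> 'a \<Rightarrow> ereal" where
  "running_sup Y u x = (SUP s\<in>{s. 0 \<le> s \<and> ereal s \<le> u}. ereal (Y s x))"

definition poisson_epochs :: "'a measure \<Rightarrow> real \<Rightarrow> (nat \<Rightarrow> 'a \<Rightarrow> real) \<Rightarrow> bool" where
  "poisson_epochs M \<omega> I \<longleftrightarrow>
     (\<forall>x\<in>space M. I 0 x = 0) \<and>
     (\<forall>n. distributed M lborel (\<lambda>x. I (Suc n) x - I n x) (exponential_density \<omega>)) \<and>
     prob_space.indep_vars M (\<lambda>_. borel) (\<lambda>n x. I (Suc n) x - I n x) UNIV"

definition num_inspections :: "(nat \<Rightarrow> 'a \<Rightarrow> real) \<Rightarrow> ('a \<Rightarrow> ereal) \<Rightarrow> 'a \<Rightarrow> enat" where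
  "num_inspections I T x =
     (let A = {n. 1 \<le> n \<and> ereal (I n x) \<le> T x} in if finite A then enat (card A) else \<infinity>)"

text \<open>\<open>max\<^bsub>0 \<le> n \<le> N\<^esub> S\<^sub>n\<close> with \<open>S\<^sub>n = Z\<^sub>1 + \<dots> + Z\<^sub>n\<close>, a supremum over all \<open>n\<close> if \<open>N = \<infinity>\<close>.\<close>

definition walk_max :: "(nat \<Rightarrow> 'a \<Rightarrow> real) \<Rightarrow> ('a \<Rightarrow> enat) \<Rightarrow> 'a \<Rightarrow> ereal" where
  "walk_max Z N x = (SUP n\<in>{n. enat n \<le> N x}. ereal (\<Sum>m=1..n. Z m x))"

end

(* A path run up to an independent exponential time with parameter \<lambda> = \<beta> + \<omega> has a supremum M and a
   drawdown D = M - Y(T) that are independent (Wiener--Hopf). For a random walk killed at a geometric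
   time this follows by cutting the path at its first maximum; the Levy case is the limit along the
   grids of mesh 1/n. Cut the path at a sum of k + 1 independent exponential times. The supremum is the
   maximum of S_n + M_(n+1) over n \<le> k, where S_n is the sum of the increments M_i - D_i, i \<le> n.
   Writing S_n + M_(n+1) as M_1 plus the sum of M_(i+1) - D_i over i \<le> n, and using that
   M_(i+1) - D_i has the law of an increment, one finds M_1 plus an independent maximum of a walk
   with k steps. Finally the exponential time with parameter \<beta> is a sum of N + 1 such times with N
   geometric, and for \<beta> = 0 one lets k tend to infinity. *)

theory Submission
  imports Defs
begin

section \<open>Suprema of cadlag paths\<close>

text \<open>Everything is carried by distribution functions at real levels: \<open>sup_cdf t\<close>
  for the supremum over [0, t], \<open>erlang_sup_cdf k\<close> for an Erlang time with k + 1
  phases, \<open>walk_cdf k\<close> for a walk with k steps. No process is restarted at a random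
  time: the Markov property is proved at deterministic times, and exponential times enter by
  integrating against their density. The regrouping works because the independence of M and D allows
  D_i to be replaced by the drawdown of an independent copy, so that M_(i+1) - D_i and M_i - D_i
  have one law. Rounding an exponential time down to a grid gives a geometric index, which is why
  the walk identity applies before the limit. The rounded times approach T from the left, whereas
  cadlag paths are only right-continuous; the absence of jumps at a fixed time closes this gap. A
  second obstacle is measurability: a supremum over an interval depends on uncountably many
  coordinates of the path, so the measurable versions \<open>path_value\<close> and
  \<open>path_sup\<close> stand in for value and supremum and agree with them almost surely.\<close>

lemma cadlag_at_right: "cadlag f \<Longrightarrow> 0 \<le> t \<Longrightarrow> (f \<longlongrightarrow> f t) (at_right t)"
  by (simp add: cadlag_def)

lemma right_continuous_gt:
  fixes f :: "real \<Rightarrow> real"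
  assumes "(f \<longlongrightarrow> f t) (at_right t)" "a < f t"
  obtains d where "d > 0" "\<And>r. t \<le> r \<Longrightarrow> r < t + d \<Longrightarrow> a < f r"
proof -
  obtain b where b: "b > t" "\<And>r. t < r \<Longrightarrow> r < b \<Longrightarrow> a < f r"
    using order_tendstoD(1)[OF assms] by (auto simp: eventually_at_right_field)
  show thesis
    by (rule that[of "b - t"]) (use b assms(2) in \<open>auto simp: le_less\<close>)
qed

text \<open>One-sided limits bound f above on a neighbourhood of each point, and compactness of
  [0, t] leaves finitely many neighbourhoods.\<close>

lemma cadlag_bounded:
  assumes f: "cadlag f"
  obtains B where "\<And>r. 0 \<le> r \<Longrightarrow> r \<le> t \<Longrightarrow> f r \<le> B"
proof -
  have "\<exists>U. open U \<and> s \<in> U \<and> (\<exists>B. \<forall>r\<in>U \<inter> {0..t}. f r \<le> B)" if s: "s \<in> {0..t}" for s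
  proof -
    obtain b where b: "b > s" "\<And>r. s < r \<Longrightarrow> r < b \<Longrightarrow> f r < f s + 1"
      using order_tendstoD(2)[OF cadlag_at_right[OF f], of s "f s + 1"] s
      by (auto simp: eventually_at_right_field)
    obtain c B where c: "c < s" "\<And>r. c < r \<Longrightarrow> r < s \<Longrightarrow> 0 \<le> r \<Longrightarrow> f r \<le> B"
    proof (cases "s = 0")
      case True
      \<comment> \<open>To the left of 0 there is nothing to bound, so any negative c
        serves.\<close>
      then show thesis by (intro that[of "-1"]) auto
    next
      case False
      then obtain l where "(f \<longlongrightarrow> l) (at_left s)" using f s by (force simp: cadlag_def)
      from order_tendstoD(2)[OF this, of "l + 1"] obtain c where
        "c < s" "\<And>r. c < r \<Longrightarrow> r < s \<Longrightarrow> f r < l + 1"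
        by (auto simp: eventually_at_left_field)
      then show thesis by (intro that[of c "l + 1"]) (auto intro: less_imp_le)
    qed
    have "f r \<le> max B (f s + 1)" if "r \<in> {c<..<b} \<inter> {0..t}" for r
      using that b(2)[of r] c(2)[of r] by (cases r s rule: linorder_cases) auto
    then show ?thesis using b(1) c(1)
      by (intro exI[of _ "{c<..<b}"] conjI exI[of _ "max B (f s + 1)"]) auto
  qed
  then obtain U where U: "\<And>s. s \<in> {0..t} \<Longrightarrow> open (U s)" "\<And>s. s \<in> {0..t} \<Longrightarrow> s \<in> U s"
      "\<And>s. s \<in> {0..t} \<Longrightarrow> \<exists>B. \<forall>r\<in>U s \<inter> {0..t}. f r \<le> B"
    by metis
  obtain B where B: "\<And>s r. s \<in> {0..t} \<Longrightarrow> r \<in> U s \<inter> {0..t} \<Longrightarrow> f r \<le> B s"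
    using U(3) by metis
  obtain D where D: "D \<subseteq> {0..t}" "finite D" "{0..t} \<subseteq> (\<Union>s\<in>D. U s)"
    using compactE_image[OF compact_Icc, of "{0..t}" U 0 t] U by (metis UN_iff subsetI)
  have "f r \<le> Max (B ` D)" if r: "0 \<le> r" "r \<le> t" for r
  proof -
    obtain s where s: "s \<in> D" "r \<in> U s" using D(3) r by auto
    then have "f r \<le> B s" using B[of s r] D(1) r by auto
    also have "\<dots> \<le> Max (B ` D)" using s D(2) by auto
    finally show ?thesis .
  qed
  then show thesis by (rule that)
qed

text \<open>If f exceeds y at r, right-continuity keeps it above y on some [r, r + d), and every
  grid finer than d has a point there; the right endpoint is itself a grid point. The two events are
  equal for all large m, so their indicators converge pointwise, with no loss at the level
  y.\<close>

lemma grid_sup_le_eventually: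
  fixes f :: "real \<Rightarrow> real"
  assumes f: "cadlag f" and a: "0 \<le> a" and s: "0 \<le> s"
  shows "\<forall>\<^sub>F m in sequentially.
    (\<forall>i\<le>m. f (a + s * (real i / real m)) \<le> y) \<longleftrightarrow> (\<forall>r\<in>{a..a + s}. f r \<le> y)"
proof (cases "\<forall>r\<in>{a..a + s}. f r \<le> y")
  case True
  have "a + s * (real i / real m) \<in> {a..a + s}" if "i \<le> m" for i m
  proof -
    have "s * (real i / real m) \<le> s * 1"
      using that s by (intro mult_left_mono) (auto simp: divide_le_eq_1)
    then show ?thesis using s by simp
  qed
  then show ?thesis using True by (intro always_eventually) auto
next
  case False
  then obtain r where r: "a \<le> r" "r \<le> a + s" "y < f r" by force
  have "\<forall>\<^sub>F m in sequentially. \<exists>i\<le>m. y < f (a + s * (real i / real m))"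
  proof (cases "r = a + s")
    case True
    then have "\<exists>i\<le>m. y < f (a + s * (real i / real m))" if "m \<ge> 1" for m
      using that r by (intro exI[of _ m]) auto
    then show ?thesis by (auto simp: eventually_sequentially)
  next
    case False
    then have "r < a + s" using r by simp
    then have sp: "s > 0" using r by simp
    obtain d where d: "d > 0" "\<And>q. r \<le> q \<Longrightarrow> q < r + d \<Longrightarrow> y < f q"
      using right_continuous_gt[OF cadlag_at_right[OF f] r(3)] a r by auto
    \<comment> \<open>Beyond this index the mesh s / m is smaller than d.\<close>
    obtain m0 :: nat where m0: "real m0 > s / d" using reals_Archimedean2 by blast
    have "\<exists>i\<le>m. y < f (a + s * (real i / real m))" if m: "m \<ge> Suc m0" for m
    proof -
      have mp: "real m > 0" "real m > s / d" using m m0 by auto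
      \<comment> \<open>The position of r measured in cells of the grid; its ceiling i is the first
        grid point at or after r.\<close>
      define c where "c = (r - a) / s * real m"
      define i where "i = nat \<lceil>c\<rceil>"
      have "(r - a) / s < 1" using sp \<open>r < a + s\<close> by (simp add: divide_less_eq)
      then have "(r - a) / s * real m < 1 * real m" using mp by (intro mult_strict_right_mono) auto
      then have c: "0 \<le> c" "c < real m" using r sp by (auto simp: c_def)
      have i: "c \<le> real i" "real i < c + 1" using c unfolding i_def by linarith+
      have "i \<le> m" using c unfolding i_def by linarith
      have e: "r = a + s * (c / real m)" using sp mp by (simp add: c_def)
      have "s * (c / real m) \<le> s * (real i / real m)"
        using i sp mp by (intro mult_left_mono divide_right_mono) auto
      moreover have "s * (real i / real m) < s * ((c + 1) / real m)"
        using i sp mp by (intro mult_strict_left_mono divide_strict_right_mono) auto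
      moreover have "s * ((c + 1) / real m) = s * (c / real m) + s / real m"
        by (simp add: add_divide_distrib algebra_simps)
      moreover have "s / real m < d" using mp d by (simp add: field_simps)
      ultimately have "y < f (a + s * (real i / real m))" using e by (intro d) auto
      with \<open>i \<le> m\<close> show ?thesis by blast
    qed
    then show ?thesis unfolding eventually_sequentially by blast
  qed
  then show ?thesis
    by eventually_elim (use False in \<open>auto simp: not_le\<close>)
qed

section \<open>Approximation of times by grids of mesh 1/(n + 1)\<close>

lemma Suc_floor_grid:
  assumes "0 \<le> t"
  shows "t < real (Suc (nat \<lfloor>t * real (Suc n)\<rfloor>)) / real (Suc n)"
    and "real (Suc (nat \<lfloor>t * real (Suc n)\<rfloor>)) / real (Suc n) \<le> t + 1 / real (Suc n)"
proof -
  have "0 \<le> t * real (Suc n)" using assms by auto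
  then have *: "t * real (Suc n) < real (Suc (nat \<lfloor>t * real (Suc n)\<rfloor>))"
    "real (Suc (nat \<lfloor>t * real (Suc n)\<rfloor>)) \<le> t * real (Suc n) + 1"
    by linarith+
  show "t < real (Suc (nat \<lfloor>t * real (Suc n)\<rfloor>)) / real (Suc n)"
    using *(1) by (subst pos_less_divide_eq) auto
  have "real (Suc (nat \<lfloor>t * real (Suc n)\<rfloor>)) / real (Suc n) \<le> (t * real (Suc n) + 1) / real (Suc n)"
    by (intro divide_right_mono *(2)) auto
  then show "real (Suc (nat \<lfloor>t * real (Suc n)\<rfloor>)) / real (Suc n) \<le> t + 1 / real (Suc n)"
    by (simp add: add_divide_distrib)
qed

text \<open>The grid point lies strictly to the right of t, so the right limit alone decides.
  \<open>path_value\<close> is read off from this sequence.\<close>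

lemma right_grid_tendsto:
  fixes f :: "real \<Rightarrow> real"
  assumes "(f \<longlongrightarrow> f t) (at_right t)" and t: "0 \<le> t"
  shows "(\<lambda>n. f (real (Suc (nat \<lfloor>t * real (Suc n)\<rfloor>)) / real (Suc n))) \<longlonglongrightarrow> f t"
proof -
  have l: "(\<lambda>n. t + 1 / real (Suc n)) \<longlonglongrightarrow> t + 0"
    by (intro tendsto_intros LIMSEQ_Suc[OF lim_1_over_n])
  have "(\<lambda>n. real (Suc (nat \<lfloor>t * real (Suc n)\<rfloor>)) / real (Suc n)) \<longlonglongrightarrow> t"
    by (rule real_tendsto_sandwich[OF _ _ tendsto_const])
       (use l in \<open>auto intro!: always_eventually allI less_imp_le Suc_floor_grid[OF t] simp del: of_nat_Suc\<close>)
  then have "filterlim (\<lambda>n. real (Suc (nat \<lfloor>t * real (Suc n)\<rfloor>)) / real (Suc n)) (at_right t) sequentially"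
    by (rule filterlim_at_withinI)
       (use Suc_floor_grid(1)[OF t] in \<open>auto intro!: always_eventually\<close>)
  then show ?thesis by (rule filterlim_compose[OF assms(1)])
qed

lemma floor_grid:
  assumes "0 \<le> t"
  shows "real (nat \<lfloor>t * real (Suc n)\<rfloor>) / real (Suc n) \<le> t"
    and "t - 1 / real (Suc n) < real (nat \<lfloor>t * real (Suc n)\<rfloor>) / real (Suc n)"
proof -
  have "0 \<le> t * real (Suc n)" using assms by auto
  then have *: "real (nat \<lfloor>t * real (Suc n)\<rfloor>) \<le> t * real (Suc n)" by linarith
  show "real (nat \<lfloor>t * real (Suc n)\<rfloor>) / real (Suc n) \<le> t"
    using * by (subst pos_divide_le_eq) auto
  show "t - 1 / real (Suc n) < real (nat \<lfloor>t * real (Suc n)\<rfloor>) / real (Suc n)"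
    using Suc_floor_grid(1)[OF assms, of n] by (simp add: add_divide_distrib)
qed

text \<open>The grid point may coincide with t, so convergence within \<open>at_left t\<close> is
  not enough; the coincidence is harmless because the left limit is f t itself.\<close>

lemma left_grid_tendsto:
  fixes f :: "real \<Rightarrow> real"
  assumes "(f \<longlongrightarrow> f t) (at_left t)" and t: "0 \<le> t"
  shows "(\<lambda>n. f (real (nat \<lfloor>t * real (Suc n)\<rfloor>) / real (Suc n))) \<longlonglongrightarrow> f t"
proof -
  let ?u = "\<lambda>n. real (nat \<lfloor>t * real (Suc n)\<rfloor>) / real (Suc n)"
  have l: "(\<lambda>n. t - 1 / real (Suc n)) \<longlonglongrightarrow> t - 0"
    by (intro tendsto_intros LIMSEQ_Suc[OF lim_1_over_n])
  have u: "?u \<longlonglongrightarrow> t"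
    by (rule real_tendsto_sandwich[OF _ _ _ tendsto_const])
       (use l in \<open>auto intro!: always_eventually allI less_imp_le floor_grid[OF t] simp del: of_nat_Suc\<close>)
  show ?thesis
    unfolding tendsto_def
  proof (intro allI impI)
    fix S assume S: "open S" "f t \<in> S"
    then have "\<forall>\<^sub>F r in at_left t. f r \<in> S" using assms(1) by (auto simp: tendsto_def)
    then obtain b where b: "b < t" "\<And>r. b < r \<Longrightarrow> r < t \<Longrightarrow> f r \<in> S"
      by (auto simp: eventually_at_left_field)
    have "\<forall>\<^sub>F n in sequentially. b < ?u n" using order_tendstoD(1)[OF u b(1)] .
    then show "\<forall>\<^sub>F n in sequentially. f (?u n) \<in> S"
    proof eventually_elim
      case (elim n)
      then show ?case using b(2)[of "?u n"] S(2) floor_grid(1)[OF t, of n] by (cases "?u n = t") auto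
    qed
  qed
qed

text \<open>No grid maximum exceeds the supremum. Conversely a level c below the supremum is
  exceeded at some q strictly before t, hence on a right neighbourhood of q, and a fine grid has a
  point there whose index is still at most the rounded-down index of t.\<close>

lemma floor_grid_Max_tendsto:
  fixes f :: "real \<Rightarrow> real"
  assumes f: "cadlag f" and t: "0 < t" and left: "(f \<longlongrightarrow> f t) (at_left t)"
  shows "(\<lambda>n. Max ((\<lambda>j. f (real j / real (Suc n))) ` {..nat \<lfloor>t * real (Suc n)\<rfloor>})) \<longlonglongrightarrow> Sup (f ` {0..t})"
    (is "?X \<longlonglongrightarrow> ?S")
proof -
  obtain B where "\<And>r. 0 \<le> r \<Longrightarrow> r \<le> t \<Longrightarrow> f r \<le> B" using cadlag_bounded[OF f, where t = t] by blast
  then have bdd: "bdd_above (f ` {0..t})" by (intro bdd_aboveI[of _ B]) auto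
  have upper: "?X n \<le> ?S" for n
  proof (intro Max.boundedI; clarsimp simp del: of_nat_Suc)
    fix j assume j: "j \<le> nat \<lfloor>t * real (Suc n)\<rfloor>"
    have "real j / real (Suc n) \<le> real (nat \<lfloor>t * real (Suc n)\<rfloor>) / real (Suc n)"
      using j by (intro divide_right_mono) auto
    also have "\<dots> \<le> t" using floor_grid(1) t by simp
    finally show "f (real j / real (Suc n)) \<le> ?S" by (intro cSup_upper bdd) auto
  qed
  have lower: "\<forall>\<^sub>F n in sequentially. c < ?X n" if c: "c < ?S" for c
  proof -
    obtain r where r: "0 \<le> r" "r \<le> t" "c < f r"
      using c t by (subst (asm) less_cSup_iff[OF _ bdd]) auto
    \<comment> \<open>The grid stops at or before t, so a point strictly before t is needed. If c is
      exceeded only at t, left-continuity supplies an earlier point.\<close>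
    obtain q where q: "0 \<le> q" "q < t" "c < f q"
    proof (cases "r = t")
      case True
      with order_tendstoD(1)[OF left] r obtain b where
        "b < t" "\<And>r. b < r \<Longrightarrow> r < t \<Longrightarrow> c < f r"
        by (auto simp: eventually_at_left_field)
      then show thesis using t by (intro that[of "(max 0 b + t) / 2"]) (auto simp: max_def)
    qed (use r that in auto)
    obtain d where d: "d > 0" "\<And>p. q \<le> p \<Longrightarrow> p < q + d \<Longrightarrow> c < f p"
      using right_continuous_gt[OF cadlag_at_right[OF f q(1)] q(3)] by metis
    \<comment> \<open>Within e of q the path stays above c and time stays below t.\<close>
    define e where "e = min d (t - q)"
    have e: "e > 0" using d q by (simp add: e_def)
    have "(\<lambda>n. 1 / real (Suc n)) \<longlonglongrightarrow> 0" by (rule LIMSEQ_Suc[OF lim_1_over_n])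
    from order_tendstoD(2)[OF this e] show ?thesis
    proof eventually_elim
      case (elim n)
      define j where "j = Suc (nat \<lfloor>q * real (Suc n)\<rfloor>)"
      have j: "q < real j / real (Suc n)" "real j / real (Suc n) < q + e"
        using Suc_floor_grid[OF q(1), of n] elim unfolding j_def by linarith+
      then have "real j / real (Suc n) < t" by (simp add: e_def)
      then have "real j \<le> t * real (Suc n)" by (simp add: field_simps)
      then have "j \<le> nat \<lfloor>t * real (Suc n)\<rfloor>" by (simp add: le_nat_floor)
      then have "f (real j / real (Suc n)) \<le> ?X n" by (intro Max_ge) auto
      moreover have "c < f (real j / real (Suc n))" using j by (intro d) (auto simp: e_def)
      ultimately show ?case by simp
    qed
  qed
  show ?thesis
  proof (rule order_tendstoI)
    fix c assume "?S < c"
    then have "?X n < c" for n by (rule le_less_trans[OF upper])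
    then show "\<forall>\<^sub>F n in sequentially. ?X n < c" by (intro always_eventually allI)
  qed (rule lower)
qed

text \<open>Right-continuity lets rationals to the right of s replace s, except at a finite right
  endpoint u, where no later time is allowed. Truncating q at u covers this case: all rationals
  beyond u are sent to u itself. The supremum thereby becomes countable, also when u is
  random.\<close>

lemma cadlag_SUP_rational:
  assumes f: "cadlag f" and u: "0 \<le> u"
  shows "(SUP s\<in>{s. 0 \<le> s \<and> ereal s \<le> u}. ereal (f s)) =
    (SUP q\<in>\<rat> \<inter> {0..}. ereal (f (real_of_ereal (min (ereal q) u))))"
proof (rule antisym)
  show "(SUP q\<in>\<rat> \<inter> {0..}. ereal (f (real_of_ereal (min (ereal q) u)))) \<le>
    (SUP s\<in>{s. 0 \<le> s \<and> ereal s \<le> u}. ereal (f s))"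
  proof (rule SUP_mono)
    fix q :: real assume "q \<in> \<rat> \<inter> {0..}"
    then show "\<exists>s\<in>{s. 0 \<le> s \<and> ereal s \<le> u}. ereal (f (real_of_ereal (min (ereal q) u))) \<le> ereal (f s)"
      using u by (intro bexI[of _ "real_of_ereal (min (ereal q) u)"]) (cases u; auto simp: min_def)+
  qed
  show "(SUP s\<in>{s. 0 \<le> s \<and> ereal s \<le> u}. ereal (f s)) \<le>
    (SUP q\<in>\<rat> \<inter> {0..}. ereal (f (real_of_ereal (min (ereal q) u))))" (is "_ \<le> ?R")
  proof (rule SUP_least, clarsimp)
    fix s assume s: "0 \<le> s" "ereal s \<le> u"
    show "ereal (f s) \<le> ?R"
    proof (rule ereal_le_epsilon)
      fix e :: ereal assume "0 < e"
      then obtain e' where e': "0 < e'" "ereal e' \<le> e" by (cases e) (auto intro: zero_less_one)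
      obtain d where d: "d > 0" "\<And>r. s \<le> r \<Longrightarrow> r < s + d \<Longrightarrow> f s - e' < f r"
        using right_continuous_gt[OF cadlag_at_right[OF f s(1)], of "f s - e'"] e' by auto
      obtain q where q: "q \<in> \<rat>" "s < q" "q < s + d"
        using Rats_dense_in_real[of s "s + d"] d by auto
      \<comment> \<open>Since s is at most u, truncation at u keeps p between s and q.\<close>
      define p where "p = real_of_ereal (min (ereal q) u)"
      have "s \<le> p" "p < s + d" unfolding p_def using q s by (cases u; auto simp: min_def)+
      then have "f s - e' < f p" by (rule d)
      then have "ereal (f s) \<le> ereal (f p) + ereal e'" by simp
      also have "\<dots> \<le> ?R + e"
        using q s e' unfolding p_def by (intro add_mono SUP_upper) auto
      finally show "ereal (f s) \<le> ?R + e" .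
    qed
  qed
qed

section \<open>Independence of maximum and drawdown for random walks\<close>

lemma borel_measurable_pred_le [measurable (raw)]:
  fixes f g :: "'a \<Rightarrow> 'b::{second_countable_topology, linorder_topology}"
  assumes "f \<in> borel_measurable M" "g \<in> borel_measurable M"
  shows "Measurable.pred M (\<lambda>x. f x \<le> g x)"
  using assms unfolding pred_def by (rule borel_measurable_le)

text \<open>Half-lines are stable under intersection and generate the Borel sets, so independence of
  their preimages extends to the generated sigma-algebras.\<close>

lemma (in prob_space) indep_var_atMostI:
  fixes X Y :: "'a \<Rightarrow> real"
  assumes X [measurable]: "X \<in> borel_measurable M" and Y [measurable]: "Y \<in> borel_measurable M"
    and eq: "\<And>a b. prob {x\<in>space M. X x \<le> a \<and> Y x \<le> b} =
      prob {x\<in>space M. X x \<le> a} * prob {x\<in>space M. Y x \<le> b}"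
  shows "indep_var borel X borel Y"
proof -
  define G where "G Z = {Z -` S \<inter> space M | S. S \<in> range (\<lambda>a::real. {..a})}" for Z :: "'a \<Rightarrow> real"
  have G: "G Z = range (\<lambda>a. {x\<in>space M. Z x \<le> a})" for Z
  proof -
    have "Z -` {..a} \<inter> space M = {x\<in>space M. Z x \<le> a}" for a by auto
    then show ?thesis by (simp add: G_def setcompr_eq_image image_image)
  qed
  have gen: "sigma_sets (space M) {Z -` S \<inter> space M | S. S \<in> sets borel} = sigma_sets (space M) (G Z)" for Z
  proof -
    have "{Z -` S \<inter> space M | S. S \<in> sets borel} = sigma_sets (space M) (G Z)"
      unfolding G_def using sigma_sets_vimage_commute[of Z "space M" UNIV "range (\<lambda>a::real. {..a})"]
      by (simp add: borel_eq_atMost)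
    then show ?thesis
      using sigma_sets_sigma_sets_eq[of "G Z" "space M"] by (auto simp: G_def)
  qed
  have st: "Int_stable (G Z)" for Z
    unfolding Int_stable_def G
  proof safe
    fix a b
    have "{x\<in>space M. Z x \<le> a} \<inter> {x\<in>space M. Z x \<le> b} = {x\<in>space M. Z x \<le> min a b}" by auto
    then show "{x\<in>space M. Z x \<le> a} \<inter> {x\<in>space M. Z x \<le> b} \<in> range (\<lambda>a. {x\<in>space M. Z x \<le> a})"
      by (rule range_eqI)
  qed
  have "indep_set (G X) (G Y)"
    unfolding indep_sets2_eq G
  proof (safe)
    fix a b
    have "{x\<in>space M. X x \<le> a} \<inter> {x\<in>space M. Y x \<le> b} = {x\<in>space M. X x \<le> a \<and> Y x \<le> b}" by auto
    then show "prob ({x\<in>space M. X x \<le> a} \<inter> {x\<in>space M. Y x \<le> b}) =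
      prob {x\<in>space M. X x \<le> a} * prob {x\<in>space M. Y x \<le> b}" by (simp add: eq)
  qed auto
  then show ?thesis
    unfolding indep_var_eq gen by (auto intro: indep_set_sigma_sets st)
qed

text \<open>A continuous approximation from above to the indicator of {..a}: 1 up to a, then falling
  linearly and, for k > 0, vanishing from a + 1/k on. Distribution functions need not converge at
  atoms of the limit; expectations of ramps do.\<close>

definition ramp :: "real \<Rightarrow> nat \<Rightarrow> real \<Rightarrow> real" where
  "ramp a k x = max 0 (min 1 (1 - real k * (x - a)))"

lemma ramp_bounds: "0 \<le> ramp a k x" "ramp a k x \<le> 1" "\<bar>ramp a k x\<bar> \<le> 1"
  by (auto simp: ramp_def)

lemma ramp_measurable [measurable]: "ramp a k \<in> borel_measurable borel"
  unfolding ramp_def[abs_def] by measurable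

lemma ramp_cont: "isCont (ramp a k) x"
  unfolding ramp_def by (intro continuous_intros)

lemma ramp_tendsto: "(\<lambda>k. ramp a k x) \<longlonglongrightarrow> indicator {..a} x"
proof (cases "x \<le> a")
  case True
  then have "1 - real k * (x - a) \<ge> 1" for k by (simp add: mult_nonneg_nonpos)
  then have "ramp a k x = 1" for k by (simp add: ramp_def min_def)
  then show ?thesis using True by simp
next
  case False
  obtain k0 :: nat where k0: "1 / (x - a) < real k0" using reals_Archimedean2 by blast
  have "ramp a k x = 0" if "k \<ge> k0" for k
  proof -
    have "1 / (x - a) < real k" using k0 that by simp
    then have "1 < real k * (x - a)" using False by (simp add: field_simps)
    then show ?thesis by (simp add: ramp_def)
  qed
  then have "\<forall>\<^sub>F k in sequentially. ramp a k x = indicator {..a} x"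
    using False by (auto simp: eventually_sequentially)
  then show ?thesis by (rule tendsto_eventually)
qed

text \<open>For fixed k the product formula for ramps survives n tending to infinity, because ramps
  are bounded and continuous. Letting k tend to infinity afterwards turns the ramps into indicators
  of half-lines.\<close>

lemma (in prob_space) indep_var_limit:
  fixes X Y :: "nat \<Rightarrow> 'a \<Rightarrow> real"
  assumes ind: "\<And>n. indep_var borel (X n) borel (Y n)"
    and X' [measurable]: "X' \<in> borel_measurable M" and Y' [measurable]: "Y' \<in> borel_measurable M"
    and X: "AE x in M. (\<lambda>n. X n x) \<longlonglongrightarrow> X' x" and Y: "AE x in M. (\<lambda>n. Y n x) \<longlonglongrightarrow> Y' x"
  shows "indep_var borel X' borel Y'"
proof (rule indep_var_atMostI)
  have [measurable]: "X n \<in> borel_measurable M" "Y n \<in> borel_measurable M" for n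
    using ind[of n] by (auto simp: indep_var_eq)
  fix a b
  have ramps: "(\<integral>x. ramp a k (X' x) * ramp b k (Y' x) \<partial>M) =
    (\<integral>x. ramp a k (X' x) \<partial>M) * (\<integral>x. ramp b k (Y' x) \<partial>M)" for k
  proof (rule LIMSEQ_unique)
    have "(\<lambda>n. \<integral>x. ramp a k (X n x) * ramp b k (Y n x) \<partial>M) \<longlonglongrightarrow>
        (\<integral>x. ramp a k (X' x) * ramp b k (Y' x) \<partial>M)"
    proof (rule integral_dominated_convergence[where w = "\<lambda>_. 1"])
      show "AE x in M. (\<lambda>n. ramp a k (X n x) * ramp b k (Y n x)) \<longlonglongrightarrow> ramp a k (X' x) * ramp b k (Y' x)"
        using X Y by eventually_elim (intro tendsto_intros isCont_tendsto_compose[OF ramp_cont])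
    qed (auto simp: ramp_bounds abs_mult intro!: mult_le_one)
    moreover have "(\<integral>x. ramp a k (X n x) * ramp b k (Y n x) \<partial>M) =
      (\<integral>x. ramp a k (X n x) \<partial>M) * (\<integral>x. ramp b k (Y n x) \<partial>M)" for n
      using indep_var_compose[OF ind[of n] ramp_measurable ramp_measurable, of a k b k]
      by (intro indep_var_lebesgue_integral)
        (auto simp: comp_def ramp_bounds intro!: integrable_const_bound[where B = 1])
    ultimately show "(\<lambda>n. (\<integral>x. ramp a k (X n x) \<partial>M) * (\<integral>x. ramp b k (Y n x) \<partial>M)) \<longlonglongrightarrow>
        (\<integral>x. ramp a k (X' x) * ramp b k (Y' x) \<partial>M)" by simp
    have "(\<lambda>n. \<integral>x. ramp a k (X n x) \<partial>M) \<longlonglongrightarrow> (\<integral>x. ramp a k (X' x) \<partial>M)" for a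
    proof (rule integral_dominated_convergence[where w = "\<lambda>_. 1"])
      show "AE x in M. (\<lambda>n. ramp a k (X n x)) \<longlonglongrightarrow> ramp a k (X' x)"
        using X by eventually_elim (intro tendsto_intros isCont_tendsto_compose[OF ramp_cont])
    qed (auto simp: ramp_bounds)
    moreover have "(\<lambda>n. \<integral>x. ramp b k (Y n x) \<partial>M) \<longlonglongrightarrow> (\<integral>x. ramp b k (Y' x) \<partial>M)" for b
    proof (rule integral_dominated_convergence[where w = "\<lambda>_. 1"])
      show "AE x in M. (\<lambda>n. ramp b k (Y n x)) \<longlonglongrightarrow> ramp b k (Y' x)"
        using Y by eventually_elim (intro tendsto_intros isCont_tendsto_compose[OF ramp_cont])
    qed (auto simp: ramp_bounds)
    ultimately show "(\<lambda>n. (\<integral>x. ramp a k (X n x) \<partial>M) * (\<integral>x. ramp b k (Y n x) \<partial>M)) \<longlonglongrightarrow>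
        (\<integral>x. ramp a k (X' x) \<partial>M) * (\<integral>x. ramp b k (Y' x) \<partial>M)"
      by (intro tendsto_mult)
  qed
  have "(\<lambda>k. \<integral>x. ramp a k (X' x) * ramp b k (Y' x) \<partial>M) \<longlonglongrightarrow>
      (\<integral>x. indicator {..a} (X' x) * indicator {..b} (Y' x) \<partial>M)"
    by (rule integral_dominated_convergence[where w = "\<lambda>_. 1"])
       (auto simp: ramp_bounds abs_mult intro!: mult_le_one tendsto_mult ramp_tendsto)
  moreover have "(\<lambda>k. \<integral>x. ramp a k (X' x) \<partial>M) \<longlonglongrightarrow> (\<integral>x. indicator {..a} (X' x) \<partial>M)"
    "(\<lambda>k. \<integral>x. ramp b k (Y' x) \<partial>M) \<longlonglongrightarrow> (\<integral>x. indicator {..b} (Y' x) \<partial>M)"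
    by (rule integral_dominated_convergence[where w = "\<lambda>_. 1"];
        auto simp: ramp_bounds intro!: ramp_tendsto)+
  ultimately have "(\<integral>x. indicator {..a} (X' x) * indicator {..b} (Y' x) \<partial>M) =
      (\<integral>x. indicator {..a} (X' x) \<partial>M) * (\<integral>x. indicator {..b} (Y' x) \<partial>M :: real)"
    unfolding ramps by (rule LIMSEQ_unique[OF _ tendsto_mult])
  moreover have "(\<integral>x. indicator {..a} (X' x) * indicator {..b} (Y' x) \<partial>M) =
      (\<integral>x. indicator {x\<in>space M. X' x \<le> a \<and> Y' x \<le> b} x \<partial>M :: real)"
    "(\<integral>x. indicator {..a} (X' x) \<partial>M) = (\<integral>x. indicator {x\<in>space M. X' x \<le> a} x \<partial>M :: real)"
    "(\<integral>x. indicator {..b} (Y' x) \<partial>M) = (\<integral>x. indicator {x\<in>space M. Y' x \<le> b} x \<partial>M :: real)"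
    by (intro Bochner_Integration.integral_cong; auto simp: indicator_def)+
  ultimately show "prob {x\<in>space M. X' x \<le> a \<and> Y' x \<le> b} =
      prob {x\<in>space M. X' x \<le> a} * prob {x\<in>space M. Y' x \<le> b}"
    by simp
qed auto

section \<open>Random walks cut at their first maximum\<close>

definition rw :: "(nat \<Rightarrow> real) \<Rightarrow> nat \<Rightarrow> real" where
  "rw w n = (\<Sum>i<n. w i)"

definition rw_max :: "(nat \<Rightarrow> real) \<Rightarrow> nat \<Rightarrow> real" where
  "rw_max w n = Max (rw w ` {..n})"

lemma rw_measurable: "(\<lambda>w. rw w n) \<in> borel_measurable (Pi\<^sub>M UNIV (\<lambda>_. borel))"
  unfolding rw_def by measurable

lemma rw_max_measurable: "(\<lambda>w. rw_max w n) \<in> borel_measurable (Pi\<^sub>M UNIV (\<lambda>_. borel))"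
proof -
  have "(\<lambda>w. Max ((\<lambda>j. rw w j) ` {..n})) \<in> borel_measurable (Pi\<^sub>M UNIV (\<lambda>_. borel))"
    by (rule borel_measurable_Max) (auto intro: rw_measurable)
  then show ?thesis by (simp add: rw_max_def)
qed

text \<open>Gluing v and w at time k makes the walk follow v up to time k and then continue with the
  steps of w from the value reached.\<close>

lemma rw_comb_seq:
  "j \<le> k \<Longrightarrow> rw (comb_seq k v w) j = rw v j"
  "rw (comb_seq k v w) (k + m) = rw v k + rw w m"
proof -
  show "j \<le> k \<Longrightarrow> rw (comb_seq k v w) j = rw v j"
    unfolding rw_def by (intro sum.cong) (auto simp: comb_seq_def)
  show "rw (comb_seq k v w) (k + m) = rw v k + rw w m"
    by (induction m) (auto simp: rw_def comb_seq_def)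
qed

lemma rw_max_eqI:
  assumes "k \<le> n" "\<And>j. j < k \<Longrightarrow> rw w j < rw w k" "\<And>j. k \<le> j \<Longrightarrow> j \<le> n \<Longrightarrow> rw w j \<le> rw w k"
  shows "rw_max w n = rw w k"
  unfolding rw_max_def
  by (rule Max_eqI) (use assms in \<open>auto simp: not_less intro: less_imp_le, meson less_imp_le not_le\<close>)

lemma rw_max_first:
  obtains k where "k \<le> n" "\<And>j. j < k \<Longrightarrow> rw w j < rw w k" "\<And>j. j \<le> n \<Longrightarrow> rw w j \<le> rw w k"
proof -
  define P where "P k \<longleftrightarrow> k \<le> n \<and> rw w k = rw_max w n" for k
  have "rw_max w n \<in> rw w ` {..n}" unfolding rw_max_def by (rule Max_in) auto
  then have "\<exists>k. P k" by (auto simp: P_def)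
  then have P: "P (LEAST k. P k)" by (rule LeastI_ex)
  have le: "rw w j \<le> rw_max w n" if "j \<le> n" for j
    unfolding rw_max_def using that by (intro Max_ge) auto
  show thesis
  proof (rule that[of "LEAST k. P k"])
    fix j assume "j < (LEAST k. P k)"
    then have "\<not> P j" "j \<le> n" using not_less_Least[of j P] P by (auto simp: P_def)
    then show "rw w j < rw w (LEAST k. P k)" using le[of j] P by (auto simp: P_def)
  qed (use P le in \<open>auto simp: P_def\<close>)
qed

locale walk_space = sequence_space \<rho> for \<rho> :: "real measure" +
  assumes sets_rho: "sets \<rho> = sets borel"
begin

lemma sets_S: "sets S = sets (Pi\<^sub>M UNIV (\<lambda>_. borel))"
  by (intro sets_PiM_cong) (auto simp: sets_rho)

lemma space_S [simp]: "space S = UNIV"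
  using sets_eq_imp_space_eq[OF sets_S] by (simp add: space_PiM)

lemma S_measurable [measurable]:
  "(\<lambda>w. rw w n) \<in> borel_measurable S" "(\<lambda>w. rw_max w n) \<in> borel_measurable S"
  using rw_measurable rw_max_measurable by (simp_all add: measurable_cong_sets[OF sets_S refl])

text \<open>This describes the path up to its maximum and \<open>nonpos_walk\<close> the path after
  it. Strict inequalities before and weak ones after select the first time of the maximum.\<close>

definition strict_record :: "nat \<Rightarrow> real set \<Rightarrow> real" where
  "strict_record k A = measure S {w. (\<forall>j<k. rw w j < rw w k) \<and> rw w k \<in> A}"

definition nonpos_walk :: "nat \<Rightarrow> real set \<Rightarrow> real" where
  "nonpos_walk m B = measure S {w. (\<forall>j\<le>m. rw w j \<le> 0) \<and> - rw w m \<in> B}"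

text \<open>The first time k of the maximum partitions the event. Given k, the value of the maximum
  concerns only the first k steps and the drawdown only the later ones, so the probability is a
  product.\<close>

lemma measure_max_split:
  assumes [measurable]: "A \<in> sets borel" "B \<in> sets borel"
  shows "measure S {w. rw_max w n \<in> A \<and> rw_max w n - rw w n \<in> B} =
    (\<Sum>k\<le>n. strict_record k A * nonpos_walk (n - k) B)"
proof -
  define E where "E k = {w. (\<forall>j<k. rw w j < rw w k) \<and> (\<forall>j\<in>{k..n}. rw w j \<le> rw w k) \<and>
     rw w k \<in> A \<and> rw w k - rw w n \<in> B}" for k
  have [measurable]: "E k \<in> sets S" for k
  proof -
    have "{w\<in>space S. (\<forall>j<k. rw w j < rw w k) \<and> (\<forall>j\<in>{k..n}. rw w j \<le> rw w k) \<and>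
     rw w k \<in> A \<and> rw w k - rw w n \<in> B} \<in> sets S" by measurable
    then show ?thesis by (simp only: E_def space_S UNIV_I simp_thms)
  qed
  have un: "{w. rw_max w n \<in> A \<and> rw_max w n - rw w n \<in> B} = (\<Union>k\<in>{..n}. E k)"
  proof safe
    fix w assume w: "rw_max w n \<in> A" "rw_max w n - rw w n \<in> B"
    obtain k where k: "k \<le> n" "\<And>j. j < k \<Longrightarrow> rw w j < rw w k" "\<And>j. j \<le> n \<Longrightarrow> rw w j \<le> rw w k"
      using rw_max_first[where n = n and w = w] by blast
    then have "rw_max w n = rw w k" by (intro rw_max_eqI) auto
    with k w show "w \<in> (\<Union>k\<in>{..n}. E k)" by (intro UN_I[of k]) (auto simp: E_def)
  next
    fix w k assume k: "k \<le> n" "w \<in> E k"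
    then have "rw_max w n = rw w k" by (intro rw_max_eqI) (auto simp: E_def)
    then show "rw_max w n \<in> A" "rw_max w n - rw w n \<in> B" using k by (auto simp: E_def)
  qed
  have disj: "disjoint_family_on E {..n}"
    unfolding disjoint_family_on_def
  proof (intro ballI impI)
    fix i j assume ij: "i \<in> {..n}" "j \<in> {..n}" "i \<noteq> j"
    have dj: "w \<notin> E j" if "w \<in> E i" "i < j" "j \<in> {..n}" for w i j
    proof
      assume "w \<in> E j"
      then have "rw w i < rw w j" using that by (simp add: E_def)
      moreover have "rw w j \<le> rw w i" using that by (simp add: E_def)
      ultimately show False by simp
    qed
    show "E i \<inter> E j = {}"
    proof (cases "i < j")
      case True
      with dj[of _ i j] ij show ?thesis by blast
    next
      case False
      with ij have "j < i" by simp
      with dj[of _ j i] ij show ?thesis by blast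
    qed
  qed
  have "measure S (E k) = strict_record k A * nonpos_walk (n - k) B" if k: "k \<le> n" for k
  proof -
    define F where "F = {w. (\<forall>j<k. rw w j < rw w k) \<and> rw w k \<in> A}"
    define G where "G = {w. (\<forall>j\<le>n - k. rw w j \<le> 0) \<and> - rw w (n - k) \<in> B}"
    have [measurable]: "F \<in> sets S" "G \<in> sets S"
    proof -
      have "{w\<in>space S. (\<forall>j<k. rw w j < rw w k) \<and> rw w k \<in> A} \<in> sets S"
        "{w\<in>space S. (\<forall>j\<le>n - k. rw w j \<le> 0) \<and> - rw w (n - k) \<in> B} \<in> sets S" by measurable
      then show "F \<in> sets S" "G \<in> sets S" by (simp_all only: F_def G_def space_S UNIV_I simp_thms)
    qed
    have eq: "comb_seq k v w \<in> E k \<longleftrightarrow> v \<in> F \<and> w \<in> G" for v w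
    proof -
      have 1: "rw (comb_seq k v w) n = rw v k + rw w (n - k)"
        using rw_comb_seq(2)[of k v w "n - k"] k by simp
      have 2: "(\<forall>j\<in>{k..n}. rw (comb_seq k v w) j \<le> rw v k) \<longleftrightarrow> (\<forall>j\<le>n - k. rw w j \<le> 0)"
      proof safe
        fix j assume "\<forall>j\<in>{k..n}. rw (comb_seq k v w) j \<le> rw v k" "j \<le> n - k"
        then show "rw w j \<le> 0" using k by (auto simp: rw_comb_seq dest!: bspec[of _ _ "k + j"])
      next
        fix j assume "\<forall>j\<le>n - k. rw w j \<le> 0" "j \<in> {k..n}"
        then show "rw (comb_seq k v w) j \<le> rw v k"
          using rw_comb_seq(2)[of k v w "j - k"] by auto
      qed
      show ?thesis unfolding E_def F_def G_def using 2 by (auto simp: rw_comb_seq 1)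
    qed
    \<comment> \<open>Two independent step sequences glued at time k again have law
      \<open>S\<close>; under the gluing map \<open>E k\<close> becomes the rectangle F x G.\<close>
    have "emeasure S (E k) = emeasure (distr (S \<Otimes>\<^sub>M S) S (\<lambda>(v, w). comb_seq k v w)) (E k)"
      by (simp add: PiM_comb_seq)
    also have "\<dots> = emeasure (S \<Otimes>\<^sub>M S) (F \<times> G)"
      by (subst emeasure_distr)
        (auto simp: space_pair_measure eq measurable_comb_seq intro!: arg_cong2[where f = emeasure])
    also have "\<dots> = emeasure S F * emeasure S G"
      by (intro P.emeasure_pair_measure_Times) auto
    finally have "measure S (E k) = measure S F * measure S G"
      by (simp add: measure_def enn2real_mult)
    then show ?thesis by (simp add: strict_record_def nonpos_walk_def F_def G_def)
  qed
  then show ?thesis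
    unfolding un using disj by (subst P.finite_measure_finite_Union) auto
qed

text \<open>J is the joint law of maximum and drawdown at an independent geometric time. Writing q^n
  = q^k q^(n-k) turns the sum over the time k of the maximum into a Cauchy product, so J A B is a
  function of A times a function of B; total mass 1 then identifies the factors with the
  marginals.\<close>

lemma geometric_max_split:
  fixes q :: real
  assumes [measurable]: "A \<in> sets borel" "B \<in> sets borel" and q: "0 < q" "q < 1"
  defines "J \<equiv> \<lambda>A B. (\<Sum>n. (1 - q) * q ^ n * measure S {w. rw_max w n \<in> A \<and> rw_max w n - rw w n \<in> B})"
  shows "J A B = J A UNIV * J UNIV B"
proof -
  define a where "a A = (\<Sum>k. q ^ k * strict_record k A)" for A
  define b where "b B = (\<Sum>k. q ^ k * nonpos_walk k B)" for B
  have bnd: "summable (\<lambda>k. norm (q ^ k * strict_record k A))"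
    "summable (\<lambda>k. norm (q ^ k * nonpos_walk k A))" for A
    by (rule summable_comparison_test'[of "\<lambda>k. q ^ k" 0];
        use q in \<open>auto simp: strict_record_def nonpos_walk_def abs_mult intro!: summable_geometric mult_left_le\<close>)+
  have J: "J A B = (1 - q) * (a A * b B)" if [measurable]: "A \<in> sets borel" "B \<in> sets borel" for A B
  proof -
    have "(\<lambda>n. \<Sum>k\<le>n. (q ^ k * strict_record k A) * (q ^ (n - k) * nonpos_walk (n - k) B)) sums (a A * b B)"
      unfolding a_def b_def by (rule Cauchy_product_sums[OF bnd])
    then have "(\<lambda>n. (1 - q) * (\<Sum>k\<le>n. (q ^ k * strict_record k A) * (q ^ (n - k) * nonpos_walk (n - k) B)))
        sums ((1 - q) * (a A * b B))" by (rule sums_mult)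
    moreover have "(1 - q) * (\<Sum>k\<le>n. (q ^ k * strict_record k A) * (q ^ (n - k) * nonpos_walk (n - k) B)) =
      (1 - q) * q ^ n * measure S {w. rw_max w n \<in> A \<and> rw_max w n - rw w n \<in> B}" for n
      unfolding measure_max_split[OF that] sum_distrib_left
      by (intro sum.cong refl) (auto simp: power_add[symmetric] mult_ac simp flip: power_add)
    ultimately show ?thesis unfolding J_def by (simp add: sums_iff)
  qed
  have "J UNIV UNIV = 1"
  proof -
    have "(\<lambda>n. (1 - q) * q ^ n) sums ((1 - q) * (1 / (1 - q)))"
      using q by (intro sums_mult geometric_sums) auto
    then show ?thesis using q P.prob_space by (simp add: J_def sums_iff)
  qed
  then have "(1 - q) * (a UNIV * b UNIV) = 1" by (simp add: J)
  then have "(1 - q) * (a A * b B) = (1 - q) * (a A * b B) * ((1 - q) * (a UNIV * b UNIV))" by simp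
  then show ?thesis by (simp add: J mult_ac)
qed

end

section \<open>Levy processes\<close>

text \<open>The inner integral runs over an independent copy x' of the sample point, so no second
  probability space is needed to decouple X from Y.\<close>

lemma (in prob_space) indep_var_nn_integral:
  assumes ind: "indep_var A X B Y" and f [measurable]: "f \<in> borel_measurable (A \<Otimes>\<^sub>M B)"
  shows "(\<integral>\<^sup>+x. f (X x, Y x) \<partial>M) = (\<integral>\<^sup>+x. \<integral>\<^sup>+x'. f (X x, Y x') \<partial>M \<partial>M)"
proof -
  have [measurable]: "X \<in> measurable M A" "Y \<in> measurable M B"
    using ind by (auto simp: indep_var_eq)
  interpret Y: prob_space "distr M B Y" by (rule prob_space_distr) measurable
  have "(\<integral>\<^sup>+x. f (X x, Y x) \<partial>M) = (\<integral>\<^sup>+p. f p \<partial>distr M (A \<Otimes>\<^sub>M B) (\<lambda>x. (X x, Y x)))"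
    by (simp add: nn_integral_distr)
  also have "\<dots> = (\<integral>\<^sup>+p. f p \<partial>(distr M A X \<Otimes>\<^sub>M distr M B Y))"
    using ind by (simp add: indep_var_distribution_eq)
  also have "\<dots> = (\<integral>\<^sup>+v. \<integral>\<^sup>+w. f (v, w) \<partial>distr M B Y \<partial>distr M A X)"
    by (intro Y.nn_integral_fst[symmetric]) measurable
  also have "\<dots> = (\<integral>\<^sup>+x. \<integral>\<^sup>+w. f (X x, w) \<partial>distr M B Y \<partial>M)"
    by (intro nn_integral_distr Y.borel_measurable_nn_integral) measurable
  also have "\<dots> = (\<integral>\<^sup>+x. \<integral>\<^sup>+x'. f (X x, Y x') \<partial>M \<partial>M)"
    by (intro nn_integral_cong nn_integral_distr measurable_compose[OF measurable_Pair1' f])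
      (auto intro: measurable_space)
  finally show ?thesis .
qed

lemma (in prob_space) nn_integral_bounded_convergence:
  assumes meas: "\<And>i. u i \<in> borel_measurable M" "u' \<in> borel_measurable M"
    and le: "\<And>i x. u i x \<le> 1" and lim: "AE x in M. (\<lambda>i. u i x) \<longlonglongrightarrow> u' x"
  shows "(\<lambda>i. \<integral>\<^sup>+x. u i x \<partial>M) \<longlonglongrightarrow> (\<integral>\<^sup>+x. u' x \<partial>M)"
  by (rule nn_integral_dominated_convergence[where w = "\<lambda>_. 1", OF meas _ _ _ lim])
    (use le in \<open>auto simp: emeasure_space_1\<close>)

text \<open>The value and the running supremum of a path, read off from countably many coordinates; for
  cadlag paths they agree with the path itself and with its supremum over \<open>[0, u]\<close>.\<close>

abbreviation (input) path_space :: "(real \<Rightarrow> real) measure" where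
  "path_space \<equiv> Pi\<^sub>M {0..} (\<lambda>_. borel)"

definition path_value :: "real \<Rightarrow> (real \<Rightarrow> real) \<Rightarrow> real" where
  "path_value t f = lim (\<lambda>n. f (real (Suc (nat \<lfloor>t * real (Suc n)\<rfloor>)) / real (Suc n)))"

definition path_sup :: "ereal \<Rightarrow> (real \<Rightarrow> real) \<Rightarrow> ereal" where
  "path_sup u f = (SUP q\<in>\<rat> \<inter> {0..}. ereal (path_value (real_of_ereal (min (ereal q) u)) f))"

text \<open>Joint measurability in time and path is required for evaluation at random times. Each
  approximant uses the time only through an integer index, so it is pieced together from countably
  many coordinate maps.\<close>

lemma path_value_measurable:
  "(\<lambda>p. path_value (fst p) (snd p)) \<in> borel_measurable (borel \<Otimes>\<^sub>M path_space)"
  unfolding path_value_def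
proof (rule borel_measurable_lim_metric)
  fix n
  have 1: "(\<lambda>p. snd p (real (Suc i) / real (Suc n))) \<in> borel_measurable (borel \<Otimes>\<^sub>M path_space)" for i
    by (rule measurable_compose[OF measurable_snd measurable_component_singleton]) auto
  have 2: "(\<lambda>p. nat \<lfloor>fst p * real (Suc n)\<rfloor>) \<in> measurable (borel \<Otimes>\<^sub>M path_space) (count_space UNIV)"
    by measurable
  show "(\<lambda>p. snd p (real (Suc (nat \<lfloor>fst p * real (Suc n)\<rfloor>)) / real (Suc n)))
      \<in> borel_measurable (borel \<Otimes>\<^sub>M path_space)"
    by (rule measurable_compose_countable[OF 1 2])
qed

lemma path_value_measurable' [measurable (raw)]:
  assumes "t \<in> borel_measurable N" "f \<in> measurable N path_space"
  shows "(\<lambda>x. path_value (t x) (f x)) \<in> borel_measurable N"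
  using measurable_compose[OF measurable_Pair[OF assms] path_value_measurable] by simp

lemma path_sup_measurable' [measurable (raw)]:
  assumes [measurable]: "u \<in> borel_measurable N" "f \<in> measurable N path_space"
  shows "(\<lambda>x. path_sup (u x) (f x)) \<in> borel_measurable N"
  unfolding path_sup_def by (intro borel_measurable_SUP countable_Int1 countable_rat) measurable

lemma path_value_cadlag:
  assumes "cadlag f" "0 \<le> t"
  shows "path_value t (restrict f {0..}) = f t"
  unfolding path_value_def
  using right_grid_tendsto[OF cadlag_at_right[OF assms] assms(2)] by (auto intro!: limI)

lemma path_sup_cadlag:
  assumes "cadlag f" "0 \<le> u"
  shows "path_sup u (restrict f {0..}) = (SUP s\<in>{s. 0 \<le> s \<and> ereal s \<le> u}. ereal (f s))"
proof -
  have "0 \<le> real_of_ereal (min (ereal q) u)" if "0 \<le> q" for q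
    using that assms(2) by (cases u) (auto simp: min_def)
  then show ?thesis
    unfolding path_sup_def cadlag_SUP_rational[OF assms]
    by (intro SUP_cong refl) (auto simp: path_value_cadlag[OF assms(1)])
qed

lemma path_sup_cadlag_le_iff:
  assumes "cadlag f" "0 \<le> t"
  shows "path_sup (ereal t) (restrict f {0..}) \<le> ereal y \<longleftrightarrow> (\<forall>r\<in>{0..t}. f r \<le> y)"
  using assms by (auto simp: path_sup_cadlag SUP_le_iff)

lemma path_sup_cadlag_real:
  assumes f: "cadlag f" and t: "0 \<le> t"
  shows "path_sup (ereal t) (restrict f {0..}) = ereal (Sup (f ` {0..t}))"
proof -
  obtain B where B: "\<And>r. 0 \<le> r \<Longrightarrow> r \<le> t \<Longrightarrow> f r \<le> B" using cadlag_bounded[OF f, where t = t] by blast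
  have "(SUP s\<in>{0..t}. ereal (f s)) \<le> ereal B" "ereal (f 0) \<le> (SUP s\<in>{0..t}. ereal (f s))"
    using t B by (auto intro!: SUP_least SUP_upper)
  then have "\<bar>SUP s\<in>{0..t}. ereal (f s)\<bar> \<noteq> \<infinity>" by auto
  then have "ereal (Sup (f ` {0..t})) = (SUP s\<in>{0..t}. ereal (f s))"
    by (rule ereal_SUP)
  moreover have "{s. 0 \<le> s \<and> ereal s \<le> ereal t} = {0..t}" by auto
  ultimately show ?thesis using t by (simp add: path_sup_cadlag[OF f])
qed

locale levy =
  fixes M :: "'a measure" and Y :: "real \<Rightarrow> 'a \<Rightarrow> real"
  assumes levy: "levy_process M Y"
begin

sublocale prob_space M using levy by (simp add: levy_process_def)

lemma Y_measurable [measurable]: "0 \<le> t \<Longrightarrow> Y t \<in> borel_measurable M"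
  using levy by (simp add: levy_process_def)

lemma AE_Y_0: "AE x in M. Y 0 x = 0"
  using levy by (simp add: levy_process_def)

lemma AE_cadlag: "AE x in M. cadlag (\<lambda>t. Y t x)"
  using levy by (simp add: levy_process_def)

lemma stationary: "0 \<le> s \<Longrightarrow> 0 \<le> t \<Longrightarrow> distr M borel (\<lambda>x. Y (s + t) x - Y s x) = distr M borel (Y t)"
  using levy by (simp add: levy_process_def)

lemma path_of_measurable [measurable]: "path_of Y \<in> measurable M path_space"
  unfolding path_of_def by (rule measurable_restrict) auto

text \<open>Independence of an infinite family is a matter of finite subfamilies, and each of these
  lies in some {..<n}.\<close>

lemma indep_increments:
  assumes "0 \<le> t 0" "\<And>k. t k \<le> t (Suc k)"
  shows "indep_vars (\<lambda>_. borel) (\<lambda>k x. Y (t (Suc k)) x - Y (t k) x) (UNIV :: nat set)"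
proof -
  have t: "0 \<le> t k" for k
    using assms by (induction k) (auto intro: order_trans)
  have fin: "indep_vars (\<lambda>_. borel) (\<lambda>k x. Y (t (Suc k)) x - Y (t k) x) {..<n}" for n
    using levy assms by (auto simp: levy_process_def)
  show ?thesis
    unfolding indep_vars_def2
  proof (intro conjI ballI)
    show "indep_sets (\<lambda>k. {(\<lambda>x. Y (t (Suc k)) x - Y (t k) x) -` A \<inter> space M |A. A \<in> sets borel}) (UNIV :: nat set)"
    proof (subst indep_sets_finite_index_sets, intro allI impI)
      fix J :: "nat set" assume "J \<noteq> {}" "finite J"
      then obtain n where "J \<subseteq> {..<n}" by (metis finite_nat_bounded)
      then show "indep_sets (\<lambda>k. {(\<lambda>x. Y (t (Suc k)) x - Y (t k) x) -` A \<inter> space M |A. A \<in> sets borel}) J"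
        by (rule indep_sets_mono_index) (use fin[of n] in \<open>simp only: indep_vars_def2\<close>)
    qed
  qed (use t in measurable)
qed

definition grid_increments :: "real \<Rightarrow> real \<Rightarrow> 'a \<Rightarrow> nat \<Rightarrow> real" where
  "grid_increments s h x k = Y (s + real (Suc k) * h) x - Y (s + real k * h) x"

lemma grid_increments_measurable [measurable]:
  assumes "0 \<le> s" "0 \<le> h"
  shows "grid_increments s h \<in> measurable M (Pi\<^sub>M UNIV (\<lambda>_. borel))"
proof -
  have "(\<lambda>x k. grid_increments s h x k) \<in> measurable M (Pi\<^sub>M UNIV (\<lambda>_. borel))"
    unfolding grid_increments_def using assms
    by (intro measurable_PiM_single' borel_measurable_diff Y_measurable) auto
  then show ?thesis by simp
qed

lemma rw_grid_increments: "rw (grid_increments s h x) n = Y (s + real n * h) x - Y s x"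
  by (induction n) (auto simp: rw_def grid_increments_def)

text \<open>Independent increments give the product form and stationarity the common factor. The
  right-hand side does not involve s; this is the restart at time s used in the Markov
  property.\<close>

lemma distr_grid_increments:
  assumes "0 \<le> s" "0 \<le> h"
  shows "distr M (Pi\<^sub>M UNIV (\<lambda>_. borel)) (grid_increments s h) = Pi\<^sub>M UNIV (\<lambda>_. distr M borel (Y h))"
proof -
  have pos: "0 \<le> s + real k * h" for k using assms by simp
  have "indep_vars (\<lambda>_. borel) (\<lambda>k x. Y (s + real (Suc k) * h) x - Y (s + real k * h) x) UNIV"
    using assms by (intro indep_increments[of "\<lambda>k. s + real k * h"]) (auto intro!: mult_right_mono)
  then have "distr M (Pi\<^sub>M UNIV (\<lambda>_. borel)) (\<lambda>x. \<lambda>k\<in>UNIV. Y (s + real (Suc k) * h) x - Y (s + real k * h) x) =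
      Pi\<^sub>M UNIV (\<lambda>k. distr M borel (\<lambda>x. Y (s + real (Suc k) * h) x - Y (s + real k * h) x))"
    by (subst (asm) indep_vars_iff_distr_eq_PiM) (use pos in \<open>auto intro!: borel_measurable_diff Y_measurable simp del: of_nat_Suc\<close>)
  moreover have "distr M borel (\<lambda>x. Y (s + real (Suc k) * h) x - Y (s + real k * h) x) = distr M borel (Y h)" for k
    using stationary[OF pos assms(2), of k] by (simp add: algebra_simps)
  ultimately show ?thesis by (simp only: grid_increments_def[abs_def] restrict_UNIV)
qed

text \<open>Both families are disjoint blocks of the increments along a single time sequence, hence
  independent as blocks.\<close>

lemma indep_grid_increments:
  assumes s: "0 \<le> s" and u: "0 \<le> u" and m: "0 < m"
  shows "indep_var (Pi\<^sub>M {..<m} (\<lambda>_. borel)) (\<lambda>x. restrict (grid_increments 0 (s / real m) x) {..<m})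
    (Pi\<^sub>M UNIV (\<lambda>_. borel)) (grid_increments s (u / real m))"
proof -
  \<comment> \<open>The first m cells, of width s/m, fill [0, s]; from s on the cells have width u/m
    and continue without end.\<close>
  define t where "t k = (if k \<le> m then real k * (s / real m) else s + real (k - m) * (u / real m))" for k
  define X where "X k x = Y (t (Suc k)) x - Y (t k) x" for k x
  have t_hi: "t (m + k) = s + real k * (u / real m)" for k
    using m by (cases k) (auto simp: t_def)
  have "t k \<le> t (Suc k)" for k
  proof (cases "k < m")
    case True
    then have "real k * (s / real m) \<le> real (Suc k) * (s / real m)"
      using s by (intro mult_right_mono) auto
    then show ?thesis using True by (simp add: t_def)
  next
    case False
    then obtain j where k: "k = m + j" by (metis le_add_diff_inverse not_less)
    have "real j * (u / real m) \<le> real (Suc j) * (u / real m)"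
      using u by (intro mult_right_mono) auto
    then show ?thesis using t_hi[of j] t_hi[of "Suc j"] k by simp
  qed
  then have "indep_vars (\<lambda>_. borel) X UNIV"
    unfolding X_def by (intro indep_increments) (auto simp: t_def)
  then have ind: "indep_var (Pi\<^sub>M {..<m} (\<lambda>_. borel)) (\<lambda>x. restrict (\<lambda>k. X k x) {..<m})
      (Pi\<^sub>M {m..} (\<lambda>_. borel)) (\<lambda>x. restrict (\<lambda>k. X k x) {m..})"
    by (rule indep_var_restrict) auto
  have shift: "(\<lambda>g k. g (m + k)) \<in> measurable (Pi\<^sub>M {m..} (\<lambda>_. borel :: real measure)) (Pi\<^sub>M UNIV (\<lambda>_. borel))"
    by (intro measurable_PiM_single' measurable_component_singleton) auto
  have "indep_var (Pi\<^sub>M {..<m} (\<lambda>_. borel)) (id \<circ> (\<lambda>x. restrict (\<lambda>k. X k x) {..<m}))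
      (Pi\<^sub>M UNIV (\<lambda>_. borel)) ((\<lambda>g k. g (m + k)) \<circ> (\<lambda>x. restrict (\<lambda>k. X k x) {m..}))"
    by (rule indep_var_compose[OF ind _ shift]) simp
  moreover have "id \<circ> (\<lambda>x. restrict (\<lambda>k. X k x) {..<m}) = (\<lambda>x. restrict (grid_increments 0 (s / real m) x) {..<m})"
    by (auto simp: fun_eq_iff X_def t_def grid_increments_def)
  moreover have "(\<lambda>g k. g (m + k)) \<circ> (\<lambda>x. restrict (\<lambda>k. X k x) {m..}) = grid_increments s (u / real m)"
    using t_hi[of "Suc _"] by (auto simp: fun_eq_iff X_def t_hi grid_increments_def)
  ultimately show ?thesis by simp
qed

text \<open>A Levy process has no fixed times of discontinuity. By stationarity the increment over
  [t - h, t] has the law of Y h, which tends to 0 with h by right-continuity at 0. So the difference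
  between Y t and the left limit D has truncated mean 0; truncation at 1 makes dominated convergence
  available without moments.\<close>

lemma AE_left_continuous:
  assumes t: "0 < t"
  shows "AE x in M. ((\<lambda>r. Y r x) \<longlongrightarrow> Y t x) (at_left t)"
proof -
  \<comment> \<open>The times t - h n stay nonnegative and increase strictly to t, so the left limit
    is the limit of a sequence and therefore measurable.\<close>
  define h where "h n = t / real (Suc n)" for n
  have h: "0 < h n" "h n \<le> t" for n
    using t by (auto simp: h_def divide_le_eq mult_le_cancel_left1)
  have h0: "h \<longlonglongrightarrow> 0"
    unfolding h_def by (intro LIMSEQ_Suc lim_const_over_n)
  define D where "D x = lim (\<lambda>n. Y (t - h n) x)" for x
  have [measurable]: "Y (t - h n) \<in> borel_measurable M" "Y t \<in> borel_measurable M" "Y (h n) \<in> borel_measurable M" for n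
    using h[of n] t by (auto intro: Y_measurable)
  have [measurable]: "D \<in> borel_measurable M"
    unfolding D_def by measurable
  have left: "filterlim (\<lambda>n. t - h n) (at_left t) sequentially"
  proof (rule filterlim_at_withinI)
    show "(\<lambda>n. t - h n) \<longlonglongrightarrow> t" using tendsto_diff[OF tendsto_const h0, of t] by simp
  qed (use h in auto)
  have right: "filterlim h (at_right 0) sequentially"
    by (rule filterlim_at_withinI) (use h h0 in auto)
  have lim: "AE x in M. (\<lambda>n. Y (t - h n) x) \<longlonglongrightarrow> D x"
    using AE_cadlag
  proof eventually_elim
    case (elim x)
    then obtain l where "((\<lambda>r. Y r x) \<longlongrightarrow> l) (at_left t)" using t by (auto simp: cadlag_def)
    from filterlim_compose[OF this left] show ?case
      by (simp add: D_def limI)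
  qed
  have "(\<integral>x. min 1 \<bar>Y t x - D x\<bar> \<partial>M) = 0"
  proof (rule LIMSEQ_unique)
    show "(\<lambda>n. \<integral>x. min 1 \<bar>Y t x - Y (t - h n) x\<bar> \<partial>M) \<longlonglongrightarrow> (\<integral>x. min 1 \<bar>Y t x - D x\<bar> \<partial>M)"
    proof (rule integral_dominated_convergence[where w = "\<lambda>_. 1"])
      show "AE x in M. (\<lambda>n. min 1 \<bar>Y t x - Y (t - h n) x\<bar>) \<longlonglongrightarrow> min 1 \<bar>Y t x - D x\<bar>"
        using lim by eventually_elim (intro tendsto_intros)
    qed auto
    have "(\<integral>x. min 1 \<bar>Y t x - Y (t - h n) x\<bar> \<partial>M) = (\<integral>x. min 1 \<bar>Y (h n) x\<bar> \<partial>M)" for n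
    proof -
      have "distr M borel (\<lambda>x. Y t x - Y (t - h n) x) = distr M borel (Y (h n))"
        using stationary[of "t - h n" "h n"] h[of n] by simp
      then have "(\<integral>z. min 1 \<bar>z\<bar> \<partial>distr M borel (\<lambda>x. Y t x - Y (t - h n) x)) =
        (\<integral>z. min 1 \<bar>z\<bar> \<partial>distr M borel (Y (h n)))" by simp
      then show ?thesis by (simp add: integral_distr)
    qed
    moreover have "(\<lambda>n. \<integral>x. min 1 \<bar>Y (h n) x\<bar> \<partial>M) \<longlonglongrightarrow> (\<integral>x. 0 \<partial>M)"
    proof (rule integral_dominated_convergence[where w = "\<lambda>_. 1"])
      show "AE x in M. (\<lambda>n. min 1 \<bar>Y (h n) x\<bar>) \<longlonglongrightarrow> 0"
        using AE_cadlag AE_Y_0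
      proof eventually_elim
        case (elim x)
        have "(\<lambda>n. Y (h n) x) \<longlonglongrightarrow> 0"
          using filterlim_compose[OF cadlag_at_right[OF elim(1), of 0] right] elim(2) by simp
        then have "(\<lambda>n. min 1 \<bar>Y (h n) x\<bar>) \<longlonglongrightarrow> min 1 \<bar>0\<bar>" by (intro tendsto_intros)
        then show ?case by simp
      qed
    qed auto
    ultimately show "(\<lambda>n. \<integral>x. min 1 \<bar>Y t x - Y (t - h n) x\<bar> \<partial>M) \<longlonglongrightarrow> 0" by simp
  qed
  then have "AE x in M. min 1 \<bar>Y t x - D x\<bar> = 0"
    by (subst integral_nonneg_eq_0_iff_AE[symmetric]) (auto intro!: integrable_const_bound[where B = 1])
  with lim AE_cadlag show ?thesis
  proof eventually_elim
    case (elim x)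
    then obtain l where l: "((\<lambda>r. Y r x) \<longlongrightarrow> l) (at_left t)" using t by (auto simp: cadlag_def)
    from filterlim_compose[OF this left] elim(1) have "l = D x" by (rule LIMSEQ_unique)
    moreover have "D x = Y t x" using elim(3) by (auto simp: min_def split: if_splits)
    ultimately show ?case using l by simp
  qed
qed

text \<open>The quantifier over u stands inside the almost sure statement, so a random time may be
  substituted for u.\<close>

lemma AE_running_sup: "AE x in M. \<forall>u\<ge>0. running_sup Y u x = path_sup u (path_of Y x)"
  using AE_cadlag by eventually_elim (auto simp: running_sup_def path_of_def path_sup_cadlag)

lemma AE_path_value: "AE x in M. \<forall>t\<ge>0. path_value t (path_of Y x) = Y t x"
  using AE_cadlag by eventually_elim (auto simp: path_of_def path_value_cadlag)

lemma AE_path_sup_le_iff: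
  "AE x in M. \<forall>t\<ge>0. \<forall>y. path_sup (ereal t) (path_of Y x) \<le> ereal y \<longleftrightarrow> (\<forall>r\<in>{0..t}. Y r x \<le> y)"
  using AE_cadlag by eventually_elim (auto simp: path_of_def path_sup_cadlag_le_iff)

section \<open>The Markov property of the supremum at a deterministic time\<close>

definition sup_cdf :: "real \<Rightarrow> real \<Rightarrow> ennreal" where
  "sup_cdf t y = emeasure M {x\<in>space M. path_sup (ereal t) (path_of Y x) \<le> ereal y}"

lemma sup_cdf_nn_integral:
  "sup_cdf t y = (\<integral>\<^sup>+x. (if path_sup (ereal t) (path_of Y x) \<le> ereal y then 1 else 0) \<partial>M)"
proof -
  have "sup_cdf t y = (\<integral>\<^sup>+x. indicator {x\<in>space M. path_sup (ereal t) (path_of Y x) \<le> ereal y} x \<partial>M)"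
    unfolding sup_cdf_def by (rule nn_integral_indicator[symmetric]) measurable
  also have "\<dots> = (\<integral>\<^sup>+x. (if path_sup (ereal t) (path_of Y x) \<le> ereal y then 1 else 0) \<partial>M)"
    by (intro nn_integral_cong) (auto simp: indicator_def)
  finally show ?thesis .
qed

lemma sup_cdf_measurable [measurable (raw)]:
  assumes [measurable]: "t \<in> borel_measurable N" "y \<in> borel_measurable N"
  shows "(\<lambda>x. sup_cdf (t x) (y x)) \<in> borel_measurable N"
  unfolding sup_cdf_nn_integral by measurable

lemma sup_cdf_le_1: "sup_cdf t y \<le> 1"
  unfolding sup_cdf_def by (rule emeasure_le_1)

text \<open>On almost every path the grid event coincides with the supremum event for all large m,
  so the indicators converge boundedly.\<close>

lemma sup_cdf_grid:
  assumes u: "0 \<le> u"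
  shows "(\<lambda>m. emeasure M {x\<in>space M. \<forall>i\<le>m. Y (u * (real i / real m)) x \<le> y}) \<longlonglongrightarrow> sup_cdf u y"
proof -
  have [measurable]: "Y (u * (real i / real m)) \<in> borel_measurable M" for i m
    using u by (intro Y_measurable) auto
  have "(\<lambda>m. \<integral>\<^sup>+x. indicator {x\<in>space M. \<forall>i\<le>m. Y (u * (real i / real m)) x \<le> y} x \<partial>M) \<longlonglongrightarrow>
      (\<integral>\<^sup>+x. indicator {x\<in>space M. path_sup (ereal u) (path_of Y x) \<le> ereal y} x \<partial>M)"
  proof (rule nn_integral_bounded_convergence)
    show "AE x in M. (\<lambda>m. indicator {x\<in>space M. \<forall>i\<le>m. Y (u * (real i / real m)) x \<le> y} x :: ennreal)
        \<longlonglongrightarrow> indicator {x\<in>space M. path_sup (ereal u) (path_of Y x) \<le> ereal y} x"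
      using AE_cadlag AE_path_sup_le_iff
    proof eventually_elim
      case (elim x)
      show ?case
      proof (rule tendsto_eventually)
        show "\<forall>\<^sub>F m in sequentially. (indicator {x\<in>space M. \<forall>i\<le>m. Y (u * (real i / real m)) x \<le> y} x :: ennreal)
          = indicator {x\<in>space M. path_sup (ereal u) (path_of Y x) \<le> ereal y} x"
          using grid_sup_le_eventually[of "\<lambda>t. Y t x" 0 u y, OF elim(1) order_refl u]
          by eventually_elim (use elim u in \<open>auto simp: indicator_def\<close>)
      qed
    qed
    show "(\<lambda>x. indicator {x\<in>space M. \<forall>i\<le>m. Y (u * (real i / real m)) x \<le> y} x) \<in> borel_measurable M" for m
      by measurable
    show "(\<lambda>x. indicator {x\<in>space M. path_sup (ereal u) (path_of Y x) \<le> ereal y} x) \<in> borel_measurable M"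
      by measurable
  qed (simp add: indicator_def)
  moreover have "(\<integral>\<^sup>+x. indicator {x\<in>space M. \<forall>i\<le>m. Y (u * (real i / real m)) x \<le> y} x \<partial>M) =
      emeasure M {x\<in>space M. \<forall>i\<le>m. Y (u * (real i / real m)) x \<le> y}" for m
    by (rule nn_integral_indicator) measurable
  moreover have "(\<integral>\<^sup>+x. indicator {x\<in>space M. path_sup (ereal u) (path_of Y x) \<le> ereal y} x \<partial>M) = sup_cdf u y"
    unfolding sup_cdf_def by (rule nn_integral_indicator) measurable
  ultimately show ?thesis by (simp only:)
qed

text \<open>The constraint on [0, s] and the value at s are functions of the block V, and the
  constraint on [s, s + u] bounds the walk of the block W by y - Y s. The blocks are independent,
  and the steps in W have the law they would have if started at time 0.\<close>

lemma sup_cdf_add_grid: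
  assumes s: "0 \<le> s" and u: "0 \<le> u" and m: "0 < m"
  shows "(\<integral>\<^sup>+x. (if \<forall>i\<le>m. Y (s * (real i / real m)) x \<le> y then
      if \<forall>i\<le>m. Y (s + u * (real i / real m)) x \<le> y then 1 else 0 else 0) \<partial>M) =
    (\<integral>\<^sup>+x. (if \<forall>i\<le>m. Y (s * (real i / real m)) x \<le> y then
      emeasure M {x'\<in>space M. \<forall>i\<le>m. Y (u * (real i / real m)) x' \<le> y - Y s x} else 0) \<partial>M)"
proof -
  define V where "V x = restrict (grid_increments 0 (s / real m) x) {..<m}" for x
  define W where "W = grid_increments s (u / real m)"
  define \<phi> :: "(nat \<Rightarrow> real) \<times> (nat \<Rightarrow> real) \<Rightarrow> ennreal" where
    "\<phi> p = (if \<forall>i\<le>m. rw (fst p) i \<le> y then if \<forall>i\<le>m. rw (snd p) i \<le> y - rw (fst p) m then 1 else 0 else 0)" for p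
  let ?P = "Pi\<^sub>M {..<m} (\<lambda>_. borel :: real measure)" and ?Q = "Pi\<^sub>M UNIV (\<lambda>_. borel :: real measure) :: (nat \<Rightarrow> real) measure"
  have [measurable]: "(\<lambda>v. rw v i) \<in> borel_measurable ?P" if "i \<le> m" for i
    unfolding rw_def using that by (intro borel_measurable_sum measurable_component_singleton) auto
  have [measurable]: "(\<lambda>v. rw v i) \<in> borel_measurable ?Q" for i by (rule rw_measurable)
  have meas: "\<phi> \<in> borel_measurable (?P \<Otimes>\<^sub>M ?Q)"
  proof -
    have 1: "(\<lambda>p. rw (fst p) i) \<in> borel_measurable (?P \<Otimes>\<^sub>M ?Q)" if "i \<le> m" for i
      using that by measurable
    have 2: "(\<lambda>p. rw (snd p) i) \<in> borel_measurable (?P \<Otimes>\<^sub>M ?Q)" for i by measurable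
    show ?thesis unfolding \<phi>_def
      by (intro measurable_If measurable_const pred_intros_finite borel_measurable_pred_le
          borel_measurable_diff 1 2 finite_Collect_le_nat) (auto intro: 1 2)
  qed
  have V: "rw (V x) i = Y (s * (real i / real m)) x - Y 0 x" if "i \<le> m" for x i
  proof -
    have "rw (V x) i = rw (grid_increments 0 (s / real m) x) i"
      unfolding rw_def V_def using that by (intro sum.cong) auto
    then show ?thesis by (simp add: rw_grid_increments mult_ac)
  qed
  have W: "rw (W x) i = Y (s + u * (real i / real m)) x - Y s x" for x i
    unfolding W_def by (simp add: rw_grid_increments mult_ac)
  have "(\<integral>\<^sup>+x. (if \<forall>i\<le>m. Y (s * (real i / real m)) x \<le> y then
      if \<forall>i\<le>m. Y (s + u * (real i / real m)) x \<le> y then 1 else 0 else 0) \<partial>M) = (\<integral>\<^sup>+x. \<phi> (V x, W x) \<partial>M)"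
  proof (rule nn_integral_cong_AE)
    show "AE x in M. (if \<forall>i\<le>m. Y (s * (real i / real m)) x \<le> y then
      if \<forall>i\<le>m. Y (s + u * (real i / real m)) x \<le> y then 1 else 0 else 0) = \<phi> (V x, W x)"
      using AE_Y_0 by eventually_elim (use m in \<open>auto simp: \<phi>_def V W\<close>)
  qed
  also have "\<dots> = (\<integral>\<^sup>+x. \<integral>\<^sup>+x'. \<phi> (V x, W x') \<partial>M \<partial>M)"
    by (rule indep_var_nn_integral[OF _ meas]) (unfold V_def W_def, rule indep_grid_increments[OF s u m])
  also have "\<dots> = (\<integral>\<^sup>+x. (if \<forall>i\<le>m. Y (s * (real i / real m)) x \<le> y then
      emeasure M {x'\<in>space M. \<forall>i\<le>m. Y (u * (real i / real m)) x' \<le> y - Y s x} else 0) \<partial>M)"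
  proof (rule nn_integral_cong_AE)
    show "AE x in M. (\<integral>\<^sup>+x'. \<phi> (V x, W x') \<partial>M) = (if \<forall>i\<le>m. Y (s * (real i / real m)) x \<le> y then
      emeasure M {x'\<in>space M. \<forall>i\<le>m. Y (u * (real i / real m)) x' \<le> y - Y s x} else 0)"
      using AE_Y_0
    proof eventually_elim
      case (elim x)
      define c where "c = y - Y s x"
      define \<psi> :: "(nat \<Rightarrow> real) \<Rightarrow> ennreal" where "\<psi> w = (if \<forall>i\<le>m. rw w i \<le> c then 1 else 0)" for w
      have psi [measurable]: "\<psi> \<in> borel_measurable ?Q" unfolding \<psi>_def by measurable
      have um: "0 \<le> u / real m" using u by simp
      have [measurable]: "Y (u * (real i / real m)) \<in> borel_measurable M" for i
        using u by (intro Y_measurable) auto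
      have "(\<integral>\<^sup>+x'. \<psi> (W x') \<partial>M) = (\<integral>\<^sup>+w. \<psi> w \<partial>distr M ?Q (grid_increments s (u / real m)))"
        unfolding W_def using s um by (intro nn_integral_distr[symmetric]) auto
      \<comment> \<open>Stationarity: the increments after s are replaced by those after 0.\<close>
      also have "\<dots> = (\<integral>\<^sup>+w. \<psi> w \<partial>distr M ?Q (grid_increments 0 (u / real m)))"
        using distr_grid_increments[OF s um] distr_grid_increments[OF order_refl um] by simp
      also have "\<dots> = (\<integral>\<^sup>+x'. \<psi> (grid_increments 0 (u / real m) x') \<partial>M)"
        using um by (intro nn_integral_distr) auto
      also have "\<dots> = (\<integral>\<^sup>+x'. indicator {x'\<in>space M. \<forall>i\<le>m. Y (u * (real i / real m)) x' \<le> c} x' \<partial>M)"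
        by (rule nn_integral_cong_AE) (use AE_Y_0 AE_space in eventually_elim,
          auto simp: \<psi>_def rw_grid_increments mult_ac indicator_def)
      also have "\<dots> = emeasure M {x'\<in>space M. \<forall>i\<le>m. Y (u * (real i / real m)) x' \<le> c}"
        by (rule nn_integral_indicator) measurable
      finally have "(\<integral>\<^sup>+x'. \<psi> (W x') \<partial>M) = \<dots>" .
      moreover define Q where "Q \<longleftrightarrow> (\<forall>i\<le>m. Y (s * (real i / real m)) x \<le> y)"
      have "\<phi> (V x, W x') = (if Q then \<psi> (W x') else 0)" for x'
        using elim m V[of m x] by (auto simp: \<phi>_def \<psi>_def V c_def Q_def)
      ultimately show ?case unfolding Q_def[symmetric] c_def[symmetric] by (cases Q) simp_all
    qed
  qed
  finally show ?thesis .
qed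

text \<open>Both sides are limits of one sequence, because the grid identity holds for every m > 0.
  The grids on [0, s] and [s, s + u] together exhaust [0, s + u], while on the other side
  \<open>sup_cdf_grid\<close> applies at each level y - Y s.\<close>

lemma sup_cdf_add:
  assumes s: "0 \<le> s" and u: "0 \<le> u"
  shows "sup_cdf (s + u) y =
    (\<integral>\<^sup>+x. (if path_sup (ereal s) (path_of Y x) \<le> ereal y then sup_cdf u (y - Y s x) else 0) \<partial>M)"
proof (rule LIMSEQ_unique)
  have [measurable]: "Y (s * (real i / real m)) \<in> borel_measurable M"
    "Y (s + u * (real i / real m)) \<in> borel_measurable M" "Y s \<in> borel_measurable M"
    "Y (u * (real i / real m)) \<in> borel_measurable M" for i m
    using s u by (auto intro!: Y_measurable)
  let ?L = "\<lambda>m. \<integral>\<^sup>+x. (if \<forall>i\<le>m. Y (s * (real i / real m)) x \<le> y then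
      if \<forall>i\<le>m. Y (s + u * (real i / real m)) x \<le> y then 1 else 0 else 0) \<partial>M"
  let ?R = "\<lambda>m. \<integral>\<^sup>+x. (if \<forall>i\<le>m. Y (s * (real i / real m)) x \<le> y then
      emeasure M {x'\<in>space M. \<forall>i\<le>m. Y (u * (real i / real m)) x' \<le> y - Y s x} else 0) \<partial>M"
  have LR: "\<forall>\<^sub>F m in sequentially. ?L m = ?R m"
    using eventually_gt_at_top[of 0] by eventually_elim (rule sup_cdf_add_grid[OF s u])
  show "?L \<longlonglongrightarrow> sup_cdf (s + u) y"
    unfolding sup_cdf_nn_integral
  proof (rule nn_integral_bounded_convergence)
    show "AE x in M. (\<lambda>m. if \<forall>i\<le>m. Y (s * (real i / real m)) x \<le> y then
      if \<forall>i\<le>m. Y (s + u * (real i / real m)) x \<le> y then 1 else 0 else 0 :: ennreal) \<longlonglongrightarrow>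
      (if path_sup (ereal (s + u)) (path_of Y x) \<le> ereal y then 1 else 0)"
      using AE_cadlag AE_path_sup_le_iff
    proof eventually_elim
      case (elim x)
      have split: "(\<forall>r\<in>{0..s + u}. Y r x \<le> y) \<longleftrightarrow> (\<forall>r\<in>{0..0 + s}. Y r x \<le> y) \<and> (\<forall>r\<in>{s..s + u}. Y r x \<le> y)"
        using s u by force
      show ?case
        by (rule tendsto_eventually,
          use grid_sup_le_eventually[of "\<lambda>t. Y t x" 0 s y, OF elim(1) order_refl s]
            grid_sup_le_eventually[of "\<lambda>t. Y t x" s u y, OF elim(1) s u]
          in eventually_elim)
         (use elim(2) s u split in auto)
    qed
    show "(\<lambda>x. if \<forall>i\<le>m. Y (s * (real i / real m)) x \<le> y then
      if \<forall>i\<le>m. Y (s + u * (real i / real m)) x \<le> y then 1 else 0 else 0) \<in> borel_measurable M" for m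
      by measurable
    show "(\<lambda>x. if path_sup (ereal (s + u)) (path_of Y x) \<le> ereal y then 1 else 0) \<in> borel_measurable M"
      by measurable
  qed simp
  have "?R \<longlonglongrightarrow> (\<integral>\<^sup>+x. (if path_sup (ereal s) (path_of Y x) \<le> ereal y then sup_cdf u (y - Y s x) else 0) \<partial>M)"
  proof (rule nn_integral_bounded_convergence)
    show "AE x in M. (\<lambda>m. if \<forall>i\<le>m. Y (s * (real i / real m)) x \<le> y then
      emeasure M {x'\<in>space M. \<forall>i\<le>m. Y (u * (real i / real m)) x' \<le> y - Y s x} else 0) \<longlonglongrightarrow>
      (if path_sup (ereal s) (path_of Y x) \<le> ereal y then sup_cdf u (y - Y s x) else 0)"
      using AE_cadlag AE_path_sup_le_iff
    proof eventually_elim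
      case (elim x)
      have ev: "\<forall>\<^sub>F m in sequentially. (\<forall>i\<le>m. Y (s * (real i / real m)) x \<le> y) \<longleftrightarrow>
          path_sup (ereal s) (path_of Y x) \<le> ereal y"
        using grid_sup_le_eventually[of "\<lambda>t. Y t x" 0 s y, OF elim(1) order_refl s]
        by eventually_elim (use elim(2) s in auto)
      have "(\<lambda>m. if path_sup (ereal s) (path_of Y x) \<le> ereal y then
        emeasure M {x'\<in>space M. \<forall>i\<le>m. Y (u * (real i / real m)) x' \<le> y - Y s x} else 0) \<longlonglongrightarrow>
        (if path_sup (ereal s) (path_of Y x) \<le> ereal y then sup_cdf u (y - Y s x) else 0)"
        using sup_cdf_grid[OF u] by simp
      then show ?case
        by (rule Lim_transform_eventually) (use ev in eventually_elim, auto)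
    qed
    fix m
    have "(\<lambda>x. emeasure M {x'\<in>space M. \<forall>i\<le>m. Y (u * (real i / real m)) x' \<le> y - Y s x}) =
      (\<lambda>x. \<integral>\<^sup>+x'. (if \<forall>i\<le>m. Y (u * (real i / real m)) x' \<le> y - Y s x then 1 else 0) \<partial>M)"
    proof
      fix x
      have "emeasure M {x'\<in>space M. \<forall>i\<le>m. Y (u * (real i / real m)) x' \<le> y - Y s x} =
        (\<integral>\<^sup>+x'. indicator {x'\<in>space M. \<forall>i\<le>m. Y (u * (real i / real m)) x' \<le> y - Y s x} x' \<partial>M)"
        by (rule nn_integral_indicator[symmetric]) measurable
      also have "\<dots> = (\<integral>\<^sup>+x'. (if \<forall>i\<le>m. Y (u * (real i / real m)) x' \<le> y - Y s x then 1 else 0) \<partial>M)"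
        by (intro nn_integral_cong) (auto simp: indicator_def)
      finally show "emeasure M {x'\<in>space M. \<forall>i\<le>m. Y (u * (real i / real m)) x' \<le> y - Y s x} = \<dots>" .
    qed
    moreover have "(\<lambda>x. \<integral>\<^sup>+x'. (if \<forall>i\<le>m. Y (u * (real i / real m)) x' \<le> y - Y s x then 1 else 0) \<partial>M) \<in> borel_measurable M"
      by measurable
    ultimately have "(\<lambda>x. emeasure M {x'\<in>space M. \<forall>i\<le>m. Y (u * (real i / real m)) x' \<le> y - Y s x}) \<in> borel_measurable M"
      by (simp only:)
    then show "(\<lambda>x. if \<forall>i\<le>m. Y (s * (real i / real m)) x \<le> y then
      emeasure M {x'\<in>space M. \<forall>i\<le>m. Y (u * (real i / real m)) x' \<le> y - Y s x} else 0) \<in> borel_measurable M"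
      by (rule measurable_If[OF _ measurable_const]) measurable
  next
    show "(\<lambda>x. if path_sup (ereal s) (path_of Y x) \<le> ereal y then sup_cdf u (y - Y s x) else 0) \<in> borel_measurable M"
      by measurable
  qed (simp add: emeasure_le_1)
  then show "?L \<longlonglongrightarrow> (\<integral>\<^sup>+x. (if path_sup (ereal s) (path_of Y x) \<le> ereal y then sup_cdf u (y - Y s x) else 0) \<partial>M)"
    by (rule Lim_transform_eventually) (use LR in eventually_elim, simp)
qed

end

section \<open>Wiener--Hopf splitting at an exponential time\<close>

abbreviation exp_measure :: "real \<Rightarrow> real measure" where
  "exp_measure l \<equiv> density lborel (\<lambda>x. ennreal (exponential_density l x))"

section \<open>Rounding an exponential time to a grid\<close>

lemma measure_exp_lessThan:
  assumes l: "0 < l" and a: "0 \<le> a"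
  shows "measure (exp_measure l) {..<a} = 1 - exp (- l * a)"
proof -
  interpret prob_space "exp_measure l" by (rule prob_space_exponential_density[OF l])
  have "AE x in lborel. x \<noteq> a" by (rule AE_lborel_singleton)
  then have "emeasure (exp_measure l) {..<a} = emeasure (exp_measure l) {..a}"
    by (intro emeasure_eq_AE) (auto simp: AE_density)
  also have "\<dots> = ennreal (1 - exp (- l * a))"
    using emeasure_erlang_density[OF l, of 0 a] a by (simp add: erlang_CDF_0)
  finally show ?thesis using l a by (simp add: measure_def)
qed

text \<open>The cell [j/c, (j + 1)/c) carries a difference of consecutive powers of exp (- l / c),
  the probability of outlasting one cell: the rounded index is exactly geometric.\<close>

lemma measure_exp_floor:
  assumes l: "0 < l" and c: "0 < c"
  shows "measure (exp_measure l) {t. nat \<lfloor>t * c\<rfloor> = j} = (1 - exp (- l / c)) * exp (- l / c) ^ j"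
proof -
  interpret prob_space "exp_measure l" by (rule prob_space_exponential_density[OF l])
  define a where "a k = real k / c" for k
  have a: "0 \<le> a k" "a k \<le> a (Suc k)" for k using c by (auto simp: a_def divide_right_mono)
  have CDF: "measure (exp_measure l) {..<a k} = 1 - exp (- l / c) ^ k" for k
    using measure_exp_lessThan[OF l a(1)] by (simp add: a_def exp_of_nat_mult[symmetric] mult_ac)
  have "measure (exp_measure l) {t. nat \<lfloor>t * c\<rfloor> = j} = measure (exp_measure l) ({..<a (Suc j)} - {..<a j})"
  proof (cases j)
    \<comment> \<open>\<open>nat\<close> sends negative numbers to 0, so this cell also contains the
      negative half-line, which has measure 0.\<close>
    case 0
    have "{t. nat \<lfloor>t * c\<rfloor> = 0} = {..<a (Suc 0)}"
      using c by (auto simp: a_def field_simps floor_less_iff)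
    moreover have "measure (exp_measure l) ({..<a (Suc 0)} - {..<a 0}) =
        measure (exp_measure l) {..<a (Suc 0)} - measure (exp_measure l) {..<a 0}"
      by (rule finite_measure_Diff) (use a(2)[of 0] in auto)
    moreover have "measure (exp_measure l) {..<a 0} = 0" using CDF[of 0] by simp
    ultimately show ?thesis unfolding 0 by (simp only: diff_0_right)
  next
    case (Suc i)
    have "{t. nat \<lfloor>t * c\<rfloor> = j} = {..<a (Suc j)} - {..<a j}"
    proof safe
      fix t assume "j = nat \<lfloor>t * c\<rfloor>"
      then have "real j \<le> t * c \<and> t * c < real (Suc j)" using Suc by linarith
      then show "t < a (Suc (nat \<lfloor>t * c\<rfloor>))" "t < a (nat \<lfloor>t * c\<rfloor>) \<Longrightarrow> False"
        using c \<open>j = nat \<lfloor>t * c\<rfloor>\<close> by (auto simp: a_def field_simps)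
    next
      fix t assume "t < a (Suc j)" "\<not> t < a j"
      then have "real j \<le> t * c \<and> t * c < real (Suc j)"
        using c by (auto simp: a_def field_simps)
      then show "nat \<lfloor>t * c\<rfloor> = j" by linarith
    qed
    then show ?thesis by simp
  qed
  also have "\<dots> = measure (exp_measure l) {..<a (Suc j)} - measure (exp_measure l) {..<a j}"
    by (rule finite_measure_Diff) (use a(2)[of j] in auto)
  also have "\<dots> = (1 - exp (- l / c)) * exp (- l / c) ^ j"
    unfolding CDF by (simp add: algebra_simps)
  finally show ?thesis .
qed

lemma AE_exp_measure_pos: "AE t in exp_measure w. 0 < t"
proof -
  have "AE t in lborel. t \<noteq> (0::real)" by (rule AE_lborel_singleton)
  then have "AE t in lborel. 0 < ennreal (exponential_density w t) \<longrightarrow> 0 < t"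
    by eventually_elim (auto simp: exponential_density_def split: if_splits)
  then show ?thesis by (subst AE_density) auto
qed

locale exp_levy = levy +
  fixes l :: real
  assumes l_pos: "0 < l"
begin

abbreviation "Exp \<equiv> exp_measure l"

sublocale Exp: prob_space Exp by (rule prob_space_exponential_density[OF l_pos])

sublocale P: pair_prob_space Exp M ..

text \<open>The exponential time is the first coordinate of the product space \<open>Exp\<close> x
  \<open>M\<close>, which makes it independent of the path by construction.\<close>

definition end_value :: "real \<times> 'a \<Rightarrow> real" where
  "end_value p = path_value (fst p) (path_of Y (snd p))"

text \<open>\<open>real_of_ereal\<close> would send an infinite supremum to 0; at each time t >= 0
  the supremum is almost surely finite, so this default is immaterial.\<close>

definition end_sup :: "real \<times> 'a \<Rightarrow> real" where
  "end_sup p = real_of_ereal (path_sup (ereal (fst p)) (path_of Y (snd p)))"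

lemma end_measurable [measurable]:
  "end_value \<in> borel_measurable (Exp \<Otimes>\<^sub>M M)" "end_sup \<in> borel_measurable (Exp \<Otimes>\<^sub>M M)"
proof -
  have [measurable]: "fst \<in> borel_measurable (Exp \<Otimes>\<^sub>M M)"
    using measurable_fst[of Exp M] by simp
  show "end_value \<in> borel_measurable (Exp \<Otimes>\<^sub>M M)" "end_sup \<in> borel_measurable (Exp \<Otimes>\<^sub>M M)"
    unfolding end_value_def[abs_def] end_sup_def[abs_def] by measurable
qed

text \<open>The rounded index k is geometric and independent of the grid walk, so maximum and
  drawdown have the joint law J of \<open>geometric_max_split\<close>, which factorises.\<close>

lemma grid_max_indep:
  fixes n :: nat
  defines "h \<equiv> 1 / real (Suc n)" and "k \<equiv> \<lambda>t::real. nat \<lfloor>t * real (Suc n)\<rfloor>"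
  shows "P.indep_var borel (\<lambda>p. rw_max (grid_increments 0 h (snd p)) (k (fst p)))
    borel (\<lambda>p. rw_max (grid_increments 0 h (snd p)) (k (fst p)) - rw (grid_increments 0 h (snd p)) (k (fst p)))"
proof -
  let ?Q = "Pi\<^sub>M UNIV (\<lambda>_. borel :: real measure) :: (nat \<Rightarrow> real) measure"
  have h: "0 \<le> h" by (simp add: h_def)
  have [measurable]: "k \<in> measurable borel (count_space UNIV)" unfolding k_def by measurable
  have [measurable]: "fst \<in> borel_measurable (Exp \<Otimes>\<^sub>M M)"
    using measurable_fst[of Exp M] by simp
  have G [measurable]: "grid_increments 0 h \<in> measurable M ?Q" using h by measurable
  have m1: "(\<lambda>p. rw (grid_increments 0 h (snd p)) (k (fst p))) \<in> borel_measurable (Exp \<Otimes>\<^sub>M M)"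
    by (rule measurable_compose_countable[where g = "\<lambda>p. k (fst p)"])
      (auto intro!: measurable_compose[OF _ rw_measurable] simp: measurable_compose[OF measurable_snd G])
  have m2: "(\<lambda>p. rw_max (grid_increments 0 h (snd p)) (k (fst p))) \<in> borel_measurable (Exp \<Otimes>\<^sub>M M)"
    by (rule measurable_compose_countable[where g = "\<lambda>p. k (fst p)"])
      (auto intro!: measurable_compose[OF _ rw_max_measurable] simp: measurable_compose[OF measurable_snd G])
  interpret rho: prob_space "distr M borel (Y h)" using h by (intro prob_space_distr) auto
  interpret W: walk_space "distr M borel (Y h)"
    by unfold_locales simp
  \<comment> \<open>The probability that an exponential time exceeds one cell of width 1/(n +
    1).\<close>
  define q where "q = exp (- l / real (Suc n))"
  have q: "0 < q" "q < 1" using l_pos by (auto simp: q_def)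
  define J where "J A B = (\<Sum>j. (1 - q) * q ^ j *
      measure W.S {w. rw_max w j \<in> A \<and> rw_max w j - rw w j \<in> B})" for A B
  have J: "measure (Exp \<Otimes>\<^sub>M M) {p\<in>space (Exp \<Otimes>\<^sub>M M). rw_max (grid_increments 0 h (snd p)) (k (fst p)) \<in> A \<and>
      rw_max (grid_increments 0 h (snd p)) (k (fst p)) - rw (grid_increments 0 h (snd p)) (k (fst p)) \<in> B} = J A B"
    (is "measure _ ?E = _")
    if [measurable]: "A \<in> sets borel" "B \<in> sets borel" for A B
  proof -
    define Q where "Q j = {w. rw_max w j \<in> A \<and> rw_max w j - rw w j \<in> B}" for j
    have Q: "Q j \<in> sets ?Q" for j
    proof -
      have [measurable]: "(\<lambda>w. rw_max w j) \<in> borel_measurable ?Q" "(\<lambda>w. rw w j) \<in> borel_measurable ?Q"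
        by (rule rw_max_measurable rw_measurable)+
      have "{w\<in>space ?Q. rw_max w j \<in> A \<and> rw_max w j - rw w j \<in> B} \<in> sets ?Q" by measurable
      then show ?thesis by (simp only: Q_def space_PiM PiE_UNIV_domain space_borel Pi_UNIV UNIV_I simp_thms)
    qed
    \<comment> \<open>Fixing the index j turns the event into a rectangle: a condition on the time
      multiplied by a condition on the path.\<close>
    define R where "R j = {t. k t = j} \<times> (grid_increments 0 h -` Q j \<inter> space M)" for j
    have Mj [measurable]: "grid_increments 0 h -` Q j \<inter> space M \<in> sets M" for j
      using measurable_sets[OF G Q] .
    have kj [measurable]: "{t. k t = j} \<in> sets borel" for j
    proof -
      have "k -` {j} \<inter> space borel \<in> sets borel"
        by (rule measurable_sets[of k borel "count_space UNIV"]) auto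
      moreover have "k -` {j} \<inter> space borel = {t. k t = j}" by auto
      ultimately show ?thesis by simp
    qed
    have "range R \<subseteq> sets (Exp \<Otimes>\<^sub>M M)" using kj by (auto simp: R_def)
    moreover have "disjoint_family R" by (auto simp: disjoint_family_on_def R_def)
    ultimately have "(\<lambda>j. measure (Exp \<Otimes>\<^sub>M M) (R j)) sums measure (Exp \<Otimes>\<^sub>M M) (\<Union>j. R j)"
      by (rule P.finite_measure_UNION)
    moreover have "(\<Union>j. R j) = ?E"
      by (auto simp: R_def Q_def space_pair_measure)
    moreover have "measure (Exp \<Otimes>\<^sub>M M) (R j) = (1 - q) * q ^ j *
        measure W.S {w. rw_max w j \<in> A \<and> rw_max w j - rw w j \<in> B}" for j
    proof -
      have "emeasure (Exp \<Otimes>\<^sub>M M) (R j) = emeasure Exp {t. k t = j} * emeasure M (grid_increments 0 h -` Q j \<inter> space M)"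
        unfolding R_def by (intro emeasure_pair_measure_Times) auto
      then have "measure (Exp \<Otimes>\<^sub>M M) (R j) = measure Exp {t. k t = j} * measure M (grid_increments 0 h -` Q j \<inter> space M)"
        by (simp add: measure_def enn2real_mult)
      also have "measure Exp {t. k t = j} = (1 - q) * q ^ j"
        unfolding k_def q_def by (rule measure_exp_floor[OF l_pos]) simp
      also have "measure M (grid_increments 0 h -` Q j \<inter> space M) = measure (distr M ?Q (grid_increments 0 h)) (Q j)"
        by (rule measure_distr[symmetric, OF G Q])
      also have "\<dots> = measure W.S (Q j)"
        using distr_grid_increments[OF order_refl h] by simp
      finally show ?thesis by (simp add: Q_def)
    qed
    ultimately show ?thesis unfolding J_def by (simp add: sums_iff)
  qed
  have split: "J A B = J A UNIV * J UNIV B" if "A \<in> sets borel" "B \<in> sets borel" for A B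
    unfolding J_def using W.geometric_max_split[OF that q] .
  show ?thesis
  proof (rule P.indep_var_atMostI)
    fix a b
    show "measure (Exp \<Otimes>\<^sub>M M) {p\<in>space (Exp \<Otimes>\<^sub>M M). rw_max (grid_increments 0 h (snd p)) (k (fst p)) \<le> a \<and>
        rw_max (grid_increments 0 h (snd p)) (k (fst p)) - rw (grid_increments 0 h (snd p)) (k (fst p)) \<le> b} =
      measure (Exp \<Otimes>\<^sub>M M) {p\<in>space (Exp \<Otimes>\<^sub>M M). rw_max (grid_increments 0 h (snd p)) (k (fst p)) \<le> a} *
      measure (Exp \<Otimes>\<^sub>M M) {p\<in>space (Exp \<Otimes>\<^sub>M M).
        rw_max (grid_increments 0 h (snd p)) (k (fst p)) - rw (grid_increments 0 h (snd p)) (k (fst p)) \<le> b}"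
      using J[of "{..a}" "{..b}"] J[of "{..a}" UNIV] J[of UNIV "{..b}"] split[of "{..a}" "{..b}"] by simp
  qed (use m1 m2 in auto)
qed

text \<open>The grid index is rounded down, so both limits are taken from the left of t; almost sure
  left-continuity at the fixed time t is what makes them correct.\<close>

lemma grid_max_tendsto:
  assumes t: "0 < t"
  shows "AE x in M. (\<lambda>n. rw_max (grid_increments 0 (1 / real (Suc n)) x) (nat \<lfloor>t * real (Suc n)\<rfloor>)) \<longlonglongrightarrow> end_sup (t, x) \<and>
    (\<lambda>n. rw (grid_increments 0 (1 / real (Suc n)) x) (nat \<lfloor>t * real (Suc n)\<rfloor>)) \<longlonglongrightarrow> end_value (t, x)"
  using AE_cadlag AE_left_continuous[OF t] AE_Y_0
proof eventually_elim
  case (elim x)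
  have rw: "rw (grid_increments 0 (1 / real (Suc n)) x) j = Y (real j / real (Suc n)) x" for n j
    by (simp add: rw_grid_increments elim)
  have "end_sup (t, x) = Sup ((\<lambda>t. Y t x) ` {0..t})"
    using t path_sup_cadlag_real[OF elim(1), of t] by (simp add: end_sup_def path_of_def)
  moreover have "end_value (t, x) = Y t x"
    using t path_value_cadlag[OF elim(1), of t] by (simp add: end_value_def path_of_def)
  ultimately show ?case
    using floor_grid_Max_tendsto[OF elim(1) t elim(2)] left_grid_tendsto[OF elim(2)] t
    unfolding rw_max_def rw by simp
qed

text \<open>Independence holds on every grid and passes to the almost sure limit. By Fubini the
  convergence is checked for each fixed positive time, where left-continuity is available.\<close>

theorem sup_indep_drawdown:
  "P.indep_var borel end_sup borel (\<lambda>p. end_sup p - end_value p)"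
proof -
  let ?k = "\<lambda>n p. nat \<lfloor>fst p * real (Suc n)\<rfloor>"
  define A where "A n p = rw_max (grid_increments 0 (1 / real (Suc n)) (snd p)) (?k n p)" for n and p :: "real \<times> 'a"
  define B where "B n p = A n p - rw (grid_increments 0 (1 / real (Suc n)) (snd p)) (?k n p)" for n and p :: "real \<times> 'a"
  have ind: "P.indep_var borel (A n) borel (B n)" for n
    using grid_max_indep[of n] by (simp add: A_def[abs_def] B_def[abs_def])
  then have [measurable]: "A n \<in> borel_measurable (Exp \<Otimes>\<^sub>M M)" "B n \<in> borel_measurable (Exp \<Otimes>\<^sub>M M)" for n
    by (auto simp: P.indep_var_eq)
  \<comment> \<open>Convergence is stated for differences tending to 0 because convergence to a
    constant is directly a measurable event.\<close>
  have "AE p in Exp \<Otimes>\<^sub>M M. (\<lambda>n. A n p - end_sup p) \<longlonglongrightarrow> 0 \<and>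
      (\<lambda>n. B n p - (end_sup p - end_value p)) \<longlonglongrightarrow> 0"
  proof (rule P.AE_pair_measure)
    show "{p\<in>space (Exp \<Otimes>\<^sub>M M). (\<lambda>n. A n p - end_sup p) \<longlonglongrightarrow> 0 \<and>
      (\<lambda>n. B n p - (end_sup p - end_value p)) \<longlonglongrightarrow> 0} \<in> sets (Exp \<Otimes>\<^sub>M M)" by measurable
    show "AE t in Exp. AE x in M. (\<lambda>n. A n (t, x) - end_sup (t, x)) \<longlonglongrightarrow> 0 \<and>
      (\<lambda>n. B n (t, x) - (end_sup (t, x) - end_value (t, x))) \<longlonglongrightarrow> 0"
      using AE_exp_measure_pos
    proof eventually_elim
      case (elim t)
      show ?case using grid_max_tendsto[OF elim]
      proof eventually_elim
        case (elim x)
        then show ?case unfolding A_def B_def fst_conv snd_conv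
          by (auto intro!: LIM_zero tendsto_diff)
      qed
    qed
  qed
  then have "AE p in Exp \<Otimes>\<^sub>M M. (\<lambda>n. A n p) \<longlonglongrightarrow> end_sup p"
    "AE p in Exp \<Otimes>\<^sub>M M. (\<lambda>n. B n p) \<longlonglongrightarrow> end_sup p - end_value p"
    by (eventually_elim, auto dest: LIM_zero_cancel)+
  then show ?thesis by (intro P.indep_var_limit[OF ind]) auto
qed

text \<open>\<open>erlang_density k\<close> is the density of a sum of k + 1 exponential times, so k
  counts the interior cuts, not the segments.\<close>

definition erlang_sup_cdf :: "nat \<Rightarrow> real \<Rightarrow> ennreal" where
  "erlang_sup_cdf k y = (\<integral>\<^sup>+t. ennreal (erlang_density k l t) * sup_cdf t y \<partial>lborel)"

lemma erlang_sup_cdf_measurable [measurable (raw)]: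
  assumes [measurable]: "f \<in> borel_measurable N"
  shows "(\<lambda>x. erlang_sup_cdf k (f x)) \<in> borel_measurable N"
  unfolding erlang_sup_cdf_def by measurable

lemma AE_path_sup_eq_end_sup:
  "0 \<le> t \<Longrightarrow> AE x in M. path_sup (ereal t) (path_of Y x) = ereal (end_sup (t, x))"
  using AE_cadlag by eventually_elim (simp add: end_sup_def path_of_def path_sup_cadlag_real)

lemma AE_end_value: "0 \<le> t \<Longrightarrow> AE x in M. end_value (t, x) = Y t x"
  using AE_path_value by eventually_elim (simp add: end_value_def)

lemma erlang_sup_cdf_0:
  "erlang_sup_cdf 0 y = (\<integral>\<^sup>+p. (if end_sup p \<le> y then 1 else 0) \<partial>(Exp \<Otimes>\<^sub>M M))"
proof -
  have "(\<integral>\<^sup>+p. (if end_sup p \<le> y then 1 else 0) \<partial>(Exp \<Otimes>\<^sub>M M)) =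
      (\<integral>\<^sup>+t. \<integral>\<^sup>+x. (if end_sup (t, x) \<le> y then 1 else 0) \<partial>M \<partial>Exp)"
    by (intro nn_integral_fst[symmetric]) measurable
  also have "\<dots> = (\<integral>\<^sup>+t. sup_cdf t y \<partial>Exp)"
  proof (rule nn_integral_cong_AE)
    show "AE t in Exp. (\<integral>\<^sup>+x. (if end_sup (t, x) \<le> y then 1 else 0) \<partial>M) = sup_cdf t y"
      using AE_exp_measure_pos
    proof eventually_elim
      case (elim t)
      have "AE x in M. path_sup (ereal t) (path_of Y x) = ereal (end_sup (t, x))"
        using elim by (intro AE_path_sup_eq_end_sup) simp
      then show ?case unfolding sup_cdf_nn_integral
        by (intro nn_integral_cong_AE, eventually_elim) simp
    qed
  qed
  also have "\<dots> = erlang_sup_cdf 0 y"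
    unfolding erlang_sup_cdf_def by (subst nn_integral_density) auto
  finally show ?thesis by simp
qed

text \<open>The first exponential time t is separated from the remaining Erlang time u. For fixed t
  and u this is \<open>sup_cdf_add\<close>; Fubini and the convolution of the two densities
  recombine t + u into an Erlang time with one more phase.\<close>

lemma erlang_sup_cdf_Suc:
  "erlang_sup_cdf (Suc k) y =
    (\<integral>\<^sup>+p. (if end_sup p \<le> y then erlang_sup_cdf k (y - end_value p) else 0) \<partial>(Exp \<Otimes>\<^sub>M M))"
proof -
  let ?e = "\<lambda>k t. ennreal (erlang_density k l t)"
  have "(\<integral>\<^sup>+p. (if end_sup p \<le> y then erlang_sup_cdf k (y - end_value p) else 0) \<partial>(Exp \<Otimes>\<^sub>M M)) =
    (\<integral>\<^sup>+t. \<integral>\<^sup>+x. (if end_sup (t, x) \<le> y then erlang_sup_cdf k (y - end_value (t, x)) else 0) \<partial>M \<partial>Exp)"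
    by (intro nn_integral_fst[symmetric]) measurable
  also have "\<dots> = (\<integral>\<^sup>+t. \<integral>\<^sup>+u. ?e k u * sup_cdf (t + u) y \<partial>lborel \<partial>Exp)"
  proof (rule nn_integral_cong_AE)
    show "AE t in Exp. (\<integral>\<^sup>+x. (if end_sup (t, x) \<le> y then erlang_sup_cdf k (y - end_value (t, x)) else 0) \<partial>M) =
      (\<integral>\<^sup>+u. ?e k u * sup_cdf (t + u) y \<partial>lborel)"
      using AE_exp_measure_pos
    proof eventually_elim
      case (elim t)
      then have t: "0 \<le> t" by simp
      have [measurable]: "Y t \<in> borel_measurable M" using t by measurable
      have "(\<integral>\<^sup>+x. (if end_sup (t, x) \<le> y then erlang_sup_cdf k (y - end_value (t, x)) else 0) \<partial>M) =
        (\<integral>\<^sup>+x. \<integral>\<^sup>+u. ?e k u * (if path_sup (ereal t) (path_of Y x) \<le> ereal y then sup_cdf u (y - Y t x) else 0) \<partial>lborel \<partial>M)"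
      proof (rule nn_integral_cong_AE)
        show "AE x in M. (if end_sup (t, x) \<le> y then erlang_sup_cdf k (y - end_value (t, x)) else 0) =
          (\<integral>\<^sup>+u. ?e k u * (if path_sup (ereal t) (path_of Y x) \<le> ereal y then sup_cdf u (y - Y t x) else 0) \<partial>lborel)"
          using AE_path_sup_eq_end_sup[OF t] AE_end_value[OF t]
          by eventually_elim (simp add: erlang_sup_cdf_def)
      qed
      also have "\<dots> = (\<integral>\<^sup>+u. \<integral>\<^sup>+x. ?e k u * (if path_sup (ereal t) (path_of Y x) \<le> ereal y then sup_cdf u (y - Y t x) else 0) \<partial>M \<partial>lborel)"
      proof -
        interpret L: pair_sigma_finite lborel M ..
        show ?thesis by (rule L.Fubini') measurable
      qed
      also have "\<dots> = (\<integral>\<^sup>+u. ?e k u * sup_cdf (t + u) y \<partial>lborel)"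
      proof (rule nn_integral_cong)
        fix u :: real
        show "(\<integral>\<^sup>+x. ?e k u * (if path_sup (ereal t) (path_of Y x) \<le> ereal y then sup_cdf u (y - Y t x) else 0) \<partial>M) =
          ?e k u * sup_cdf (t + u) y"
        proof (cases "0 \<le> u")
          case True
          show ?thesis unfolding sup_cdf_add[OF t True] by (rule nn_integral_cmult) measurable
        qed (simp add: erlang_density_def)
      qed
      finally show ?case .
    qed
  qed
  also have "\<dots> = (\<integral>\<^sup>+t. ?e 0 t * (\<integral>\<^sup>+u. ?e k u * sup_cdf (t + u) y \<partial>lborel) \<partial>lborel)"
    by (subst nn_integral_density) auto
  also have "\<dots> = (\<integral>\<^sup>+t. \<integral>\<^sup>+u. ?e 0 t * (?e k u * sup_cdf (t + u) y) \<partial>lborel \<partial>lborel)"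
    by (intro nn_integral_cong nn_integral_cmult[symmetric]) measurable
  also have "\<dots> = (\<integral>\<^sup>+u. \<integral>\<^sup>+t. ?e 0 t * (?e k u * sup_cdf (t + u) y) \<partial>lborel \<partial>lborel)"
    by (rule lborel_pair.Fubini') measurable
  \<comment> \<open>Substitution of the total time v = t + u.\<close>
  also have "\<dots> = (\<integral>\<^sup>+u. \<integral>\<^sup>+v. ?e 0 (v - u) * (?e k u * sup_cdf v y) \<partial>lborel \<partial>lborel)"
  proof (rule nn_integral_cong)
    fix u
    show "(\<integral>\<^sup>+t. ?e 0 t * (?e k u * sup_cdf (t + u) y) \<partial>lborel) =
        (\<integral>\<^sup>+v. ?e 0 (v - u) * (?e k u * sup_cdf v y) \<partial>lborel)"
      by (subst nn_integral_real_affine[where c = 1 and t = "- u"]) auto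
  qed
  also have "\<dots> = (\<integral>\<^sup>+v. \<integral>\<^sup>+u. ?e 0 (v - u) * (?e k u * sup_cdf v y) \<partial>lborel \<partial>lborel)"
    by (rule lborel_pair.Fubini') measurable
  also have "\<dots> = (\<integral>\<^sup>+v. (\<integral>\<^sup>+u. ?e 0 (v - u) * ?e k u \<partial>lborel) * sup_cdf v y \<partial>lborel)"
    by (intro nn_integral_cong, subst nn_integral_multc[symmetric]) (auto simp: mult_ac)
  also have "\<dots> = erlang_sup_cdf (Suc k) y"
    unfolding erlang_sup_cdf_def using convolution_erlang_density[OF l_pos, of 0 k]
    by (intro nn_integral_cong arg_cong2[where f = "(*)"] refl) (auto simp: fun_eq_iff)
  finally show ?thesis by simp
qed

end

section \<open>Suprema at Erlang times and maxima of walks\<close>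

context walk_space
begin

section \<open>Distribution functions of walk maxima\<close>

definition walk_cdf :: "nat \<Rightarrow> real \<Rightarrow> ennreal" where
  "walk_cdf k y = (\<integral>\<^sup>+w. (if \<forall>n\<le>k. rw w n \<le> y then 1 else 0) \<partial>S)"

lemma walk_cdf_measurable [measurable (raw)]:
  assumes [measurable]: "f \<in> borel_measurable N"
  shows "(\<lambda>x. walk_cdf k (f x)) \<in> borel_measurable N"
  unfolding walk_cdf_def by measurable

lemma walk_cdf_le_1: "walk_cdf k y \<le> 1"
proof -
  have "walk_cdf k y \<le> (\<integral>\<^sup>+w. 1 \<partial>S)" unfolding walk_cdf_def by (intro nn_integral_mono) auto
  then show ?thesis using P.emeasure_space_1 by simp
qed

lemma walk_cdf_0: "walk_cdf 0 y = (if 0 \<le> y then 1 else 0)"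
  using P.emeasure_space_1 by (simp add: walk_cdf_def rw_def)

lemma rw_case_nat: "rw (case_nat z w) (Suc n) = z + rw w n"
  unfolding rw_def by (subst sum.lessThan_Suc_shift) simp

text \<open>The first step z is split off: the remaining walk must stay below y - z. The condition 0
  <= y comes from the starting value, which belongs to the maximum.\<close>

lemma walk_cdf_Suc: "walk_cdf (Suc k) y = (if 0 \<le> y then \<integral>\<^sup>+z. walk_cdf k (y - z) \<partial>\<rho> else 0)"
proof -
  interpret R: pair_prob_space \<rho> S ..
  have split: "(\<forall>n\<le>Suc k. rw (case_nat z w) n \<le> y) \<longleftrightarrow> 0 \<le> y \<and> (\<forall>n\<le>k. rw w n \<le> y - z)" for z w
  proof -
    have "(\<forall>n\<le>Suc k. rw (case_nat z w) n \<le> y) \<longleftrightarrow>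
        rw (case_nat z w) 0 \<le> y \<and> (\<forall>n\<le>k. rw (case_nat z w) (Suc n) \<le> y)"
      by (metis Suc_le_mono le0 not0_implies_Suc)
    moreover have "rw (case_nat z w) 0 = 0" by (simp add: rw_def)
    moreover have "rw (case_nat z w) (Suc n) \<le> y \<longleftrightarrow> rw w n \<le> y - z" for n
      by (auto simp: rw_case_nat)
    ultimately show ?thesis by simp
  qed
  have m: "(\<lambda>(z, w). case_nat z w) \<in> measurable (\<rho> \<Otimes>\<^sub>M S) S" by measurable
  have snd: "(\<lambda>p. rw (snd p) n) \<in> borel_measurable (\<rho> \<Otimes>\<^sub>M S)" for n
    by (rule measurable_compose[OF measurable_snd S_measurable(1)])
  have fst: "fst \<in> borel_measurable (\<rho> \<Otimes>\<^sub>M S)"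
    using measurable_fst[of \<rho> S] by (simp add: measurable_cong_sets[OF refl sets_rho])
  have "walk_cdf (Suc k) y = (\<integral>\<^sup>+w. (if \<forall>n\<le>Suc k. rw w n \<le> y then 1 else 0) \<partial>distr (\<rho> \<Otimes>\<^sub>M S) S (\<lambda>(z, w). case_nat z w))"
    unfolding walk_cdf_def PiM_iter ..
  also have "\<dots> = (\<integral>\<^sup>+p. (if \<forall>n\<le>Suc k. rw (case p of (z, w) \<Rightarrow> case_nat z w) n \<le> y then 1 else 0) \<partial>(\<rho> \<Otimes>\<^sub>M S))"
    by (rule nn_integral_distr[OF m]) measurable
  also have "\<dots> = (\<integral>\<^sup>+p. (if 0 \<le> y \<and> (\<forall>n\<le>k. rw (snd p) n \<le> y - fst p) then 1 else 0) \<partial>(\<rho> \<Otimes>\<^sub>M S))"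
    by (intro nn_integral_cong) (auto simp: split_beta split)
  also have "\<dots> = (\<integral>\<^sup>+z. \<integral>\<^sup>+w. (if 0 \<le> y \<and> (\<forall>n\<le>k. rw w n \<le> y - z) then 1 else 0) \<partial>S \<partial>\<rho>)"
  proof -
    have "(\<lambda>p. if 0 \<le> y \<and> (\<forall>n\<le>k. rw (snd p) n \<le> y - fst p) then 1 else 0 :: ennreal) \<in> borel_measurable (\<rho> \<Otimes>\<^sub>M S)"
      using snd fst by measurable
    from P.nn_integral_fst[OF this] show ?thesis by simp
  qed
  also have "\<dots> = (if 0 \<le> y then \<integral>\<^sup>+z. walk_cdf k (y - z) \<partial>\<rho> else 0)"
    by (simp add: walk_cdf_def)
  finally show ?thesis .
qed

end

context exp_levy
begin

abbreviation "step_law \<equiv> distr (Exp \<Otimes>\<^sub>M M) borel end_value"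

lemma walk_space_step_law: "walk_space step_law"
proof -
  interpret st: prob_space step_law by (rule P.prob_space_distr) measurable
  show ?thesis by unfold_locales simp
qed

sublocale W: walk_space step_law by (rule walk_space_step_law)

text \<open>Splitting each segment into its supremum and its drawdown, which are independent, and
  regrouping the drawdown of one segment with the supremum of the next turns the supremum over
  \<open>k + 1\<close> segments into the first supremum plus the maximum of a walk with \<open>k\<close> steps.\<close>

theorem erlang_sup_cdf_eq:
  "erlang_sup_cdf k y = (\<integral>\<^sup>+p. W.walk_cdf k (y - end_sup p) \<partial>(Exp \<Otimes>\<^sub>M M))"
proof (induction k arbitrary: y)
  case 0
  show ?case unfolding erlang_sup_cdf_0 W.walk_cdf_0 by (intro nn_integral_cong) auto
next
  case (Suc k)
  let ?P = "Exp \<Otimes>\<^sub>M M"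
  define D where "D p = end_sup p - end_value p" for p
  have [measurable]: "D \<in> borel_measurable ?P" unfolding D_def[abs_def] by measurable
  have ind: "P.indep_var borel end_sup borel D"
    using sup_indep_drawdown by (simp add: D_def[abs_def])
  \<comment> \<open>Here p supplies a supremum and q the drawdown of an independent copy. Since
    supremum and drawdown at one point are independent, q may be replaced by p, and the difference
    becomes \<open>end_value p\<close>, whose law is the step law.\<close>
  have regroup: "(\<integral>\<^sup>+q. \<integral>\<^sup>+p. W.walk_cdf k (c - (end_sup p - D q)) \<partial>?P \<partial>?P) = (\<integral>\<^sup>+z. W.walk_cdf k (c - z) \<partial>step_law)" for c
  proof -
    interpret PP: pair_sigma_finite ?P ?P ..
    have "(\<integral>\<^sup>+q. \<integral>\<^sup>+p. W.walk_cdf k (c - (end_sup p - D q)) \<partial>?P \<partial>?P) =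
      (\<integral>\<^sup>+p. \<integral>\<^sup>+q. W.walk_cdf k (c - (end_sup p - D q)) \<partial>?P \<partial>?P)"
      by (rule PP.Fubini'[symmetric]) measurable
    also have "\<dots> = (\<integral>\<^sup>+p. W.walk_cdf k (c - (end_sup p - D p)) \<partial>?P)"
      using P.indep_var_nn_integral[OF ind, of "\<lambda>(a, b). W.walk_cdf k (c - (a - b))"] by simp
    also have "\<dots> = (\<integral>\<^sup>+z. W.walk_cdf k (c - z) \<partial>step_law)"
      by (subst nn_integral_distr) (auto simp: D_def)
    finally show ?thesis .
  qed
  have "erlang_sup_cdf (Suc k) y =
      (\<integral>\<^sup>+p. (if end_sup p \<le> y then \<integral>\<^sup>+p'. W.walk_cdf k (y - end_value p - end_sup p') \<partial>?P else 0) \<partial>?P)"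
    unfolding erlang_sup_cdf_Suc Suc.IH ..
  also have "\<dots> = (\<integral>\<^sup>+p. (if end_sup p \<le> y then \<integral>\<^sup>+p'. W.walk_cdf k (y - end_sup p - (end_sup p' - D p)) \<partial>?P else 0) \<partial>?P)"
  proof -
    have "y - end_value p - end_sup p' = y - end_sup p - (end_sup p' - D p)" for p p'
      by (simp add: D_def)
    then show ?thesis by (simp only:)
  qed
  \<comment> \<open>The same independence in the opposite direction: the first supremum is decoupled
    from its own drawdown, leaving the drawdown free to join the next supremum.\<close>
  also have "\<dots> = (\<integral>\<^sup>+p. \<integral>\<^sup>+q. (if end_sup p \<le> y then \<integral>\<^sup>+p'. W.walk_cdf k (y - end_sup p - (end_sup p' - D q)) \<partial>?P else 0) \<partial>?P \<partial>?P)"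
    using P.indep_var_nn_integral[OF ind, of
      "\<lambda>(a, b). if a \<le> y then \<integral>\<^sup>+p'. W.walk_cdf k (y - a - (end_sup p' - b)) \<partial>?P else 0"] by simp
  also have "\<dots> = (\<integral>\<^sup>+p. (if end_sup p \<le> y then \<integral>\<^sup>+z. W.walk_cdf k (y - end_sup p - z) \<partial>step_law else 0) \<partial>?P)"
    by (intro nn_integral_cong) (auto simp: regroup)
  also have "\<dots> = (\<integral>\<^sup>+p. W.walk_cdf (Suc k) (y - end_sup p) \<partial>?P)"
    by (intro nn_integral_cong) (simp add: W.walk_cdf_Suc)
  finally show ?case .
qed

section \<open>Erlang times with many phases, and geometric mixtures of them\<close>

lemma erlang_CDF_tendsto_0:
  assumes "0 \<le> t"
  shows "(\<lambda>k. erlang_CDF k l t) \<longlonglongrightarrow> 0"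
proof -
  have "(\<lambda>n. (l * t) ^ n /\<^sub>R fact n) sums exp (l * t)" by (rule exp_converges)
  then have "(\<lambda>k. \<Sum>n\<le>k. (l * t) ^ n /\<^sub>R fact n) \<longlonglongrightarrow> exp (l * t)"
    by (simp add: sums_def_le)
  \<comment> \<open>The Erlang distribution function is one minus exp (- l t) times a partial sum of
    the series of exp (l t).\<close>
  then have "(\<lambda>k. 1 - exp (- (l * t)) * (\<Sum>n\<le>k. (l * t) ^ n /\<^sub>R fact n)) \<longlonglongrightarrow> 1 - exp (- (l * t)) * exp (l * t)"
    by (intro tendsto_intros)
  moreover have "1 - exp (- (l * t)) * (\<Sum>n\<le>k. (l * t) ^ n /\<^sub>R fact n) = erlang_CDF k l t" for k
    using assms by (simp add: erlang_CDF_def sum_distrib_left divide_inverse mult_ac)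
  ultimately show ?thesis by (simp add: exp_minus_inverse mult.commute)
qed

definition total_sup_cdf :: "real \<Rightarrow> ennreal" where
  "total_sup_cdf y = (\<integral>\<^sup>+x. (if path_sup \<infinity> (path_of Y x) \<le> ereal y then 1 else 0) \<partial>M)"

lemma AE_path_sup_infinity_le_iff:
  "AE x in M. path_sup \<infinity> (path_of Y x) \<le> ereal y \<longleftrightarrow> (\<forall>r\<ge>0. Y r x \<le> y)"
  using AE_cadlag by eventually_elim (auto simp: path_of_def path_sup_cadlag SUP_le_iff)

lemma total_sup_cdf_le: "0 \<le> t \<Longrightarrow> total_sup_cdf y \<le> sup_cdf t y"
  unfolding total_sup_cdf_def sup_cdf_nn_integral
  by (rule nn_integral_mono_AE, use AE_path_sup_infinity_le_iff AE_path_sup_le_iff in eventually_elim) auto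

lemma sup_cdf_tendsto: "(\<lambda>m. sup_cdf (real m) y) \<longlonglongrightarrow> total_sup_cdf y"
  unfolding total_sup_cdf_def sup_cdf_nn_integral
proof (rule nn_integral_bounded_convergence)
  show "AE x in M. (\<lambda>m. if path_sup (ereal (real m)) (path_of Y x) \<le> ereal y then 1 else 0 :: ennreal)
      \<longlonglongrightarrow> (if path_sup \<infinity> (path_of Y x) \<le> ereal y then 1 else 0)"
    using AE_path_sup_infinity_le_iff[of y] AE_path_sup_le_iff
  proof eventually_elim
    case (elim x)
    have fin: "path_sup (ereal (real m)) (path_of Y x) \<le> ereal y \<longleftrightarrow> (\<forall>r\<in>{0..real m}. Y r x \<le> y)" for m
      using elim(2) by auto
    show ?case
    proof (cases "\<forall>r\<ge>0. Y r x \<le> y")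
      case True
      then show ?thesis by (simp add: elim(1) fin)
    next
      case False
      then obtain r where r: "0 \<le> r" "\<not> Y r x \<le> y" by auto
      obtain m0 :: nat where "r \<le> real m0" using real_arch_simple by blast
      then have "\<not> path_sup (ereal (real m)) (path_of Y x) \<le> ereal y" if "m0 \<le> m" for m
        unfolding fin using r that by (auto intro!: bexI[of _ r])
      then have "\<forall>\<^sub>F m in sequentially. (if path_sup (ereal (real m)) (path_of Y x) \<le> ereal y then 1 else 0 :: ennreal) = 0"
        by (auto simp: eventually_sequentially)
      moreover have "\<not> path_sup \<infinity> (path_of Y x) \<le> ereal y" unfolding elim(1) using False by simp
      ultimately show ?thesis by (simp add: tendsto_eventually)
    qed
  qed
qed auto

text \<open>Every \<open>sup_cdf t\<close> with t >= 0 lies above the limit, which gives the lower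
  bound. For the upper bound the integral is cut at a large m: the Erlang mass before m vanishes as
  k grows, and beyond m the integrand is at most \<open>sup_cdf m\<close>.\<close>

lemma erlang_sup_cdf_tendsto: "(\<lambda>k. erlang_sup_cdf k y) \<longlonglongrightarrow> total_sup_cdf y"
proof (rule order_tendstoI)
  have prob: "(\<integral>\<^sup>+t. ennreal (erlang_density k l t) \<partial>lborel) = 1" for k
    using nn_integral_erlang_ith_moment[OF l_pos, of k 0] by simp
  fix a assume a: "a < total_sup_cdf y"
  have "total_sup_cdf y \<le> erlang_sup_cdf k y" for k
  proof -
    have "total_sup_cdf y = (\<integral>\<^sup>+t. ennreal (erlang_density k l t) * total_sup_cdf y \<partial>lborel)"
      by (simp add: nn_integral_multc prob)
    also have "\<dots> \<le> erlang_sup_cdf k y"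
      unfolding erlang_sup_cdf_def
    proof (rule nn_integral_mono)
      fix t
      show "ennreal (erlang_density k l t) * total_sup_cdf y \<le> ennreal (erlang_density k l t) * sup_cdf t y"
        by (cases "0 \<le> t") (auto simp: erlang_density_def intro!: mult_left_mono total_sup_cdf_le)
    qed
    finally show ?thesis .
  qed
  with a show "\<forall>\<^sub>F k in sequentially. a < erlang_sup_cdf k y"
    by (intro always_eventually allI) (blast intro: less_le_trans)
next
  have prob: "(\<integral>\<^sup>+t. ennreal (erlang_density k l t) \<partial>lborel) = 1" for k
    using nn_integral_erlang_ith_moment[OF l_pos, of k 0] by simp
  fix a assume "total_sup_cdf y < a"
  from order_tendstoD(2)[OF sup_cdf_tendsto this] obtain m where m: "sup_cdf (real m) y < a"
    by (auto dest: eventually_happens)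
  have le: "erlang_sup_cdf k y \<le> ennreal (erlang_CDF k l (real m)) + sup_cdf (real m) y" for k
  proof -
    have "erlang_sup_cdf k y \<le> (\<integral>\<^sup>+t. ennreal (erlang_density k l t) * indicator {..real m} t +
        ennreal (erlang_density k l t) * sup_cdf (real m) y \<partial>lborel)"
      unfolding erlang_sup_cdf_def
    proof (rule nn_integral_mono)
      fix t
      have "sup_cdf t y \<le> sup_cdf (real m) y" if "real m \<le> t"
        unfolding sup_cdf_nn_integral
        by (rule nn_integral_mono_AE, use AE_path_sup_le_iff in eventually_elim) (use that in auto)
      then show "ennreal (erlang_density k l t) * sup_cdf t y \<le> ennreal (erlang_density k l t) * indicator {..real m} t +
        ennreal (erlang_density k l t) * sup_cdf (real m) y"
        using mult_left_mono[OF sup_cdf_le_1[of t y], of "ennreal (erlang_density k l t)"]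
        by (cases "t \<le> real m") (auto simp: add_increasing2 intro!: mult_left_mono)
    qed
    also have "\<dots> = ennreal (erlang_CDF k l (real m)) + sup_cdf (real m) y"
      by (subst nn_integral_add) (auto simp: nn_integral_multc prob nn_integral_erlang_density[OF l_pos])
    finally show ?thesis .
  qed
  have "(\<lambda>k. ennreal (erlang_CDF k l (real m)) + sup_cdf (real m) y) \<longlonglongrightarrow> ennreal 0 + sup_cdf (real m) y"
    by (intro tendsto_add tendsto_ennrealI tendsto_const erlang_CDF_tendsto_0) simp
  then have "\<forall>\<^sub>F k in sequentially. ennreal (erlang_CDF k l (real m)) + sup_cdf (real m) y < a"
    by (rule order_tendstoD) (use m in simp)
  then show "\<forall>\<^sub>F k in sequentially. erlang_sup_cdf k y < a"
    by eventually_elim (rule le_less_trans[OF le])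
qed

text \<open>A rate-\<beta> exponential time is a geometric number of rate-l phases, each being the
  last with probability \<beta>/l. On densities this is the power series of exp ((l - \<beta>) t),
  multiplied by \<beta> exp (- l t).\<close>

lemma exponential_mixture:
  assumes \<beta>: "0 < \<beta>" "\<beta> < l"
  shows "ennreal (exponential_density \<beta> t) =
    (\<Sum>k. ennreal (\<beta> / l * (1 - \<beta> / l) ^ k) * ennreal (erlang_density k l t))"
proof (cases "0 \<le> t")
  case True
  have "(\<lambda>k. \<beta> * exp (- l * t) * (((l - \<beta>) * t) ^ k /\<^sub>R fact k)) sums (\<beta> * exp (- l * t) * exp ((l - \<beta>) * t))"
    by (intro sums_mult exp_converges)
  moreover have "\<beta> * exp (- l * t) * (((l - \<beta>) * t) ^ k /\<^sub>R fact k) =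
      \<beta> / l * (1 - \<beta> / l) ^ k * erlang_density k l t" for k
  proof -
    have "(l - \<beta>) ^ k = (1 - \<beta> / l) ^ k * l ^ k"
      using l_pos by (simp add: power_mult_distrib[symmetric] field_simps)
    then show ?thesis using True l_pos
      by (simp add: erlang_density_def power_mult_distrib divide_inverse mult_ac)
  qed
  moreover have "\<beta> * exp (- l * t) * exp ((l - \<beta>) * t) = exponential_density \<beta> t"
    using True by (simp add: exponential_density_def exp_add[symmetric] algebra_simps)
  ultimately have "(\<lambda>k. \<beta> / l * (1 - \<beta> / l) ^ k * erlang_density k l t) sums exponential_density \<beta> t"
    by simp
  then have "(\<lambda>k. ennreal (\<beta> / l * (1 - \<beta> / l) ^ k * erlang_density k l t)) sums ennreal (exponential_density \<beta> t)"
    using \<beta> by (subst sums_ennreal) (auto simp: exponential_density_nonneg intro!: mult_nonneg_nonneg)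
  then show ?thesis
    using \<beta> by (simp add: sums_iff ennreal_mult'[symmetric])
qed (auto simp: erlang_density_def)

lemma exponential_sup_cdf:
  assumes \<beta>: "0 < \<beta>" "\<beta> < l"
  shows "(\<integral>\<^sup>+t. ennreal (exponential_density \<beta> t) * sup_cdf t y \<partial>lborel) =
    (\<Sum>k. ennreal (\<beta> / l * (1 - \<beta> / l) ^ k) * erlang_sup_cdf k y)"
proof -
  have "(\<integral>\<^sup>+t. ennreal (exponential_density \<beta> t) * sup_cdf t y \<partial>lborel) =
    (\<integral>\<^sup>+t. (\<Sum>k. ennreal (\<beta> / l * (1 - \<beta> / l) ^ k) * (ennreal (erlang_density k l t) * sup_cdf t y)) \<partial>lborel)"
    unfolding exponential_mixture[OF \<beta>] by (intro nn_integral_cong) (simp add: ennreal_suminf_multc[symmetric] mult.assoc)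
  also have "\<dots> = (\<Sum>k. \<integral>\<^sup>+t. ennreal (\<beta> / l * (1 - \<beta> / l) ^ k) * (ennreal (erlang_density k l t) * sup_cdf t y) \<partial>lborel)"
    by (rule nn_integral_suminf) measurable
  also have "\<dots> = (\<Sum>k. ennreal (\<beta> / l * (1 - \<beta> / l) ^ k) * erlang_sup_cdf k y)"
    unfolding erlang_sup_cdf_def by (intro suminf_cong nn_integral_cmult) measurable
  finally show ?thesis .
qed

end

section \<open>Laws, independence and the number of inspections\<close>

text \<open>A function equal almost everywhere to a measurable one is measurable for the completion
  and has the same law there. Path functionals are thus exchanged for their measurable
  versions.\<close>

lemma law_eq_distr:
  assumes X0: "X0 \<in> borel_measurable M" and eq: "AE x in M. X x = X0 x"
  shows "law M X = distr M borel X0"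
proof -
  have X0c: "X0 \<in> borel_measurable (completion M)" using X0 by (rule measurable_completion)
  have "X \<in> borel_measurable (completion M)"
  proof (rule measurableI)
    fix A :: "'b set" assume "A \<in> sets borel"
    then have sets: "X0 -` A \<inter> space (completion M) \<in> sets (completion M)" by (rule measurable_sets[OF X0c])
    have ae: "AE x in completion M. x \<in> X0 -` A \<inter> space (completion M) \<longleftrightarrow> x \<in> X -` A \<inter> space (completion M)"
      using AE_completion[OF eq] by eventually_elim simp
    show "X -` A \<inter> space (completion M) \<in> sets (completion M)"
      by (rule completion.in_sets_AE[OF ae sets]) simp
  qed auto
  then have "law M X = distr (completion M) borel X0"
    unfolding law_def using X0c AE_completion[OF eq] by (intro distr_cong_AE) auto
  then show ?thesis using distr_completion[OF X0] by simp
qed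

lemma (in prob_space) indep_elements_distr:
  assumes ind: "indep_elements M A X B Y"
  shows "distr M (A \<Otimes>\<^sub>M B) (\<lambda>x. (X x, Y x)) = distr M A X \<Otimes>\<^sub>M distr M B Y"
proof (rule sym, rule pair_measure_eqI)
  have [measurable]: "X \<in> measurable M A" "Y \<in> measurable M B"
    using ind by (auto simp: indep_elements_def)
  interpret X: prob_space "distr M A X" by (rule prob_space_distr) measurable
  interpret Y: prob_space "distr M B Y" by (rule prob_space_distr) measurable
  show "sigma_finite_measure (distr M A X)" "sigma_finite_measure (distr M B Y)" by unfold_locales
  show "sets (distr M A X \<Otimes>\<^sub>M distr M B Y) = sets (distr M (A \<Otimes>\<^sub>M B) (\<lambda>x. (X x, Y x)))"
    by (simp cong: sets_pair_measure_cong)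
  fix E F assume EF: "E \<in> sets (distr M A X)" "F \<in> sets (distr M B Y)"
  then have [measurable]: "E \<in> sets A" "F \<in> sets B" by auto
  have "prob ((X -` E \<inter> space M) \<inter> (Y -` F \<inter> space M)) = prob (X -` E \<inter> space M) * prob (Y -` F \<inter> space M)"
    using ind unfolding indep_elements_def by (elim conjE indep_setD) (use EF in auto)
  moreover have "(\<lambda>x. (X x, Y x)) -` (E \<times> F) \<inter> space M = (X -` E \<inter> space M) \<inter> (Y -` F \<inter> space M)"
    by auto
  ultimately show "emeasure (distr M A X) E * emeasure (distr M B Y) F =
      emeasure (distr M (A \<Otimes>\<^sub>M B) (\<lambda>x. (X x, Y x))) (E \<times> F)"
    by (simp add: emeasure_distr emeasure_eq_measure ennreal_mult'')
qed

lemma (in prob_space) indep_elements_nn_integral: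
  assumes ind: "indep_elements M A X B Y" and f [measurable]: "f \<in> borel_measurable (A \<Otimes>\<^sub>M B)"
  shows "(\<integral>\<^sup>+x. f (X x, Y x) \<partial>M) = (\<integral>\<^sup>+a. \<integral>\<^sup>+x. f (a, Y x) \<partial>M \<partial>distr M A X)"
proof -
  have [measurable]: "X \<in> measurable M A" "Y \<in> measurable M B"
    using ind by (auto simp: indep_elements_def)
  interpret Y: prob_space "distr M B Y" by (rule prob_space_distr) measurable
  have "(\<integral>\<^sup>+x. f (X x, Y x) \<partial>M) = (\<integral>\<^sup>+p. f p \<partial>distr M (A \<Otimes>\<^sub>M B) (\<lambda>x. (X x, Y x)))"
    by (simp add: nn_integral_distr)
  also have "\<dots> = (\<integral>\<^sup>+p. f p \<partial>(distr M A X \<Otimes>\<^sub>M distr M B Y))"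
    by (simp add: indep_elements_distr[OF ind])
  also have "\<dots> = (\<integral>\<^sup>+v. \<integral>\<^sup>+w. f (v, w) \<partial>distr M B Y \<partial>distr M A X)"
    by (intro Y.nn_integral_fst[symmetric]) measurable
  also have "\<dots> = (\<integral>\<^sup>+a. \<integral>\<^sup>+x. f (a, Y x) \<partial>M \<partial>distr M A X)"
    by (intro nn_integral_cong nn_integral_distr measurable_compose[OF measurable_Pair1' f]) auto
  finally show ?thesis .
qed

lemma (in prob_space) indep_elements_compose:
  assumes ind: "indep_elements M A X B Y" and g: "g \<in> measurable B C"
  shows "indep_elements M A X C (\<lambda>x. g (Y x))"
proof -
  have Y: "Y \<in> measurable M B" using ind by (simp add: indep_elements_def)
  have sub: "{(\<lambda>x. g (Y x)) -` S \<inter> space M | S. S \<in> sets C} \<subseteq> {Y -` S \<inter> space M | S. S \<in> sets B}"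
  proof (rule subsetI, elim CollectE exE conjE)
    fix E S assume E: "E = (\<lambda>x. g (Y x)) -` S \<inter> space M" and S: "S \<in> sets C"
    have "E = Y -` (g -` S \<inter> space B) \<inter> space M"
      unfolding E using measurable_space[OF Y] by auto
    then show "E \<in> {Y -` S \<inter> space M | S. S \<in> sets B}"
      using measurable_sets[OF g S] by (intro CollectI exI[of _ "g -` S \<inter> space B"] conjI)
  qed
  have "indep_set {X -` S \<inter> space M | S. S \<in> sets A} {Y -` S \<inter> space M | S. S \<in> sets B}"
    using ind by (simp add: indep_elements_def)
  then have "indep_set {X -` S \<inter> space M | S. S \<in> sets A} {(\<lambda>x. g (Y x)) -` S \<inter> space M | S. S \<in> sets C}"
    unfolding indep_set_def by (rule indep_sets_mono_sets) (use sub in \<open>simp split: bool.split\<close>)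
  then show ?thesis
    using ind measurable_compose[OF Y g] by (simp add: indep_elements_def)
qed

section \<open>Probability measures on the extended reals\<close>

lemma prob_space_ereal_convolution:
  assumes "prob_space \<mu>" "prob_space \<nu>" "sets \<mu> = sets borel" "sets \<nu> = sets borel"
  shows "prob_space (ereal_convolution \<mu> \<nu>)"
proof -
  interpret \<mu>: prob_space \<mu> by fact
  interpret \<nu>: prob_space \<nu> by fact
  interpret \<mu>\<nu>: pair_prob_space \<mu> \<nu> ..
  have [measurable_cong]: "sets \<mu> = sets borel" "sets \<nu> = sets borel" by fact+
  show ?thesis unfolding ereal_convolution_def by (rule \<mu>\<nu>.prob_space_distr) measurable
qed

text \<open>The endpoints need no separate data: the mass at minus infinity is a decreasing limit
  along real rays, and the mass at infinity is what remains of the total mass 1. The complementary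
  rays then form a generating pi-system.\<close>

lemma ereal_measure_eqI:
  fixes \<mu> \<nu> :: "ereal measure"
  assumes "prob_space \<mu>" "prob_space \<nu>" and sets: "sets \<mu> = sets borel" "sets \<nu> = sets borel"
    and eq: "\<And>y::real. emeasure \<mu> {..ereal y} = emeasure \<nu> {..ereal y}"
  shows "\<mu> = \<nu>"
proof -
  interpret \<mu>: prob_space \<mu> by fact
  interpret \<nu>: prob_space \<nu> by fact
  have sp: "space \<mu> = UNIV" "space \<nu> = UNIV"
    using sets[THEN sets_eq_imp_space_eq] by auto
  have cdf: "emeasure \<mu> {..a} = emeasure \<nu> {..a}" for a
  proof (cases a)
    case PInf
    then show ?thesis using \<mu>.emeasure_space_1 \<nu>.emeasure_space_1 sp by (simp add: atMost_def)
  next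
    case MInf
    have "(\<Inter>n. {..ereal (- real n)}) = {..- \<infinity>}"
    proof (intro equalityI subsetI)
      fix x :: ereal assume x: "x \<in> (\<Inter>n. {..ereal (- real n)})"
      show "x \<in> {..- \<infinity>}"
      proof (cases x)
        case (real r)
        obtain n :: nat where "- r < real n" using reals_Archimedean2 by blast
        moreover have "r \<le> - real n" using x real by (auto dest: INT_D[of _ _ UNIV n])
        ultimately show ?thesis by simp
      qed (use x in \<open>auto dest: INT_D[of _ _ UNIV 0]\<close>)
    qed auto
    moreover have "range (\<lambda>n. {..ereal (- real n)}) \<subseteq> sets borel" by auto
    ultimately have "(\<lambda>n. emeasure \<mu> {..ereal (- real n)}) \<longlonglongrightarrow> emeasure \<mu> {..- \<infinity>}"
      "(\<lambda>n. emeasure \<nu> {..ereal (- real n)}) \<longlonglongrightarrow> emeasure \<nu> {..- \<infinity>}"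
      using Lim_emeasure_decseq[of "\<lambda>n. {..ereal (- real n)}" \<mu>]
        Lim_emeasure_decseq[of "\<lambda>n. {..ereal (- real n)}" \<nu>]
      by (auto simp: sets decseq_def)
    then show ?thesis unfolding MInf eq by (rule LIMSEQ_unique)
  qed (simp add: eq)
  have Ioi: "emeasure \<mu> {a<..} = emeasure \<nu> {a<..}" for a
  proof -
    have "{a<..} = UNIV - {..a}" by auto
    then show ?thesis
      using emeasure_compl[of "{..a}" \<mu>] emeasure_compl[of "{..a}" \<nu>] cdf[of a]
        \<mu>.emeasure_space_1 \<nu>.emeasure_space_1 by (simp add: sp sets)
  qed
  show ?thesis
  proof (rule measure_eqI_generator_eq_countable[where E = "insert UNIV (range greaterThan)" and \<Omega> = UNIV and A = "{UNIV}"])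
    have "{a<..} \<inter> {b<..} = {max a b<..}" for a b :: ereal by auto
    then show "Int_stable (insert UNIV (range (greaterThan :: ereal \<Rightarrow> _)))"
      by (auto simp: Int_stable_def)
    have gen: "sets (borel :: ereal measure) = sigma_sets UNIV (insert UNIV (range greaterThan))"
    proof -
      have "sets (borel :: ereal measure) = sigma_sets UNIV (range greaterThan)"
        by (simp add: borel_Ioi)
      also have "\<dots> = sigma_sets UNIV (insert UNIV (range greaterThan))"
        by (rule sigma_sets_eqI) (auto intro: sigma_sets_top)
      finally show ?thesis .
    qed
    then show "sets \<mu> = sigma_sets UNIV (insert UNIV (range greaterThan))"
      "sets \<nu> = sigma_sets UNIV (insert UNIV (range greaterThan))" by (simp_all add: sets)
    show "emeasure \<mu> X = emeasure \<nu> X" if "X \<in> insert UNIV (range greaterThan)" for X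
      using that \<mu>.emeasure_space_1 \<nu>.emeasure_space_1 by (auto simp: Ioi sp)
  qed (use \<mu>.emeasure_space_1 sp in auto)
qed

text \<open>Increasing epochs make the set of counted indices an initial segment {1..k} or all of
  {1..}, so its cardinality is the last index not exceeding T. Index 0 satisfies the condition
  without being counted.\<close>

lemma num_inspections_eq_enat_iff:
  assumes inc: "\<And>n. I n x < I (Suc n) x" and 0: "ereal (I 0 x) \<le> T x"
  shows "num_inspections I T x = enat k \<longleftrightarrow> ereal (I k x) \<le> T x \<and> \<not> ereal (I (Suc k) x) \<le> T x"
proof -
  define A where "A = {n. 1 \<le> n \<and> ereal (I n x) \<le> T x}"
  have mono: "I m x \<le> I n x" if "m \<le> n" for m n
    using lift_Suc_mono_le[of "\<lambda>n. I n x", OF less_imp_le[OF inc] that] .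
  have down: "ereal (I m x) \<le> T x" if "ereal (I n x) \<le> T x" "m \<le> n" for m n
    using that mono[of m n] by (auto intro: order_trans[of "ereal (I m x)" "ereal (I n x)"])
  have A: "A = {1..j}" if "ereal (I j x) \<le> T x" "\<not> ereal (I (Suc j) x) \<le> T x" for j
  proof -
    have "n \<le> j" if "ereal (I n x) \<le> T x" for n
      using down[OF that, of "Suc j"] \<open>\<not> ereal (I (Suc j) x) \<le> T x\<close> not_less_eq_eq by blast
    then show ?thesis using down[OF that(1)] by (auto simp: A_def)
  qed
  have num: "num_inspections I T x = (if finite A then enat (card A) else \<infinity>)"
    by (simp add: num_inspections_def A_def Let_def)
  show ?thesis
  proof (cases "\<exists>j. ereal (I j x) \<le> T x \<and> \<not> ereal (I (Suc j) x) \<le> T x")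
    case True
    then obtain j where j: "ereal (I j x) \<le> T x" "\<not> ereal (I (Suc j) x) \<le> T x" by blast
    have "j = k" if "ereal (I k x) \<le> T x" "\<not> ereal (I (Suc k) x) \<le> T x"
      using A[OF j] A[OF that] by (metis card_atLeastAtMost diff_Suc_1)
    then show ?thesis using j by (auto simp: num A[OF j])
  next
    case False
    have "ereal (I n x) \<le> T x" for n by (induction n) (use 0 False in auto)
    then have "A = {1..}" by (auto simp: A_def)
    then show ?thesis using False by (auto simp: num infinite_Ici)
  qed
qed

lemma num_inspections_eq_infinityD:
  assumes inc: "\<And>n. I n x < I (Suc n) x" and 0: "ereal (I 0 x) \<le> T x"
    and inf: "num_inspections I T x = \<infinity>"
  shows "ereal (I k x) \<le> T x"
proof (induction k)
  case (Suc k)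
  have "num_inspections I T x \<noteq> enat k" by (simp add: inf)
  with Suc show ?case by (simp add: num_inspections_eq_enat_iff[of I x T, OF inc 0])
qed (rule 0)

section \<open>Poisson epochs before an exponential killing time\<close>

lemma nn_integral_exp_tail:
  assumes "0 < b" "0 \<le> a"
  shows "(\<integral>\<^sup>+t. ennreal (exponential_density b t) * (if a \<le> t then 1 else 0) \<partial>lborel) = ennreal (exp (- b * a))"
proof -
  interpret prob_space "exp_measure b" by (rule prob_space_exponential_density[OF assms(1)])
  have "(\<integral>\<^sup>+t. ennreal (exponential_density b t) * (if a \<le> t then 1 else 0) \<partial>lborel) = emeasure (exp_measure b) {a..}"
    by (subst emeasure_density) (auto intro!: nn_integral_cong simp: indicator_def)
  also have "{a..} = space (exp_measure b) - {..<a}" by auto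
  also have "emeasure (exp_measure b) \<dots> = ennreal (1 - measure (exp_measure b) {..<a})"
    by (subst emeasure_eq_measure, subst prob_compl) auto
  finally show ?thesis by (simp add: measure_exp_lessThan[OF assms])
qed

text \<open>Exponential tilting: the integrand is w/(b + w) times the exponential density with rate
  b + w.\<close>

lemma nn_integral_exp_laplace:
  assumes w: "0 < w" and b: "0 \<le> b"
  shows "(\<integral>\<^sup>+t. ennreal (exponential_density w t) * ennreal (exp (- b * t)) \<partial>lborel) = ennreal (w / (b + w))"
proof -
  have "exponential_density w t * exp (- b * t) = w / (b + w) * exponential_density (b + w) t" for t
    using w b by (simp add: exponential_density_def exp_add[symmetric] distrib_left mult_ac)
  then have "(\<integral>\<^sup>+t. ennreal (exponential_density w t) * ennreal (exp (- b * t)) \<partial>lborel) =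
    (\<integral>\<^sup>+t. ennreal (w / (b + w)) * ennreal (exponential_density (b + w) t) \<partial>lborel)"
    using w b by (intro nn_integral_cong) (simp add: exponential_density_nonneg ennreal_mult'[symmetric] flip: ennreal_mult)
  also have "\<dots> = ennreal (w / (b + w)) * (\<integral>\<^sup>+t. ennreal (exponential_density (b + w) t) \<partial>lborel)"
    by (rule nn_integral_cmult) measurable
  also have "(\<integral>\<^sup>+t. ennreal (exponential_density (b + w) t) \<partial>lborel) = 1"
    using nn_integral_erlang_ith_moment[of "b + w" 0 0] w b by simp
  finally show ?thesis by simp
qed

lemma AE_exponential_pos:
  assumes D: "distributed M lborel X (exponential_density w)"
  shows "AE x in M. 0 < X x"
proof -
  have "AE t in distr M lborel X. 0 < t"
    unfolding distributed_distr_eq_density[OF D] by (rule AE_exp_measure_pos)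
  then show ?thesis
    using distributed_measurable[OF D] by (subst (asm) AE_distr_iff) auto
qed

lemma AE_killing_time_nonneg:
  assumes killing: "killing_time M \<beta> T"
  shows "AE x in M. 0 \<le> T x"
proof (cases "\<beta> = 0")
  case True
  then have "AE x in M. T x = \<infinity>" using killing by (simp add: killing_time_def)
  then show ?thesis by eventually_elim simp
next
  case False
  then obtain U where U: "distributed M lborel U (exponential_density \<beta>)" "AE x in M. T x = ereal (U x)"
    using killing by (auto simp: killing_time_def)
  show ?thesis using AE_exponential_pos[OF U(1)] U(2) by eventually_elim simp
qed

locale poisson_killing = prob_space M
  for M :: "'a measure" +
  fixes \<beta> \<omega> :: real and I :: "nat \<Rightarrow> 'a \<Rightarrow> real" and T :: "'a \<Rightarrow> ereal"
  assumes \<omega>_pos: "0 < \<omega>" and \<beta>_nonneg: "0 \<le> \<beta>"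
    and poisson: "poisson_epochs M \<omega> I" and killing: "killing_time M \<beta> T"
    and indep: "indep_elements M borel T (Pi\<^sub>M UNIV (\<lambda>_. borel)) (\<lambda>x n. I n x)"
begin

lemma T_measurable [measurable]: "T \<in> borel_measurable M"
  using killing by (simp add: killing_time_def)

lemma I_measurable [measurable]: "I n \<in> borel_measurable M"
proof -
  have "(\<lambda>x n. I n x) \<in> measurable M (Pi\<^sub>M UNIV (\<lambda>_. borel))"
    using indep by (simp add: indep_elements_def)
  from measurable_compose[OF this measurable_component_singleton[of n]] show ?thesis by simp
qed

lemma AE_I_inc: "AE x in M. I 0 x = 0 \<and> (\<forall>n. I n x < I (Suc n) x)"
proof -
  have "AE x in M. 0 < I (Suc n) x - I n x" for n
    using poisson by (intro AE_exponential_pos[where w = \<omega>]) (simp add: poisson_epochs_def)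
  then have "AE x in M. \<forall>n. 0 < I (Suc n) x - I n x" by (simp add: AE_all_countable)
  moreover have "AE x in M. I 0 x = 0"
    using poisson by (intro AE_I2) (simp add: poisson_epochs_def)
  ultimately show ?thesis by eventually_elim simp
qed

text \<open>Conditioning on the epochs turns the probability into the mean of exp (- \<beta> I_k).
  As I_k is a sum of k independent exponential gaps, this is the k-th power of one Laplace
  transform.\<close>

lemma prob_epoch_le:
  assumes \<beta>: "0 < \<beta>"
  shows "emeasure M {x\<in>space M. ereal (I k x) \<le> T x} = ennreal ((\<omega> / (\<beta> + \<omega>)) ^ k)"
proof -
  obtain U where U: "distributed M lborel U (exponential_density \<beta>)" "AE x in M. T x = ereal (U x)"
    using killing \<beta> by (auto simp: killing_time_def)
  have "emeasure M {x\<in>space M. ereal (I k x) \<le> T x} = (\<integral>\<^sup>+x. indicator {x\<in>space M. ereal (I k x) \<le> T x} x \<partial>M)"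
    by (rule nn_integral_indicator[symmetric]) measurable
  also have "\<dots> = (\<integral>\<^sup>+x. (\<lambda>(t, i). if ereal (i k) \<le> t then 1 else 0) (T x, \<lambda>n. I n x) \<partial>M)"
    by (intro nn_integral_cong) (auto simp: indicator_def)
  also have "\<dots> = (\<integral>\<^sup>+t. \<integral>\<^sup>+x. (\<lambda>(t, i). if ereal (i k) \<le> t then 1 else 0) (t, \<lambda>n. I n x) \<partial>M \<partial>distr M borel T)"
    by (rule indep_elements_nn_integral[OF indep]) measurable
  also have "\<dots> = (\<integral>\<^sup>+x'. \<integral>\<^sup>+x. (if ereal (I k x) \<le> T x' then 1 else 0) \<partial>M \<partial>M)"
    by (subst nn_integral_distr) (simp_all split: prod.split)
  also have "\<dots> = (\<integral>\<^sup>+x'. \<integral>\<^sup>+x. (if I k x \<le> U x' then 1 else 0) \<partial>M \<partial>M)"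
    by (rule nn_integral_cong_AE) (use U(2) in eventually_elim, simp)
  also have "\<dots> = (\<integral>\<^sup>+t. ennreal (exponential_density \<beta> t) * (\<integral>\<^sup>+x. (if I k x \<le> t then 1 else 0) \<partial>M) \<partial>lborel)"
    by (rule distributed_nn_integral[OF U(1), symmetric]) measurable
  also have "\<dots> = (\<integral>\<^sup>+t. \<integral>\<^sup>+x. ennreal (exponential_density \<beta> t) * (if I k x \<le> t then 1 else 0) \<partial>M \<partial>lborel)"
    by (intro nn_integral_cong nn_integral_cmult[symmetric]) measurable
  also have "\<dots> = (\<integral>\<^sup>+x. \<integral>\<^sup>+t. ennreal (exponential_density \<beta> t) * (if I k x \<le> t then 1 else 0) \<partial>lborel \<partial>M)"
  proof -
    interpret L: pair_sigma_finite lborel M ..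
    show ?thesis by (rule L.Fubini'[symmetric]) measurable
  qed
  also have "\<dots> = (\<integral>\<^sup>+x. (\<Prod>j<k. ennreal (exp (- \<beta> * (I (Suc j) x - I j x)))) \<partial>M)"
  proof (rule nn_integral_cong_AE)
    show "AE x in M. (\<integral>\<^sup>+t. ennreal (exponential_density \<beta> t) * (if I k x \<le> t then 1 else 0) \<partial>lborel) =
      (\<Prod>j<k. ennreal (exp (- \<beta> * (I (Suc j) x - I j x))))"
      using AE_I_inc
    proof eventually_elim
      case (elim x)
      have "I 0 x \<le> I k x"
        by (rule lift_Suc_mono_le[of "\<lambda>n. I n x"]) (use elim in \<open>simp_all add: less_imp_le\<close>)
      then have "0 \<le> I k x" using elim by simp
      moreover have "(\<Sum>j<k. - \<beta> * (I (Suc j) x - I j x)) = - \<beta> * I k x"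
        using sum_lessThan_telescope[of "\<lambda>n. I n x" k] elim by (simp only: sum_distrib_left[symmetric]) simp
      ultimately show ?case
        by (simp add: nn_integral_exp_tail[OF \<beta>] prod_ennreal exp_sum[symmetric])
    qed
  qed
  also have "\<dots> = (\<Prod>j<k. \<integral>\<^sup>+x. ennreal (exp (- \<beta> * (I (Suc j) x - I j x))) \<partial>M)"
  proof (rule indep_vars_nn_integral)
    have "indep_vars (\<lambda>_. borel) (\<lambda>n x. I (Suc n) x - I n x) {..<k}"
      using poisson by (auto simp: poisson_epochs_def intro: indep_vars_subset)
    then show "indep_vars (\<lambda>_. borel) (\<lambda>j x. ennreal (exp (- \<beta> * (I (Suc j) x - I j x)))) {..<k}"
      by (rule indep_vars_compose2[where Y = "\<lambda>_ d. ennreal (exp (- \<beta> * d))"]) measurable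
  qed auto
  also have "\<dots> = (\<Prod>j<k. ennreal (\<omega> / (\<beta> + \<omega>)))"
  proof (rule prod.cong[OF refl])
    fix j
    have "distributed M lborel (\<lambda>x. I (Suc j) x - I j x) (exponential_density \<omega>)"
      using poisson by (simp add: poisson_epochs_def)
    from distributed_nn_integral[OF this, of "\<lambda>d. ennreal (exp (- \<beta> * d))"]
    show "(\<integral>\<^sup>+x. ennreal (exp (- \<beta> * (I (Suc j) x - I j x))) \<partial>M) = ennreal (\<omega> / (\<beta> + \<omega>))"
      using nn_integral_exp_laplace[OF \<omega>_pos \<beta>_nonneg] by simp
  qed
  also have "\<dots> = ennreal ((\<omega> / (\<beta> + \<omega>)) ^ k)"
    using \<omega>_pos \<beta>_nonneg by (simp add: ennreal_power)
  finally show ?thesis .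
qed

text \<open>With q = \<omega>/(\<beta> + \<omega>), exactly k inspections means that epoch k
  precedes killing and epoch k + 1 does not, which has probability q^k - q^(k+1). Infinitely many
  inspections is contained in each event of probability q^k.\<close>

lemma num_inspections_geometric:
  assumes \<beta>: "0 < \<beta>" and N [measurable]: "num_inspections I T \<in> measurable M (count_space UNIV)"
  shows "emeasure M {x\<in>space M. num_inspections I T x = enat k} =
      ennreal (\<beta> / (\<beta> + \<omega>) * (1 - \<beta> / (\<beta> + \<omega>)) ^ k)"
    and "AE x in M. num_inspections I T x \<noteq> \<infinity>"
proof -
  define q where "q = \<omega> / (\<beta> + \<omega>)"
  have q: "0 \<le> q" "q < 1" "1 - \<beta> / (\<beta> + \<omega>) = q" "\<beta> / (\<beta> + \<omega>) = 1 - q"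
    using \<beta> \<omega>_pos by (auto simp: q_def field_simps)
  define E where "E k = {x\<in>space M. ereal (I k x) \<le> T x}" for k
  have [measurable]: "E k \<in> sets M" for k unfolding E_def by measurable
  have E: "prob (E k) = q ^ k" for k
    using prob_epoch_le[OF \<beta>, of k] q by (simp add: E_def q_def emeasure_eq_measure)
  have good: "AE x in M. (\<forall>n. I n x < I (Suc n) x) \<and> ereal (I 0 x) \<le> T x"
    using AE_I_inc AE_killing_time_nonneg[OF killing] by eventually_elim (simp add: zero_ereal_def)
  have "emeasure M {x\<in>space M. num_inspections I T x = enat k} = emeasure M (E k - E k \<inter> E (Suc k))"
  proof (rule emeasure_eq_AE)
    show "AE x in M. x \<in> {x\<in>space M. num_inspections I T x = enat k} \<longleftrightarrow> x \<in> E k - E k \<inter> E (Suc k)"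
      using good by eventually_elim (auto simp: E_def num_inspections_eq_enat_iff)
  qed auto
  also have "\<dots> = ennreal (prob (E k) - prob (E k \<inter> E (Suc k)))"
    unfolding emeasure_eq_measure by (subst finite_measure_Diff) auto
  also have "prob (E k \<inter> E (Suc k)) = prob (E (Suc k))"
  proof (rule finite_measure_eq_AE)
    show "AE x in M. x \<in> E k \<inter> E (Suc k) \<longleftrightarrow> x \<in> E (Suc k)"
      using good
    proof eventually_elim
      case (elim x)
      then have "ereal (I k x) \<le> ereal (I (Suc k) x)" by (simp add: less_imp_le)
      then show ?case unfolding E_def using order_trans[of "ereal (I k x)" "ereal (I (Suc k) x)" "T x"] by blast
    qed
  qed auto
  finally show "emeasure M {x\<in>space M. num_inspections I T x = enat k} =
      ennreal (\<beta> / (\<beta> + \<omega>) * (1 - \<beta> / (\<beta> + \<omega>)) ^ k)"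
    unfolding q E by (simp add: algebra_simps)
  have "prob {x\<in>space M. num_inspections I T x = \<infinity>} \<le> q ^ k" for k
    unfolding E[symmetric]
  proof (rule finite_measure_mono_AE)
    show "AE x in M. x \<in> {x\<in>space M. num_inspections I T x = \<infinity>} \<longrightarrow> x \<in> E k"
      using good by eventually_elim (auto simp: E_def intro: num_inspections_eq_infinityD)
  qed auto
  moreover have "(\<lambda>k. q ^ k) \<longlonglongrightarrow> 0" using q by (intro LIMSEQ_power_zero) auto
  ultimately have "prob {x\<in>space M. num_inspections I T x = \<infinity>} \<le> 0"
    by (intro LIMSEQ_le_const) auto
  then have "prob {x\<in>space M. num_inspections I T x = \<infinity>} = 0" by (simp add: measure_le_0_iff)
  then show "AE x in M. num_inspections I T x \<noteq> \<infinity>"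
    by (subst (asm) prob_eq_0) auto
qed

end

section \<open>The decomposition\<close>

lemma walk_max_le_iff:
  "walk_max Z N x \<le> ereal y \<longleftrightarrow> (\<forall>n. enat n \<le> N x \<longrightarrow> (\<Sum>m=1..n. Z m x) \<le> y)"
  by (auto simp: walk_max_def SUP_le_iff)

lemma walk_max_measurable:
  assumes [measurable]: "N \<in> measurable M (count_space UNIV)" "\<And>m. 1 \<le> m \<Longrightarrow> Z m \<in> borel_measurable M"
  shows "walk_max Z N \<in> borel_measurable M"
proof (rule borel_measurableI_le)
  fix a :: ereal
  have [measurable]: "(\<lambda>x. \<Sum>m=1..n. Z m x) \<in> borel_measurable M" for n
    using assms(2) by (intro borel_measurable_sum) auto
  have "{x\<in>space M. \<forall>n. enat n \<le> N x \<longrightarrow> ereal (\<Sum>m=1..n. Z m x) \<le> a} \<in> sets M" by measurable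
  moreover have "walk_max Z N x \<le> a \<longleftrightarrow> (\<forall>n. enat n \<le> N x \<longrightarrow> ereal (\<Sum>m=1..n. Z m x) \<le> a)" for x
    by (auto simp: walk_max_def SUP_le_iff)
  ultimately show "{x\<in>space M. walk_max Z N x \<le> a} \<in> sets M" by simp
qed

context exp_levy
begin

section \<open>Transfer of the given random variables to the product space\<close>

lemma indep_exponential_nn_integral:
  assumes T': "distributed M lborel T' (exponential_density l)"
    and ind: "indep_elements M borel T' path_space (path_of Y)"
    and f: "f \<in> borel_measurable (borel \<Otimes>\<^sub>M path_space)"
  shows "(\<integral>\<^sup>+x. f (T' x, path_of Y x) \<partial>M) = (\<integral>\<^sup>+p. f (fst p, path_of Y (snd p)) \<partial>(Exp \<Otimes>\<^sub>M M))"
proof -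
  have [measurable]: "fst \<in> borel_measurable (Exp \<Otimes>\<^sub>M M)"
    using measurable_fst[of Exp M] by simp
  have "distr M borel T' = distr M lborel T'" by (rule distr_cong) simp_all
  also have "\<dots> = Exp" by (rule distributed_distr_eq_density[OF T'])
  finally have "(\<integral>\<^sup>+x. f (T' x, path_of Y x) \<partial>M) = (\<integral>\<^sup>+t. \<integral>\<^sup>+x. f (t, path_of Y x) \<partial>M \<partial>Exp)"
    using indep_elements_nn_integral[OF ind f] by simp
  also have "\<dots> = (\<integral>\<^sup>+p. f (fst p, path_of Y (snd p)) \<partial>(Exp \<Otimes>\<^sub>M M))"
  proof -
    have "(\<lambda>p. f (fst p, path_of Y (snd p))) \<in> borel_measurable (Exp \<Otimes>\<^sub>M M)"
      by (rule measurable_compose[OF _ f]) measurable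
    from nn_integral_fst[OF this] show ?thesis by simp
  qed
  finally show ?thesis .
qed

lemma law_value_at_exponential:
  assumes T': "distributed M lborel T' (exponential_density l)"
    and ind: "indep_elements M borel T' path_space (path_of Y)"
  shows "law M (\<lambda>x. Y (T' x) x) = step_law"
proof -
  have [measurable]: "T' \<in> borel_measurable M" using distributed_measurable[OF T'] by simp
  have "law M (\<lambda>x. Y (T' x) x) = distr M borel (\<lambda>x. path_value (T' x) (path_of Y x))"
    by (rule law_eq_distr) (measurable, use AE_path_value AE_exponential_pos[OF T'] in eventually_elim, simp)
  also have "\<dots> = step_law"
  proof (rule measure_eqI)
    fix A assume "A \<in> sets (distr M borel (\<lambda>x. path_value (T' x) (path_of Y x)))"
    then have [measurable]: "A \<in> sets borel" by simp
    have "emeasure (distr M borel (\<lambda>x. path_value (T' x) (path_of Y x))) A =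
        (\<integral>\<^sup>+z. indicator A z \<partial>distr M borel (\<lambda>x. path_value (T' x) (path_of Y x)))" by simp
    also have "\<dots> = (\<integral>\<^sup>+x. indicator A (path_value (T' x) (path_of Y x)) \<partial>M)"
      by (rule nn_integral_distr) measurable
    also have "\<dots> = (\<integral>\<^sup>+p. indicator A (end_value p) \<partial>(Exp \<Otimes>\<^sub>M M))"
      using indep_exponential_nn_integral[OF T' ind, of "\<lambda>(t, f). indicator A (path_value t f)"]
      by (simp add: end_value_def)
    also have "\<dots> = (\<integral>\<^sup>+z. indicator A z \<partial>step_law)"
      by (rule nn_integral_distr[symmetric]) measurable
    finally show "emeasure (distr M borel (\<lambda>x. path_value (T' x) (path_of Y x))) A = emeasure step_law A"
      by simp
  qed simp
  finally show ?thesis .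
qed

lemma law_sup_at_exponential:
  assumes T': "distributed M lborel T' (exponential_density l)"
    and ind: "indep_elements M borel T' path_space (path_of Y)"
  shows "law M (\<lambda>x. running_sup Y (ereal (T' x)) x) = distr M borel (\<lambda>x. path_sup (ereal (T' x)) (path_of Y x))"
proof -
  have [measurable]: "T' \<in> borel_measurable M" using distributed_measurable[OF T'] by simp
  show ?thesis
    by (rule law_eq_distr) (measurable, use AE_running_sup AE_exponential_pos[OF T'] in eventually_elim, simp)
qed

text \<open>The measure \<mu> may charge infinity, but the supremum up to an exponential time is
  almost surely finite. At a finite value r the inequality u + r <= y can be solved for u in
  \<open>ereal\<close>, which gives the shifted ray.\<close>

lemma emeasure_convolution_sup:
  assumes T': "distributed M lborel T' (exponential_density l)"
    and ind: "indep_elements M borel T' path_space (path_of Y)"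
    and \<mu>: "prob_space \<mu>" "sets \<mu> = sets borel"
  shows "emeasure (ereal_convolution \<mu> (law M (\<lambda>x. running_sup Y (ereal (T' x)) x))) {..ereal y} =
    (\<integral>\<^sup>+p. emeasure \<mu> {..ereal (y - end_sup p)} \<partial>(Exp \<Otimes>\<^sub>M M))"
proof -
  have [measurable]: "T' \<in> borel_measurable M" using distributed_measurable[OF T'] by simp
  have [measurable]: "fst \<in> borel_measurable (Exp \<Otimes>\<^sub>M M)"
    using measurable_fst[of Exp M] by simp
  define \<nu> where "\<nu> = distr M borel (\<lambda>x. path_sup (ereal (T' x)) (path_of Y x))"
  have \<nu>: "prob_space \<nu>" "sets \<nu> = sets borel" unfolding \<nu>_def by (rule prob_space_distr, measurable)
  interpret \<mu>: prob_space \<mu> by fact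
  interpret \<nu>: prob_space \<nu> by fact
  interpret \<mu>\<nu>: pair_prob_space \<mu> \<nu> ..
  have [measurable_cong]: "sets \<mu> = sets borel" "sets \<nu> = sets borel" by fact+
  have sp: "space \<mu> = UNIV" "space \<nu> = UNIV"
    using \<mu>(2) \<nu>(2) by (auto dest: sets_eq_imp_space_eq)
  define h where "h v = (\<integral>\<^sup>+u. (if u + v \<le> ereal y then 1 else 0) \<partial>\<mu>)" for v
  have [measurable]: "h \<in> borel_measurable borel" unfolding h_def by measurable
  have h: "h (ereal r) = emeasure \<mu> {..ereal (y - r)}" for r
  proof -
    have "u + ereal r \<le> ereal y \<longleftrightarrow> u \<le> ereal (y - r)" for u by (cases u) auto
    then have "h (ereal r) = (\<integral>\<^sup>+u. indicator {..ereal (y - r)} u \<partial>\<mu>)"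
      unfolding h_def by (intro nn_integral_cong) (auto simp: indicator_def)
    then show ?thesis by (simp add: \<mu>(2))
  qed
  have m: "(\<lambda>p. fst p + snd p) \<in> borel_measurable (\<mu> \<Otimes>\<^sub>M \<nu>)" by measurable
  have "emeasure (ereal_convolution \<mu> \<nu>) {..ereal y} = (\<integral>\<^sup>+z. indicator {..ereal y} z \<partial>ereal_convolution \<mu> \<nu>)"
    by (simp add: ereal_convolution_def)
  also have "\<dots> = (\<integral>\<^sup>+p. indicator {..ereal y} (fst p + snd p) \<partial>(\<mu> \<Otimes>\<^sub>M \<nu>))"
    unfolding ereal_convolution_def split_beta by (rule nn_integral_distr[OF m]) measurable
  also have "\<dots> = (\<integral>\<^sup>+v. \<integral>\<^sup>+u. indicator {..ereal y} (fst (u, v) + snd (u, v)) \<partial>\<mu> \<partial>\<nu>)"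
    by (rule \<mu>\<nu>.nn_integral_snd[symmetric]) (use m in measurable)
  also have "\<dots> = (\<integral>\<^sup>+v. h v \<partial>\<nu>)"
    unfolding h_def by (intro nn_integral_cong) (auto simp: indicator_def)
  also have "\<dots> = (\<integral>\<^sup>+x. h (path_sup (ereal (T' x)) (path_of Y x)) \<partial>M)"
    unfolding \<nu>_def by (rule nn_integral_distr) measurable
  also have "\<dots> = (\<integral>\<^sup>+p. h (path_sup (ereal (fst p)) (path_of Y (snd p))) \<partial>(Exp \<Otimes>\<^sub>M M))"
    using indep_exponential_nn_integral[OF T' ind, of "\<lambda>(t, f). h (path_sup (ereal t) f)"] by simp
  also have "\<dots> = (\<integral>\<^sup>+p. emeasure \<mu> {..ereal (y - end_sup p)} \<partial>(Exp \<Otimes>\<^sub>M M))"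
  proof (rule nn_integral_cong_AE)
    have "AE p in Exp \<Otimes>\<^sub>M M. path_sup (ereal (fst p)) (path_of Y (snd p)) = ereal (end_sup p)"
    proof (rule P.AE_pair_measure)
      show "{p\<in>space (Exp \<Otimes>\<^sub>M M). path_sup (ereal (fst p)) (path_of Y (snd p)) = ereal (end_sup p)} \<in> sets (Exp \<Otimes>\<^sub>M M)"
        by measurable
      show "AE t in Exp. AE x in M. path_sup (ereal (fst (t, x))) (path_of Y (snd (t, x))) = ereal (end_sup (t, x))"
        using AE_exp_measure_pos by eventually_elim (simp add: AE_path_sup_eq_end_sup)
    qed
    then show "AE p in Exp \<Otimes>\<^sub>M M. h (path_sup (ereal (fst p)) (path_of Y (snd p))) = emeasure \<mu> {..ereal (y - end_sup p)}"
      by eventually_elim (simp add: h)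
  qed
  finally show ?thesis unfolding law_sup_at_exponential[OF T' ind] \<nu>_def .
qed

text \<open>Independence allows the path to be integrated first with the killing time frozen, and
  then the killing time against its own law. \<open>V\<close> stands for the inspection epochs,
  which the independence assumption on T couples with the path.\<close>

lemma emeasure_law_killed_sup:
  assumes killing: "killing_time M \<beta> T"
    and ind: "indep_elements M borel T (path_space \<Otimes>\<^sub>M Q) (\<lambda>x. (path_of Y x, V x))"
  shows "law M (\<lambda>x. running_sup Y (T x) x) = distr M borel (\<lambda>x. path_sup (T x) (path_of Y x))"
    and "emeasure (law M (\<lambda>x. running_sup Y (T x) x)) {..ereal y} = (if \<beta> = 0 then total_sup_cdf y else
      \<integral>\<^sup>+t. ennreal (exponential_density \<beta> t) * sup_cdf t y \<partial>lborel)"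
proof -
  have [measurable]: "T \<in> borel_measurable M" using killing by (simp add: killing_time_def)
  have T0: "AE x in M. 0 \<le> T x" by (rule AE_killing_time_nonneg[OF killing])
  show law: "law M (\<lambda>x. running_sup Y (T x) x) = distr M borel (\<lambda>x. path_sup (T x) (path_of Y x))"
    by (rule law_eq_distr) (measurable, use AE_running_sup T0 in eventually_elim, simp)
  define g where "g u = (\<integral>\<^sup>+x. (if path_sup u (path_of Y x) \<le> ereal y then 1 else 0) \<partial>M)" for u
  have [measurable]: "g \<in> borel_measurable borel" unfolding g_def by measurable
  have "emeasure (law M (\<lambda>x. running_sup Y (T x) x)) {..ereal y} =
      (\<integral>\<^sup>+z. indicator {..ereal y} z \<partial>distr M borel (\<lambda>x. path_sup (T x) (path_of Y x)))" by (simp add: law)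
  also have "\<dots> = (\<integral>\<^sup>+x. indicator {..ereal y} (path_sup (T x) (path_of Y x)) \<partial>M)"
    by (rule nn_integral_distr) measurable
  also have "\<dots> = (\<integral>\<^sup>+u. \<integral>\<^sup>+x. indicator {..ereal y} (path_sup u (path_of Y x)) \<partial>M \<partial>distr M borel T)"
    using indep_elements_nn_integral[OF ind, of "\<lambda>p. indicator {..ereal y} (path_sup (fst p) (fst (snd p)))"] by simp
  also have "\<dots> = (\<integral>\<^sup>+u. g u \<partial>distr M borel T)"
    unfolding g_def by (intro nn_integral_cong) (auto simp: indicator_def)
  also have "\<dots> = (\<integral>\<^sup>+x. g (T x) \<partial>M)" by (rule nn_integral_distr) measurable
  also have "\<dots> = (if \<beta> = 0 then total_sup_cdf y else
      \<integral>\<^sup>+t. ennreal (exponential_density \<beta> t) * sup_cdf t y \<partial>lborel)"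
  proof (cases "\<beta> = 0")
    case True
    then have "AE x in M. T x = \<infinity>" using killing by (simp add: killing_time_def)
    then have "(\<integral>\<^sup>+x. g (T x) \<partial>M) = (\<integral>\<^sup>+x. g \<infinity> \<partial>M)"
      by (intro nn_integral_cong_AE, eventually_elim) simp
    then show ?thesis using True by (simp add: emeasure_space_1 g_def total_sup_cdf_def)
  next
    case False
    then obtain U where U: "distributed M lborel U (exponential_density \<beta>)" "AE x in M. T x = ereal (U x)"
      using killing by (auto simp: killing_time_def)
    have "(\<integral>\<^sup>+x. g (T x) \<partial>M) = (\<integral>\<^sup>+x. g (ereal (U x)) \<partial>M)"
      using U(2) by (intro nn_integral_cong_AE, eventually_elim) simp
    also have "\<dots> = (\<integral>\<^sup>+t. ennreal (exponential_density \<beta> t) * g (ereal t) \<partial>lborel)"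
      by (rule distributed_nn_integral[OF U(1), symmetric]) measurable
    finally show ?thesis using False by (simp add: g_def sup_cdf_nn_integral)
  qed
  finally show "emeasure (law M (\<lambda>x. running_sup Y (T x) x)) {..ereal y} = (if \<beta> = 0 then total_sup_cdf y else
      \<integral>\<^sup>+t. ennreal (exponential_density \<beta> t) * sup_cdf t y \<partial>lborel)" .
qed

section \<open>The walk with steps Z and its maximum up to a random index\<close>

context
  fixes Z :: "nat \<Rightarrow> 'a \<Rightarrow> real"
  assumes iid: "indep_vars (\<lambda>_. borel) Z {1..}" and Z_law: "\<And>m. 1 \<le> m \<Longrightarrow> distr M borel (Z m) = step_law"
begin

lemma Z_measurable [measurable]: "1 \<le> m \<Longrightarrow> Z m \<in> borel_measurable M"
  using iid by (simp add: indep_vars_def)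

lemma partial_sum_measurable [measurable]: "(\<lambda>x. \<Sum>m=1..n. Z m x) \<in> borel_measurable M"
  by (intro borel_measurable_sum) auto

text \<open>Independence and the common step law make (Z_1, Z_2, ...) a sample of the infinite
  product measure. The reindexing by \<open>Suc\<close> reconciles Z, which starts at 1, with walk
  sequences, which start at 0.\<close>

lemma walk_cdf_eq:
  "W.walk_cdf k y = (\<integral>\<^sup>+x. (if \<forall>n. enat n \<le> enat k \<longrightarrow> (\<Sum>m=1..n. Z m x) \<le> y then 1 else 0) \<partial>M)"
proof -
  let ?B = "Pi\<^sub>M {1..} (\<lambda>_. borel :: real measure) :: (nat \<Rightarrow> real) measure"
  have "distr M ?B (\<lambda>x. \<lambda>i\<in>{1..}. Z i x) = Pi\<^sub>M {1..} (\<lambda>i. distr M borel (Z i))"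
    using iid by (subst (asm) indep_vars_iff_distr_eq_PiM') auto
  also have "\<dots> = Pi\<^sub>M {1..} (\<lambda>_. step_law)"
    by (rule PiM_cong) (auto simp: Z_law)
  finally have joint: "distr M ?B (\<lambda>x. \<lambda>i\<in>{1..}. Z i x) = Pi\<^sub>M {1..} (\<lambda>_. step_law)" .
  have reindex: "W.S = distr (Pi\<^sub>M {1..} (\<lambda>_. step_law)) W.S (\<lambda>z n. z (Suc n))"
    using distr_PiM_reindex[of "{1..}" "\<lambda>_. step_law" Suc UNIV] W.prob_space by (simp add: restrict_UNIV)
  have m1: "(\<lambda>x. \<lambda>i\<in>{1..}. Z i x) \<in> measurable M ?B" by (rule measurable_restrict) auto
  have m2: "(\<lambda>z n. z (Suc n)) \<in> measurable ?B W.S"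
    by (subst measurable_cong_sets[OF refl W.sets_S])
      (intro measurable_PiM_single' measurable_component_singleton, auto)
  have shift: "rw (\<lambda>n. z (Suc n)) n = (\<Sum>m=1..n. z m)" for z n
    by (simp add: rw_def sum.atLeast1_atMost_eq)
  define f :: "(nat \<Rightarrow> real) \<Rightarrow> ennreal" where "f w = (if \<forall>n\<le>k. rw w n \<le> y then 1 else 0)" for w
  have f: "f \<in> borel_measurable W.S" unfolding f_def by measurable
  have f2: "(\<lambda>z. f (\<lambda>n. z (Suc n))) \<in> borel_measurable ?B" by (rule measurable_compose[OF m2 f])
  have "W.walk_cdf k y = (\<integral>\<^sup>+w. f w \<partial>W.S)" by (simp add: W.walk_cdf_def f_def)
  also have "\<dots> = (\<integral>\<^sup>+w. f w \<partial>distr (distr M ?B (\<lambda>x. \<lambda>i\<in>{1..}. Z i x)) W.S (\<lambda>z n. z (Suc n)))"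
    unfolding joint reindex[symmetric] ..
  also have "\<dots> = (\<integral>\<^sup>+z. f (\<lambda>n. z (Suc n)) \<partial>distr M ?B (\<lambda>x. \<lambda>i\<in>{1..}. Z i x))"
    by (rule nn_integral_distr) (use m2 f in auto)
  also have "\<dots> = (\<integral>\<^sup>+x. f (\<lambda>n. (\<lambda>i\<in>{1..}. Z i x) (Suc n)) \<partial>M)"
    by (rule nn_integral_distr[OF m1]) (use f2 in simp)
  also have "\<dots> = (\<integral>\<^sup>+x. (if \<forall>n. enat n \<le> enat k \<longrightarrow> (\<Sum>m=1..n. Z m x) \<le> y then 1 else 0) \<partial>M)"
  proof (intro nn_integral_cong)
    fix x
    have "(\<Sum>m=1..n. (\<lambda>m\<in>{1..}. Z m x) m) = (\<Sum>m=1..n. Z m x)" for n by (intro sum.cong) auto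
    then show "f (\<lambda>n. (\<lambda>i\<in>{1..}. Z i x) (Suc n)) =
        (if \<forall>n. enat n \<le> enat k \<longrightarrow> (\<Sum>m=1..n. Z m x) \<le> y then 1 else 0)"
      unfolding f_def shift by (simp only: enat_ord_simps)
  qed
  finally show ?thesis .
qed

lemma walk_cdf_tendsto:
  "(\<lambda>k. W.walk_cdf k y) \<longlonglongrightarrow> (\<integral>\<^sup>+x. (if \<forall>n. enat n \<le> \<infinity> \<longrightarrow> (\<Sum>m=1..n. Z m x) \<le> y then 1 else 0) \<partial>M)"
  unfolding walk_cdf_eq
proof (rule nn_integral_bounded_convergence)
  show "AE x in M. (\<lambda>k. if \<forall>n. enat n \<le> enat k \<longrightarrow> (\<Sum>m=1..n. Z m x) \<le> y then 1 else 0 :: ennreal)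
    \<longlonglongrightarrow> (if \<forall>n. enat n \<le> \<infinity> \<longrightarrow> (\<Sum>m=1..n. Z m x) \<le> y then 1 else 0)"
  proof (rule AE_I2, rule tendsto_eventually)
    fix x
    show "\<forall>\<^sub>F k in sequentially. (if \<forall>n. enat n \<le> enat k \<longrightarrow> (\<Sum>m=1..n. Z m x) \<le> y then 1 else 0 :: ennreal) =
      (if \<forall>n. enat n \<le> \<infinity> \<longrightarrow> (\<Sum>m=1..n. Z m x) \<le> y then 1 else 0)"
    proof (cases "\<forall>n. (\<Sum>m=1..n. Z m x) \<le> y")
      case False
      then obtain n0 where "\<not> (\<Sum>m=1..n0. Z m x) \<le> y" by blast
      then show ?thesis
        by (intro eventually_mono[OF eventually_ge_at_top[of n0]]) auto
    qed simp
  qed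
qed measurable

text \<open>Independence of the number of inspections from the steps allows the random index to be
  frozen at x while the walk is averaged over x'.\<close>

lemma emeasure_law_walk_max:
  assumes ind: "indep_elements M (count_space UNIV) N (Pi\<^sub>M {1..} (\<lambda>_. borel)) (\<lambda>x. \<lambda>m\<in>{1..}. Z m x)"
  shows "emeasure (law M (walk_max Z N)) {..ereal y} =
      (\<integral>\<^sup>+x. \<integral>\<^sup>+x'. (if \<forall>n. enat n \<le> N x \<longrightarrow> (\<Sum>m=1..n. Z m x') \<le> y then 1 else 0) \<partial>M \<partial>M)"
proof -
  let ?B = "Pi\<^sub>M {1..} (\<lambda>_. borel :: real measure) :: (nat \<Rightarrow> real) measure"
  have N [measurable]: "N \<in> measurable M (count_space UNIV)"
    using ind by (simp add: indep_elements_def)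
  have [measurable]: "walk_max Z N \<in> borel_measurable M"
    by (rule walk_max_measurable) measurable
  have law: "law M (walk_max Z N) = distr M borel (walk_max Z N)"
    by (rule law_eq_distr) auto
  define f :: "enat \<times> (nat \<Rightarrow> real) \<Rightarrow> ennreal" where
    "f p = (if \<forall>n. enat n \<le> fst p \<longrightarrow> (\<Sum>m=1..n. snd p m) \<le> y then 1 else 0)" for p
  have f: "f \<in> borel_measurable (count_space UNIV \<Otimes>\<^sub>M ?B)"
  proof -
    have [measurable]: "(\<lambda>p. \<Sum>m=1..n. snd p m) \<in> borel_measurable (count_space UNIV \<Otimes>\<^sub>M ?B)" for n
      by (intro borel_measurable_sum measurable_compose[OF measurable_snd measurable_component_singleton]) auto
    show ?thesis unfolding f_def by measurable
  qed
  have fZ: "f (a, \<lambda>m\<in>{1..}. Z m x) = (if \<forall>n. enat n \<le> a \<longrightarrow> (\<Sum>m=1..n. Z m x) \<le> y then 1 else 0)" for a x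
  proof -
    have "(\<Sum>m=1..n. (\<lambda>m\<in>{1..}. Z m x) m) = (\<Sum>m=1..n. Z m x)" for n by (intro sum.cong) auto
    then show ?thesis unfolding f_def fst_conv snd_conv by (simp only:)
  qed
  have "emeasure (law M (walk_max Z N)) {..ereal y} = (\<integral>\<^sup>+z. indicator {..ereal y} z \<partial>distr M borel (walk_max Z N))"
    by (simp add: law)
  also have "\<dots> = (\<integral>\<^sup>+x. indicator {..ereal y} (walk_max Z N x) \<partial>M)" by (rule nn_integral_distr) measurable
  also have "\<dots> = (\<integral>\<^sup>+x. f (N x, \<lambda>m\<in>{1..}. Z m x) \<partial>M)"
    unfolding fZ by (intro nn_integral_cong) (simp add: indicator_def walk_max_le_iff)
  also have "\<dots> = (\<integral>\<^sup>+a. \<integral>\<^sup>+x. f (a, \<lambda>m\<in>{1..}. Z m x) \<partial>M \<partial>distr M (count_space UNIV) N)"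
    by (rule indep_elements_nn_integral[OF ind f])
  also have "\<dots> = (\<integral>\<^sup>+x. \<integral>\<^sup>+x'. f (N x, \<lambda>m\<in>{1..}. Z m x') \<partial>M \<partial>M)"
    by (rule nn_integral_distr) auto
  finally show "emeasure (law M (walk_max Z N)) {..ereal y} =
      (\<integral>\<^sup>+x. \<integral>\<^sup>+x'. (if \<forall>n. enat n \<le> N x \<longrightarrow> (\<Sum>m=1..n. Z m x') \<le> y then 1 else 0) \<partial>M \<partial>M)"
    unfolding fZ .
qed

end

end

text \<open>Both laws are probability measures on \<open>ereal\<close>, so it is enough to compare
  them on rays ending at real y. With c the distribution function of the walk maximum, both values
  are the mean of c (y - \<open>end_sup\<close>).\<close>

theorem theorem2:
  fixes M :: "'a measure"
    and Y :: "real \<Rightarrow> 'a \<Rightarrow> real"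
    and \<beta> \<omega> :: real
    and T :: "'a \<Rightarrow> ereal"
    and T' :: "'a \<Rightarrow> real"
    and I Z :: "nat \<Rightarrow> 'a \<Rightarrow> real"
  assumes levy: "levy_process M Y"
    and omega_pos: "\<omega> > 0"
    and beta_nonneg: "\<beta> \<ge> 0"
    and neg_mean: "\<beta> = 0 \<Longrightarrow> ext_expectation M (Y 1) < 0"
    and T'_exp: "distributed M lborel T' (exponential_density (\<beta> + \<omega>))"
    and T'_indep: "indep_elements M borel T' (PiM {0..} (\<lambda>_. borel)) (path_of Y)"
    and I_poisson: "poisson_epochs M \<omega> I"
    and I_indep: "indep_elements M (PiM UNIV (\<lambda>_. borel)) (\<lambda>x n. I n x)
                    (PiM {0..} (\<lambda>_. borel)) (path_of Y)"
    and T_exp: "killing_time M \<beta> T"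
    and T_indep: "indep_elements M borel T
                    (PiM {0..} (\<lambda>_. borel) \<Otimes>\<^sub>M PiM UNIV (\<lambda>_. borel))
                    (\<lambda>x. (path_of Y x, \<lambda>n. I n x))"
    and Z_iid: "prob_space.indep_vars M (\<lambda>_. borel) Z {1..}"
    and Z_law: "\<And>m. m \<ge> 1 \<Longrightarrow> law M (Z m) = law M (\<lambda>x. Y (T' x) x)"
    and Z_indep: "indep_elements M (count_space UNIV) (num_inspections I T)
                    (PiM {1..} (\<lambda>_. borel)) (\<lambda>x. \<lambda>m\<in>{1..}. Z m x)"
  shows "law M (\<lambda>x. running_sup Y (T x) x) =
         ereal_convolution (law M (walk_max Z (num_inspections I T)))
                           (law M (\<lambda>x. running_sup Y (ereal (T' x)) x))"
proof -
  interpret exp_levy M Y "\<beta> + \<omega>"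
    by unfold_locales (use levy omega_pos beta_nonneg in auto)
  let ?N = "num_inspections I T"
  have N [measurable]: "?N \<in> measurable M (count_space UNIV)"
    using Z_indep by (simp add: indep_elements_def)
  have [measurable]: "T \<in> borel_measurable M" "T' \<in> borel_measurable M"
    using T_exp distributed_measurable[OF T'_exp] by (simp_all add: killing_time_def)
  have "\<forall>m\<in>{1..}. Z m \<in> borel_measurable M"
    using Z_iid unfolding indep_vars_def2 by (rule conjunct1)
  then have Z_meas: "Z m \<in> borel_measurable M" if "1 \<le> m" for m using that by simp
  have Z_step: "distr M borel (Z m) = step_law" if "1 \<le> m" for m
    using law_eq_distr[OF Z_meas[OF that], of "Z m"] Z_law[of m] that
      law_value_at_exponential[OF T'_exp T'_indep] by simp
  note sup = emeasure_law_killed_sup[OF T_exp T_indep]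
  define c where "c y = emeasure (law M (walk_max Z ?N)) {..ereal y}" for y
  have c_eq: "c y = (\<integral>\<^sup>+x. \<integral>\<^sup>+x'. (if \<forall>n. enat n \<le> ?N x \<longrightarrow> (\<Sum>m=1..n. Z m x') \<le> y then 1 else 0) \<partial>M \<partial>M)" for y
    unfolding c_def by (rule emeasure_law_walk_max[OF Z_iid _ Z_indep]) (rule Z_step)
  have walk_cdf: "W.walk_cdf k y = (\<integral>\<^sup>+x. (if \<forall>n. enat n \<le> enat k \<longrightarrow> (\<Sum>m=1..n. Z m x) \<le> y then 1 else 0) \<partial>M)" for k y
    by (rule walk_cdf_eq[OF Z_iid]) (rule Z_step)
  have walk_meas [measurable]: "walk_max Z ?N \<in> borel_measurable M"
    by (rule walk_max_measurable[OF N Z_meas])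
  have "law M (walk_max Z ?N) = distr M borel (walk_max Z ?N)"
    by (rule law_eq_distr[OF walk_meas]) simp
  then have prob_W: "prob_space (law M (walk_max Z ?N))" and sets_W: "sets (law M (walk_max Z ?N)) = sets borel"
    by (simp_all add: prob_space_distr)
  have conv: "emeasure (ereal_convolution (law M (walk_max Z ?N)) (law M (\<lambda>x. running_sup Y (ereal (T' x)) x))) {..ereal y} =
      (\<integral>\<^sup>+p. c (y - end_sup p) \<partial>(Exp \<Otimes>\<^sub>M M))" for y
    unfolding c_def by (rule emeasure_convolution_sup[OF T'_exp T'_indep prob_W sets_W])
  have cdf: "emeasure (law M (\<lambda>x. running_sup Y (T x) x)) {..ereal y} = (\<integral>\<^sup>+p. c (y - end_sup p) \<partial>(Exp \<Otimes>\<^sub>M M))" for y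
  proof (cases "\<beta> = 0")
    case True
    then have "AE x in M. T x = \<infinity>" using T_exp by (simp add: killing_time_def)
    then have N_inf: "AE x in M. ?N x = \<infinity>"
    proof eventually_elim
      case (elim x)
      \<comment> \<open>With T infinite every epoch is counted.\<close>
      then have "{n. 1 \<le> n \<and> ereal (I n x) \<le> T x} = {1..}" by auto
      then show ?case by (simp add: num_inspections_def infinite_Ici)
    qed
    have [measurable]: "(\<lambda>x. \<Sum>m=1..n. Z m x) \<in> borel_measurable M" for n
      by (intro borel_measurable_sum Z_meas) simp
    have c_inf: "c y = (\<integral>\<^sup>+x. (if \<forall>n. enat n \<le> \<infinity> \<longrightarrow> (\<Sum>m=1..n. Z m x) \<le> y then 1 else 0) \<partial>M)" (is "_ = ?c") for y
    proof -
      have "c y = (\<integral>\<^sup>+x. ?c \<partial>M)"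
        unfolding c_eq by (rule nn_integral_cong_AE) (use N_inf in eventually_elim, simp)
      then show ?thesis by (simp add: emeasure_space_1)
    qed
    have c: "(\<lambda>k. W.walk_cdf k y) \<longlonglongrightarrow> c y" for y
      unfolding c_inf by (rule walk_cdf_tendsto[OF Z_iid]) (rule Z_step)
    have [measurable]: "c \<in> borel_measurable borel"
      unfolding c_inf[abs_def] by measurable
    have "(\<lambda>k. \<integral>\<^sup>+p. W.walk_cdf k (y - end_sup p) \<partial>(Exp \<Otimes>\<^sub>M M)) \<longlonglongrightarrow> (\<integral>\<^sup>+p. c (y - end_sup p) \<partial>(Exp \<Otimes>\<^sub>M M))"
      by (rule P.nn_integral_bounded_convergence) (auto simp: W.walk_cdf_le_1 c)
    \<comment> \<open>By \<open>erlang_sup_cdf_eq\<close> the same sequence also tends to the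
      distribution function of the all-time supremum, so the limits agree.\<close>
    then have "(\<integral>\<^sup>+p. c (y - end_sup p) \<partial>(Exp \<Otimes>\<^sub>M M)) = total_sup_cdf y"
      unfolding erlang_sup_cdf_eq[symmetric] using erlang_sup_cdf_tendsto by (rule LIMSEQ_unique)
    then show ?thesis using True by (simp add: sup(2))
  next
    case False
    then have \<beta>: "0 < \<beta>" using beta_nonneg by simp
    have I_T: "indep_elements M borel T (Pi\<^sub>M UNIV (\<lambda>_. borel)) (\<lambda>x n. I n x)"
      using indep_elements_compose[OF T_indep measurable_snd] by simp
    interpret poisson_killing M \<beta> \<omega> I T
      by unfold_locales (use omega_pos beta_nonneg I_poisson T_exp I_T in auto)
    \<comment> \<open>These weights occur twice: as the law of the number of inspections, and as the
      weight of k + 1 phases of rate \<beta> + \<omega> in the exponential law of rate \<beta>. This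
      coincidence matches the two sides term by term.\<close>
    define p where "p k = \<beta> / (\<beta> + \<omega>) * (1 - \<beta> / (\<beta> + \<omega>)) ^ k" for k
    note N_law = num_inspections_geometric[OF \<beta> N]
    have c: "c y = (\<Sum>k. ennreal (p k) * W.walk_cdf k y)" for y
    proof -
      have "c y = (\<integral>\<^sup>+x. (\<Sum>k. indicator {x\<in>space M. ?N x = enat k} x * W.walk_cdf k y) \<partial>M)"
        unfolding c_eq
      proof (rule nn_integral_cong_AE)
        show "AE x in M. (\<integral>\<^sup>+x'. (if \<forall>n. enat n \<le> ?N x \<longrightarrow> (\<Sum>m=1..n. Z m x') \<le> y then 1 else 0) \<partial>M) =
            (\<Sum>k. indicator {x\<in>space M. ?N x = enat k} x * W.walk_cdf k y)"
          using N_law(2) AE_space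
        proof eventually_elim
          case (elim x)
          then obtain j where j: "?N x = enat j" by auto
          have "(\<Sum>k. indicator {x\<in>space M. ?N x = enat k} x * W.walk_cdf k y) =
              (\<Sum>k\<in>{j}. indicator {x\<in>space M. ?N x = enat k} x * W.walk_cdf k y)"
            by (rule suminf_finite) (auto simp: j)
          also have "\<dots> = W.walk_cdf j y" using elim by (simp add: j)
          finally show ?case unfolding j walk_cdf by simp
        qed
      qed
      also have "\<dots> = (\<Sum>k. \<integral>\<^sup>+x. indicator {x\<in>space M. ?N x = enat k} x * W.walk_cdf k y \<partial>M)"
        by (rule nn_integral_suminf) measurable
      also have "\<dots> = (\<Sum>k. ennreal (p k) * W.walk_cdf k y)"
        by (intro suminf_cong) (simp add: nn_integral_multc N_law(1) p_def)
      finally show ?thesis .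
    qed
    have "(\<integral>\<^sup>+q. c (y - end_sup q) \<partial>(Exp \<Otimes>\<^sub>M M)) =
        (\<Sum>k. \<integral>\<^sup>+q. ennreal (p k) * W.walk_cdf k (y - end_sup q) \<partial>(Exp \<Otimes>\<^sub>M M))"
      unfolding c by (rule nn_integral_suminf) measurable
    also have "\<dots> = (\<Sum>k. ennreal (p k) * erlang_sup_cdf k y)"
      unfolding erlang_sup_cdf_eq by (intro suminf_cong nn_integral_cmult) measurable
    also have "\<dots> = (\<integral>\<^sup>+t. ennreal (exponential_density \<beta> t) * sup_cdf t y \<partial>lborel)"
      unfolding p_def using exponential_sup_cdf[OF \<beta>] omega_pos by simp
    finally show ?thesis using False by (simp add: sup(2))
  qed
  show ?thesis
  proof (rule ereal_measure_eqI)
    show "prob_space (law M (\<lambda>x. running_sup Y (T x) x))"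
      unfolding sup(1) by (rule prob_space_distr) measurable
    show "sets (law M (\<lambda>x. running_sup Y (T x) x)) = sets borel" by (simp add: law_def)
    show "sets (ereal_convolution (law M (walk_max Z ?N)) (law M (\<lambda>x. running_sup Y (ereal (T' x)) x))) = sets borel"
      by (simp add: ereal_convolution_def)
    show "prob_space (ereal_convolution (law M (walk_max Z ?N)) (law M (\<lambda>x. running_sup Y (ereal (T' x)) x)))"
    proof (rule prob_space_ereal_convolution[OF prob_W _ sets_W])
      show "prob_space (law M (\<lambda>x. running_sup Y (ereal (T' x)) x))"
        unfolding law_sup_at_exponential[OF T'_exp T'_indep] by (rule prob_space_distr) measurable
    qed (simp add: law_def)
  qed (simp add: cdf conv)
qed

end
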